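(* Let $d\ge1$ and let $\sigma:\mathbb{R}^d\to\mathbb{R}_+$ be a random density satisfying the following conditions, where $T$ is its associated pseudometric. 1. (Measurability) Almost surely, $\sigma$ is measurable. 2. (Finite moment) For every $x\in\mathbb{R}^d$, $\mathbb{E}\int_{[0,x]}\sigma<+\infty$, where $[0,x]$ is the segment. 3. (Ergodicity) The translations of $\mathbb{R}^d$ are ergodic for the law of $\sigma$. 4. (Decay of instant one-arms) There exist $\eta,R_0>0$ such that for all $R\ge R_0$, $\mathbb{P}[T(A_R)=0]\le R^{-(d-1+\eta)}$. 5. (Exponential quasi independence) There exists $\beta>0$ such that for every $\alpha>0$ there exists $Q_0$ such that for every $Q\ge Q_0$, $\mathrm{Ind}^-(Q,Q^{1+\alpha})\le\exp(-Q^\beta)$. Let $\mu(v)=\lim_{n\to\infty}\frac1nT(0,nv)$, $v\in\mathbb{R}^d$ (almost sure and $L^1$ limit, which exists and is deterministic under 1, 2, 3). Then $\mu$ is a norm.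
   Context: A random density is a random function $\sigma:\mathbb{R}^d\to\mathbb{R}_+$. Its associated pseudometric is $$T(x,y)=\inf_{\gamma}\int_\gamma\sigma,$$ the infimum being over piecewise $C^1$ paths $\gamma$ from $x$ to $y$ and the integral being with respect to Euclidean arc length. Translations act on densities by $\tau_v(\sigma)=\sigma\circ\tau_v$, $\tau_v(x)=x+v$. The action $\tau_v$ is ergodic for the law of $\sigma$ if the law is $\tau_v$-invariant and every $\tau_v$-invariant event has probability $0$ or $1$; the translations are ergodic if this holds for every $v\ne0$. For $R>1$: $A_R=B(0,R)\setminus B(0,1)$ (Euclidean balls) and $T(A_R)=\inf_{x\in S(0,1),\,y\in S(0,R)}T(x,y)$. The set of real functions on $\mathbb{R}^d$ carries the pointwise partial order. An event $E$ is decreasing if $\varphi\in E$ and $\varphi\ge\psi$ imply $\psi\in E$. For $A\subset\mathbb{R}^d$, $\mathcal{A}^-$ is the set of decreasing events depending only on the values of $\sigma$ over $A$. For $Q,S>0$, $$\mathrm{Ind}^-(Q,S)=\sup\big|\mathbb{P}[E_A\cap E_B]-\mathbb{P}[E_A]\mathbb{P}[E_B]\big|,$$ the supremum being over $A,B\subset\mathbb{R}^d$ of diameter at most $S$ with $\mathrm{dist}(A,B)>Q$, and $E_A\in\mathcal{A}^-$, $E_B\in\mathcal{B}^-$. *)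

theory Defs
  imports "HOL-Probability.Probability"
begin

section \<open>The pseudometric of a density\<close>

type_synonym 'd density = "real ^ 'd \<Rightarrow> real"

text \<open>
  Integrals of densities and distances take values in \<^typ>\<open>ennreal\<close>: nothing forces a density to
  be integrable along any path.
\<close>

definition arc_integral :: "'d::finite density \<Rightarrow> (real \<Rightarrow> real ^ 'd) \<Rightarrow> ennreal" where
  "arc_integral \<phi> \<gamma> =
     (\<integral>\<^sup>+ t \<in> {0..1}. ennreal (\<phi> (\<gamma> t)) * ennreal (norm (vector_derivative \<gamma> (at t))) \<partial>lborel)"

definition T :: "'d::finite density \<Rightarrow> real ^ 'd \<Rightarrow> real ^ 'd \<Rightarrow> ennreal" where
  "T \<phi> x y =
     (INF \<gamma> \<in> {\<gamma>. valid_path \<gamma> \<and> pathstart \<gamma> = x \<and> pathfinish \<gamma> = y}. arc_integral \<phi> \<gamma>)"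

definition T_annulus :: "'d::finite density \<Rightarrow> real \<Rightarrow> ennreal" where
  "T_annulus \<phi> R = (INF x \<in> sphere 0 1. INF y \<in> sphere 0 R. T \<phi> x y)"


section \<open>Random densities\<close>

text \<open>
  The events are the members of a sigma-algebra \<open>F\<close> on the set of all real functions on
  \<open>\<real>\<^sup>d\<close>.  The product sigma-algebra is too small to serve as \<open>F\<close>: distances depend on uncountably
  many values of the density. So \<open>F\<close> is a parameter, required only to make the values of the
  density, its integrals along segments, and the distances random variables.
\<close>

definition density_events :: "'d::finite density measure \<Rightarrow> bool" where
  "density_events F \<longleftrightarrow>
     space F = UNIV \<and>
     (\<forall>x. (\<lambda>\<phi>. \<phi> x) \<in> borel_measurable F) \<and>
     (\<forall>x. (\<lambda>\<phi>. arc_integral \<phi> (linepath 0 x)) \<in> borel_measurable F) \<and>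
     (\<forall>x y. (\<lambda>\<phi>. T \<phi> x y) \<in> borel_measurable F) \<and>
     (\<forall>R>1. (\<lambda>\<phi>. T_annulus \<phi> R) \<in> borel_measurable F)"

definition random_density ::
    "'w measure \<Rightarrow> 'd::finite density measure \<Rightarrow> ('w \<Rightarrow> 'd density) \<Rightarrow> bool" where
  "random_density M F \<sigma> \<longleftrightarrow>
     prob_space M \<and> density_events F \<and> \<sigma> \<in> measurable M F \<and>
     (\<forall>\<omega> \<in> space M. \<forall>x. 0 \<le> \<sigma> \<omega> x)"


section \<open>Ergodicity of translations\<close>

definition translate :: "real ^ 'd \<Rightarrow> 'd::finite density \<Rightarrow> 'd density" where
  "translate v \<phi> = (\<lambda>x. \<phi> (x + v))"

text \<open>Here and below \<open>L\<close> is the law of the density, a measure on a space of functions.\<close>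

definition ergodic_translation :: "'d::finite density measure \<Rightarrow> real ^ 'd \<Rightarrow> bool" where
  "ergodic_translation L v \<longleftrightarrow>
     translate v \<in> measurable L L \<and> distr L L (translate v) = L \<and>
     (\<forall>E \<in> sets L. translate v -` E = E \<longrightarrow> measure L E = 0 \<or> measure L E = 1)"


section \<open>Quasi independence of decreasing events\<close>

definition decreasing_event :: "'d::finite density set \<Rightarrow> bool" where
  "decreasing_event E \<longleftrightarrow> (\<forall>\<phi> \<psi>. \<phi> \<in> E \<and> \<psi> \<le> \<phi> \<longrightarrow> \<psi> \<in> E)"

definition depends_only_on :: "'d::finite density set \<Rightarrow> (real ^ 'd) set \<Rightarrow> bool" where
  "depends_only_on E A \<longleftrightarrow> (\<forall>\<phi> \<psi>. (\<forall>x\<in>A. \<phi> x = \<psi> x) \<longrightarrow> (\<phi> \<in> E \<longleftrightarrow> \<psi> \<in> E))"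

definition decreasing_events_on ::
    "'d::finite density measure \<Rightarrow> (real ^ 'd) set \<Rightarrow> 'd density set set" where
  "decreasing_events_on L A = {E \<in> sets L. decreasing_event E \<and> depends_only_on E A}"

text \<open>
  Boundedness is explicit because \<^const>\<open>diameter\<close> is unspecified on unbounded sets. Empty
  sets are excluded by \<^const>\<open>setdist\<close> being zero on them; they would contribute only zeros
  to the supremum.
\<close>

definition Ind_dec :: "'d::finite density measure \<Rightarrow> real \<Rightarrow> real \<Rightarrow> real" where
  "Ind_dec L Q S =
     Sup {\<bar>measure L (E\<^sub>A \<inter> E\<^sub>B) - measure L E\<^sub>A * measure L E\<^sub>B\<bar> | A B E\<^sub>A E\<^sub>B.
            bounded A \<and> diameter A \<le> S \<and> bounded B \<and> diameter B \<le> S \<and> Q < setdist A B \<and>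
            E\<^sub>A \<in> decreasing_events_on L A \<and> E\<^sub>B \<in> decreasing_events_on L B}"


section \<open>The time constant\<close>

text \<open>
  In the \<open>L\<^sup>1\<close> convergence, \<open>\<bar>X - c\<bar>\<close> is written \<open>max X c - min X c\<close>: subtraction of extended
  nonnegative reals is truncated, and with this form an infinite distance counts as infinite.
\<close>

definition is_time_limit ::
    "'w measure \<Rightarrow> ('w \<Rightarrow> 'd::finite density) \<Rightarrow> real ^ 'd \<Rightarrow> real \<Rightarrow> bool" where
  "is_time_limit M \<sigma> v c \<longleftrightarrow>
     0 \<le> c \<and>
     (AE \<omega> in M. (\<lambda>n. T (\<sigma> \<omega>) 0 (real n *\<^sub>R v) / of_nat n) \<longlonglongrightarrow> ennreal c) \<and>
     (\<lambda>n. \<integral>\<^sup>+ \<omega>. max (T (\<sigma> \<omega>) 0 (real n *\<^sub>R v) / of_nat n) (ennreal c)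
                - min (T (\<sigma> \<omega>) 0 (real n *\<^sub>R v) / of_nat n) (ennreal c) \<partial>M) \<longlonglongrightarrow> 0"

definition time_constant ::
    "'w measure \<Rightarrow> ('w \<Rightarrow> 'd::finite density) \<Rightarrow> real ^ 'd \<Rightarrow> real" where
  "time_constant M \<sigma> v = (THE c. is_time_limit M \<sigma> v c)"

definition is_norm :: "('a::real_vector \<Rightarrow> real) \<Rightarrow> bool" where
  "is_norm N \<longleftrightarrow>
     (\<forall>x. 0 \<le> N x) \<and> (\<forall>x. N x = 0 \<longleftrightarrow> x = 0) \<and>
     (\<forall>a x. N (a *\<^sub>R x) = \<bar>a\<bar> * N x) \<and> (\<forall>x y. N (x + y) \<le> N x + N y)"

end

theory Submission
  imports Defs
begin

text \<open>
  Kingman's subadditive ergodic theorem gives the limit \<open>\<mu>(v) = lim E T(0, n v) / n\<close>; subadditivity and symmetry of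
  \<open>E T(0, \<cdot>)\<close> make \<open>\<mu>\<close> a seminorm. Positivity is a renormalization argument. Call a cube of side \<open>2 q\<close> cheap at scale
  \<open>R\<close> if some unit ball on its boundary is joined to distance \<open>R\<close> at cost less than \<open>\<delta>\<close>. The boundary is covered
  by \<open>O(q\<^sup>d\<^sup>-\<^sup>1)\<close> unit balls, so at a large first scale the one-arm estimate makes cheap cubes unlikely. A cheap
  cube at scale \<open>R\<^sub>k\<^sub>+\<^sub>1 = 2\<^sup>k\<^sup>+\<^sup>5 R\<^sub>k\<close> forces two cheap cubes at scale \<open>R\<^sub>k\<close> at distance more than \<open>R\<^sub>k\<close> from each other.
  Being cheap is a decreasing event, so quasi independence squares the probability, which beats the number of
  pairs of cubes and keeps the probabilities small at all scales, while \<open>\<delta>\<^sub>k\<close> remains proportional to \<open>R\<^sub>k\<close>.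
\<close>

text \<open>Two losses shape the renormalization. At each scale three pieces of a path, and up to
  two more by rounding, are given up, and every cube adds an overhead proportional to its size. With
  a fixed ratio between scales this would cost a fixed factor of the speed each time. So the ratio
  \<open>2 ^ (k + 5)\<close> grows and the half-side of a cube is only
  \<open>R / (d * 2 ^ (k + 6))\<close>; the relative losses are then summable. The price is a number
  of pairs of cubes that grows like \<open>B ^ k\<close> with \<open>B = 2 ^ (4 * d)\<close>. The
  induction hypothesis is therefore a geometric decay \<open>p k \<le> \<epsilon> / B ^ k\<close>:
  squaring it gains two factors \<open>B ^ k\<close> against one, and the independence error is
  super-polynomially small in a radius of at least \<open>R0 * 2 ^ k\<close>. The one-arm estimate
  concerns only cost exactly 0. Continuity of the measure extends it to small positive cost without
  quantitative control, which is enough because it enters at the first scale alone. Independence is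
  used with \<open>\<alpha> = 1\<close>: the events live in balls of diameter of order
  \<open>R\<close>, below \<open>R ^ 2\<close>.\<close>

section \<open>Lower integrals\<close>

text \<open>The integral of a non-measurable function is a lower integral. It is attained by a measurable minorant, so
  additivity over sets and affine substitution need no measurability of the density.\<close>

lemma nn_integral_minorant:
  fixes f :: "'a \<Rightarrow> ennreal"
  obtains g where "g \<in> borel_measurable M" "\<And>x. g x \<le> f x" "(\<integral>\<^sup>+ x. g x \<partial>M) = (\<integral>\<^sup>+ x. f x \<partial>M)"
proof -
  let ?S = "{g. simple_function M g \<and> g \<le> f}"
  have ne: "integral\<^sup>S M ` ?S \<noteq> {}"
    by (auto intro!: exI[of _ "\<lambda>_. 0"] simp: le_fun_def)
  obtain s :: "nat \<Rightarrow> ennreal" where s: "range s \<subseteq> integral\<^sup>S M ` ?S" "Sup (integral\<^sup>S M ` ?S) = Sup (range s)"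
    using ennreal_Sup_countable_SUP[OF ne] by auto
  have "\<forall>n. \<exists>g. g \<in> ?S \<and> s n = integral\<^sup>S M g" using s(1) by blast
  then obtain G where G: "\<And>n. G n \<in> ?S" "\<And>n. s n = integral\<^sup>S M (G n)" by metis
  \<comment> \<open>Countably many simple minorants already exhaust the supremum that defines the
    integral, and their supremum stays measurable.\<close>
  define g where "g = (\<lambda>x. SUP n. G n x)"
  have mg: "g \<in> borel_measurable M"
    unfolding g_def using G(1) by (intro borel_measurable_SUP) (auto intro: borel_measurable_simple_function)
  have le: "g x \<le> f x" for x
    unfolding g_def using G(1) by (auto intro!: SUP_least simp: le_fun_def)
  have "(\<integral>\<^sup>+ x. f x \<partial>M) = Sup (range s)" using s(2) by (simp add: nn_integral_def)
  also have "\<dots> \<le> (\<integral>\<^sup>+ x. g x \<partial>M)"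
  proof (intro SUP_least)
    fix n
    have "s n = (\<integral>\<^sup>+ x. G n x \<partial>M)" using G by (simp add: nn_integral_eq_simple_integral)
    also have "\<dots> \<le> (\<integral>\<^sup>+ x. g x \<partial>M)"
      unfolding g_def by (intro nn_integral_mono SUP_upper) auto
    finally show "s n \<le> (\<integral>\<^sup>+ x. g x \<partial>M)" .
  qed
  finally have "(\<integral>\<^sup>+ x. g x \<partial>M) = (\<integral>\<^sup>+ x. f x \<partial>M)"
    using le by (auto intro!: antisym[of "integral\<^sup>N M g"] nn_integral_mono)
  with mg le show ?thesis by (rule that)
qed

text \<open>Minorants of the two parts add up to a minorant of the whole. Conversely, one minorant
  of the whole splits measurably because \<open>A\<close> and \<open>B\<close> are measurable,
  although \<open>f\<close> need not be.\<close>

lemma nn_integral_Un_disjoint_nonmeasurable: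
  fixes f :: "'a \<Rightarrow> ennreal"
  assumes [measurable]: "A \<in> sets M" "B \<in> sets M" and disj: "A \<inter> B = {}"
  shows "(\<integral>\<^sup>+ x \<in> A \<union> B. f x \<partial>M) = (\<integral>\<^sup>+ x \<in> A. f x \<partial>M) + (\<integral>\<^sup>+ x \<in> B. f x \<partial>M)"
proof (rule antisym)
  obtain g where [measurable]: "g \<in> borel_measurable M" and g: "\<And>x. g x \<le> f x * indicator (A \<union> B) x"
    "(\<integral>\<^sup>+ x. g x \<partial>M) = (\<integral>\<^sup>+ x \<in> A \<union> B. f x \<partial>M)"
    using nn_integral_minorant[of M "\<lambda>x. f x * indicator (A \<union> B) x"] by blast
  have "g x = g x * indicator A x + g x * indicator B x" for x
    using g(1)[of x] disj by (auto simp: indicator_def)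
  then have "(\<integral>\<^sup>+ x. g x \<partial>M) = (\<integral>\<^sup>+ x. g x * indicator A x + g x * indicator B x \<partial>M)" by simp
  also have "\<dots> = (\<integral>\<^sup>+ x \<in> A. g x \<partial>M) + (\<integral>\<^sup>+ x \<in> B. g x \<partial>M)" by (intro nn_integral_add) auto
  also have "\<dots> \<le> (\<integral>\<^sup>+ x \<in> A. f x \<partial>M) + (\<integral>\<^sup>+ x \<in> B. f x \<partial>M)"
  proof (intro add_mono nn_integral_mono)
    fix x show "g x * indicator A x \<le> f x * indicator A x" "g x * indicator B x \<le> f x * indicator B x"
      using g(1)[of x] by (auto simp: indicator_def split: if_splits)
  qed
  finally show "(\<integral>\<^sup>+ x \<in> A \<union> B. f x \<partial>M) \<le> (\<integral>\<^sup>+ x \<in> A. f x \<partial>M) + (\<integral>\<^sup>+ x \<in> B. f x \<partial>M)"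
    using g(2) by simp
next
  obtain g where [measurable]: "g \<in> borel_measurable M" and g: "\<And>x. g x \<le> f x * indicator A x"
    "(\<integral>\<^sup>+ x. g x \<partial>M) = (\<integral>\<^sup>+ x \<in> A. f x \<partial>M)"
    using nn_integral_minorant[of M "\<lambda>x. f x * indicator A x"] by blast
  obtain h where [measurable]: "h \<in> borel_measurable M" and h: "\<And>x. h x \<le> f x * indicator B x"
    "(\<integral>\<^sup>+ x. h x \<partial>M) = (\<integral>\<^sup>+ x \<in> B. f x \<partial>M)"
    using nn_integral_minorant[of M "\<lambda>x. f x * indicator B x"] by blast
  have "(\<integral>\<^sup>+ x. g x \<partial>M) + (\<integral>\<^sup>+ x. h x \<partial>M) = (\<integral>\<^sup>+ x. g x + h x \<partial>M)"
    by (intro nn_integral_add[symmetric]) auto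
  also have "\<dots> \<le> (\<integral>\<^sup>+ x \<in> A \<union> B. f x \<partial>M)"
  proof (intro nn_integral_mono)
    fix x
    have "x \<notin> A \<or> x \<notin> B" using disj by blast
    then show "g x + h x \<le> f x * indicator (A \<union> B) x"
      using g(1)[of x] h(1)[of x] by (cases "x \<in> A"; cases "x \<in> B") simp_all
  qed
  finally show "(\<integral>\<^sup>+ x \<in> A. f x \<partial>M) + (\<integral>\<^sup>+ x \<in> B. f x \<partial>M) \<le> (\<integral>\<^sup>+ x \<in> A \<union> B. f x \<partial>M)"
    using g(2) h(2) by simp
qed

lemma nn_integral_real_affine_nonmeasurable:
  fixes f :: "real \<Rightarrow> ennreal"
  assumes c: "c \<noteq> 0"
  shows "(\<integral>\<^sup>+ x. f x \<partial>lborel) = ennreal \<bar>c\<bar> * (\<integral>\<^sup>+ x. f (t + c * x) \<partial>lborel)"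
proof (rule antisym)
  obtain g where [measurable]: "g \<in> borel_measurable lborel" and g: "\<And>x. g x \<le> f x"
    "(\<integral>\<^sup>+ x. g x \<partial>lborel) = (\<integral>\<^sup>+ x. f x \<partial>lborel)"
    using nn_integral_minorant[of lborel f] by blast
  have "(\<integral>\<^sup>+ x. f x \<partial>lborel) = ennreal \<bar>c\<bar> * (\<integral>\<^sup>+ x. g (t + c * x) \<partial>lborel)"
    using nn_integral_real_affine[of g c t] c g(2) by simp
  also have "\<dots> \<le> ennreal \<bar>c\<bar> * (\<integral>\<^sup>+ x. f (t + c * x) \<partial>lborel)"
    by (intro mult_left_mono nn_integral_mono g) auto
  finally show "(\<integral>\<^sup>+ x. f x \<partial>lborel) \<le> ennreal \<bar>c\<bar> * (\<integral>\<^sup>+ x. f (t + c * x) \<partial>lborel)" .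
next
  obtain g where [measurable]: "g \<in> borel_measurable lborel" and g: "\<And>x. g x \<le> f (t + c * x)"
    "(\<integral>\<^sup>+ x. g x \<partial>lborel) = (\<integral>\<^sup>+ x. f (t + c * x) \<partial>lborel)"
    using nn_integral_minorant[of lborel "\<lambda>x. f (t + c * x)"] by blast
  have "(\<integral>\<^sup>+ x. g ((x - t) / c) \<partial>lborel) = ennreal \<bar>c\<bar> * (\<integral>\<^sup>+ x. g x \<partial>lborel)"
    using nn_integral_real_affine[of "\<lambda>x. g ((x - t) / c)" c t] c by simp
  moreover have "(\<integral>\<^sup>+ x. g ((x - t) / c) \<partial>lborel) \<le> (\<integral>\<^sup>+ x. f x \<partial>lborel)"
    using g(1)[of "(_ - t) / c"] c by (intro nn_integral_mono) auto
  ultimately show "ennreal \<bar>c\<bar> * (\<integral>\<^sup>+ x. f (t + c * x) \<partial>lborel) \<le> (\<integral>\<^sup>+ x. f x \<partial>lborel)"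
    using g(2) by simp
qed

text \<open>Scaling a minorant gives one inequality for every factor. The other is the same
  inequality for the factor \<open>inverse c\<close>, which is why \<open>c\<close> is taken
  positive and finite.\<close>

lemma nn_integral_cmult_nonmeasurable:
  fixes f :: "'a \<Rightarrow> ennreal"
  assumes "0 < c" "c < \<infinity>"
  shows "(\<integral>\<^sup>+ x. c * f x \<partial>M) = c * (\<integral>\<^sup>+ x. f x \<partial>M)"
proof -
  have le: "a * (\<integral>\<^sup>+ x. h x \<partial>M) \<le> (\<integral>\<^sup>+ x. a * h x \<partial>M)" for a and h :: "'a \<Rightarrow> ennreal"
  proof -
    obtain g where [measurable]: "g \<in> borel_measurable M" and g: "\<And>x. g x \<le> h x"
      "(\<integral>\<^sup>+ x. g x \<partial>M) = (\<integral>\<^sup>+ x. h x \<partial>M)"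
      using nn_integral_minorant[of M h] by blast
    have "a * (\<integral>\<^sup>+ x. h x \<partial>M) = (\<integral>\<^sup>+ x. a * g x \<partial>M)"
      using g(2) by (simp add: nn_integral_cmult)
    also have "\<dots> \<le> (\<integral>\<^sup>+ x. a * h x \<partial>M)" by (intro nn_integral_mono mult_left_mono g) auto
    finally show ?thesis .
  qed
  have inv: "inverse c * c = 1" using assms ennreal_mult_divide_eq[of c 1]
    by (metis divide_ennreal_def infinity_ennreal_def mult.commute mult_1 mult_divide_eq_ennreal order_less_irrefl)
  have "inverse c * (\<integral>\<^sup>+ x. c * f x \<partial>M) \<le> (\<integral>\<^sup>+ x. inverse c * (c * f x) \<partial>M)" by (rule le)
  also have "\<dots> = (\<integral>\<^sup>+ x. f x \<partial>M)" by (simp add: mult.assoc[symmetric] inv)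
  finally have "c * (inverse c * (\<integral>\<^sup>+ x. c * f x \<partial>M)) \<le> c * (\<integral>\<^sup>+ x. f x \<partial>M)"
    by (rule mult_left_mono) auto
  then have "(\<integral>\<^sup>+ x. c * f x \<partial>M) \<le> c * (\<integral>\<^sup>+ x. f x \<partial>M)"
    by (simp add: mult.assoc[symmetric] mult.commute[of c] inv)
  with le[of c f] show ?thesis by (rule antisym[rotated])
qed

section \<open>Length and distance of a density\<close>

definition arc_part :: "'d::finite density \<Rightarrow> (real \<Rightarrow> real ^ 'd) \<Rightarrow> real \<Rightarrow> real \<Rightarrow> ennreal" where
  "arc_part \<phi> \<gamma> a b =
     (\<integral>\<^sup>+ t \<in> {a..b}. ennreal (\<phi> (\<gamma> t)) * ennreal (norm (vector_derivative \<gamma> (at t))) \<partial>lborel)"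

lemma arc_integral_eq_arc_part: "arc_integral \<phi> \<gamma> = arc_part \<phi> \<gamma> 0 1"
  by (simp add: arc_integral_def arc_part_def)

lemma arc_part_add:
  assumes "a \<le> b" "b \<le> c"
  shows "arc_part \<phi> \<gamma> a c = arc_part \<phi> \<gamma> a b + arc_part \<phi> \<gamma> b c"
proof -
  let ?f = "\<lambda>t. ennreal (\<phi> (\<gamma> t)) * ennreal (norm (vector_derivative \<gamma> (at t)))"
  have "{a..c} = {a..b} \<union> {b<..c}" using assms by auto
  then have "arc_part \<phi> \<gamma> a c = (\<integral>\<^sup>+ t \<in> {a..b} \<union> {b<..c}. ?f t \<partial>lborel)"
    by (simp add: arc_part_def)
  also have "\<dots> = arc_part \<phi> \<gamma> a b + (\<integral>\<^sup>+ t \<in> {b<..c}. ?f t \<partial>lborel)"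
    unfolding arc_part_def by (rule nn_integral_Un_disjoint_nonmeasurable) auto
  also have "(\<integral>\<^sup>+ t \<in> {b<..c}. ?f t \<partial>lborel) = arc_part \<phi> \<gamma> b c"
    unfolding arc_part_def
  proof (rule nn_integral_cong_AE)
    show "AE t in lborel. ?f t * indicator {b<..c} t = ?f t * indicator {b..c} t"
      using AE_lborel_singleton[of b] by eventually_elim (auto simp: indicator_def)
  qed
  finally show ?thesis .
qed

lemma arc_part_mono:
  assumes "a \<le> a'" "b' \<le> b"
  shows "arc_part \<phi> \<gamma> a' b' \<le> arc_part \<phi> \<gamma> a b"
  unfolding arc_part_def using assms by (intro nn_integral_mono) (auto simp: indicator_def)

lemma arc_part_mono_density:
  assumes "\<And>t. t \<in> {a..b} \<Longrightarrow> \<phi> (\<gamma> t) \<le> \<psi> (\<gamma> t)"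
  shows "arc_part \<phi> \<gamma> a b \<le> arc_part \<psi> \<gamma> a b"
  unfolding arc_part_def using assms
  by (intro nn_integral_mono) (auto simp: indicator_def intro!: mult_right_mono ennreal_leI)

lemma arc_part_refl [simp]: "arc_part \<phi> \<gamma> a a = 0"
proof -
  have "arc_part \<phi> \<gamma> a a = (\<integral>\<^sup>+ (t::real). 0 \<partial>lborel)"
    unfolding arc_part_def
    by (intro nn_integral_cong_AE eventually_mono[OF AE_lborel_singleton[of a]])
       (auto simp: indicator_def)
  then show ?thesis by simp
qed

lemma sum_arc_part:
  assumes "m \<le> n" "\<And>i. m \<le> i \<Longrightarrow> i < n \<Longrightarrow> t i \<le> t (Suc i)"
  shows "(\<Sum>i\<in>{m..<n}. arc_part \<phi> \<gamma> (t i) (t (Suc i))) = arc_part \<phi> \<gamma> (t m) (t n)"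
  using assms
proof (induction n rule: dec_induct)
  case base
  then show ?case by simp
next
  case (step n)
  have "t m \<le> t n"
    using step(1) step.prems by (induction rule: dec_induct) (auto intro: order_trans)
  moreover have "t n \<le> t (Suc n)" using step by auto
  ultimately have "arc_part \<phi> \<gamma> (t m) (t (Suc n)) = arc_part \<phi> \<gamma> (t m) (t n) + arc_part \<phi> \<gamma> (t n) (t (Suc n))"
    by (rule arc_part_add)
  then show ?case using step by simp
qed

lemma valid_path_differentiable:
  assumes "valid_path \<gamma>"
  obtains S where "finite S" "\<And>t. t \<in> {0..1} - S \<Longrightarrow> \<gamma> differentiable at t"
  using assms
  by (auto simp: valid_path_def piecewise_C1_differentiable_on_def C1_differentiable_on_eq)

text \<open>Affine substitution; the chain rule holds off the finitely many times where
  \<open>\<gamma>\<close> is not differentiable, and these are null. Endpoints in decreasing order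
  are allowed, so that the same formula covers path reversal.\<close>

lemma arc_integral_subpath:
  assumes \<gamma>: "valid_path \<gamma>" and uv: "u \<in> {0..1}" "v \<in> {0..1}" "u \<noteq> v"
  shows "arc_integral \<phi> (subpath u v \<gamma>) = arc_part \<phi> \<gamma> (min u v) (max u v)"
proof -
  obtain S where S: "finite S" "\<And>t. t \<in> {0..1} - S \<Longrightarrow> \<gamma> differentiable at t"
    using valid_path_differentiable[OF \<gamma>] by blast
  define c where "c = v - u"
  have c: "c \<noteq> 0" using uv by (simp add: c_def)
  let ?w = "\<lambda>t. ennreal (\<phi> (\<gamma> t)) * ennreal (norm (vector_derivative \<gamma> (at t)))"
  have "arc_part \<phi> \<gamma> (min u v) (max u v)
      = ennreal \<bar>c\<bar> * (\<integral>\<^sup>+ t. ?w (u + c * t) * indicator {min u v..max u v} (u + c * t) \<partial>lborel)"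
    unfolding arc_part_def by (rule nn_integral_real_affine_nonmeasurable[OF c])
  also have "\<dots> = (\<integral>\<^sup>+ t. ennreal \<bar>c\<bar> * (?w (u + c * t) * indicator {min u v..max u v} (u + c * t)) \<partial>lborel)"
    using c by (subst nn_integral_cmult_nonmeasurable) auto
  also have "\<dots> = arc_integral \<phi> (subpath u v \<gamma>)"
    unfolding arc_integral_def
  proof (rule nn_integral_cong_AE)
    have fin: "finite ((\<lambda>s. (s - u) / c) ` S)" using S(1) by simp
    have "AE t in lborel. t \<notin> (\<lambda>s. (s - u) / c) ` S"
      using fin by (rule AE_not_in[OF finite_imp_null_set_lborel])
    then show "AE t in lborel. ennreal \<bar>c\<bar> * (?w (u + c * t) * indicator {min u v..max u v} (u + c * t))
        = ennreal (\<phi> (subpath u v \<gamma> t)) * ennreal (norm (vector_derivative (subpath u v \<gamma>) (at t))) * indicator {0..1} t"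
    proof eventually_elim
      fix t assume t: "t \<notin> (\<lambda>s. (s - u) / c) ` S"
      have notS: "u + c * t \<notin> S"
      proof
        assume "u + c * t \<in> S"
        then have "(u + c * t - u) / c \<in> (\<lambda>s. (s - u) / c) ` S" by blast
        with t c show False by simp
      qed
      have ind: "u + c * t \<in> {min u v..max u v} \<longleftrightarrow> t \<in> {0..1}"
      proof (cases "u < v")
        case True
        then have "0 < c" by (simp add: c_def)
        then have "c * t \<le> c \<longleftrightarrow> t \<le> 1" "0 \<le> c * t \<longleftrightarrow> 0 \<le> t" by (simp_all add: zero_le_mult_iff)
        moreover have "min u v = u" "max u v = u + c" using True uv by (auto simp: c_def)
        ultimately show ?thesis by auto
      next
        case False
        then have "c < 0" using uv by (simp add: c_def)
        then have "c \<le> c * t \<longleftrightarrow> t \<le> 1" "c * t \<le> 0 \<longleftrightarrow> 0 \<le> t"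
          using mult_le_cancel_left_neg[of c 1 t] by (auto simp: mult_le_0_iff)
        moreover have "max u v = u" "min u v = u + c" using False uv by (auto simp: c_def)
        ultimately show ?thesis by auto
      qed
      show "ennreal \<bar>c\<bar> * (?w (u + c * t) * indicator {min u v..max u v} (u + c * t))
        = ennreal (\<phi> (subpath u v \<gamma> t)) * ennreal (norm (vector_derivative (subpath u v \<gamma>) (at t))) * indicator {0..1} t"
      proof (cases "t \<in> {0..1}")
        case True
        then have "u + c * t \<in> {min u v..max u v}" using ind by blast
        then have "u + c * t \<in> {0..1}" using uv by auto
        then have d: "(\<gamma> has_vector_derivative vector_derivative \<gamma> (at (u + c * t))) (at (u + c * t))"
          using S(2) notS vector_derivative_works by blast
        have "((\<lambda>t. u + c * t) has_vector_derivative c) (at t)"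
          by (auto intro!: derivative_eq_intros)
        from vector_diff_chain_at[OF this d]
        have "vector_derivative (subpath u v \<gamma>) (at t) = c *\<^sub>R vector_derivative \<gamma> (at (u + c * t))"
          by (intro vector_derivative_at) (simp add: subpath_def o_def c_def add.commute)
        then show ?thesis using True ind
          by (simp add: subpath_def c_def[symmetric] ennreal_mult' add.commute mult_ac)
      qed (use ind in simp)
    qed
  qed
  finally show ?thesis ..
qed

text \<open>Two-sided derivatives at 0 and 1 also see values outside the unit interval, where
  restrictions of a joined path differ from the paths that were joined. Only these two null times
  are affected.\<close>

lemma arc_integral_cong:
  assumes "\<And>t. t \<in> {0..1} \<Longrightarrow> \<gamma> t = \<gamma>' t"
  shows "arc_integral \<phi> \<gamma> = arc_integral \<phi> \<gamma>'"
  unfolding arc_integral_def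
proof (rule nn_integral_cong_AE)
  show "AE t in lborel. ennreal (\<phi> (\<gamma> t)) * ennreal (norm (vector_derivative \<gamma> (at t))) * indicator {0..1} t
     = ennreal (\<phi> (\<gamma>' t)) * ennreal (norm (vector_derivative \<gamma>' (at t))) * indicator {0..1} t"
    using AE_lborel_singleton[of 0] AE_lborel_singleton[of 1]
  proof eventually_elim
    fix t :: real assume "t \<noteq> 0" "t \<noteq> 1"
    show "ennreal (\<phi> (\<gamma> t)) * ennreal (norm (vector_derivative \<gamma> (at t))) * indicator {0..1} t
     = ennreal (\<phi> (\<gamma>' t)) * ennreal (norm (vector_derivative \<gamma>' (at t))) * indicator {0..1} t"
    proof (cases "t \<in> {0..1}")
      case True
      with \<open>t \<noteq> 0\<close> \<open>t \<noteq> 1\<close> have "t \<in> {0<..<1}" by auto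
      then have "eventually (\<lambda>s. s \<in> {0<..<1}) (nhds t)" by (intro eventually_nhds_in_open) auto
      then have "eventually (\<lambda>s. s \<in> UNIV \<longrightarrow> \<gamma> s = \<gamma>' s) (nhds t)"
        by eventually_elim (use assms in auto)
      then have "vector_derivative \<gamma> (at t) = vector_derivative \<gamma>' (at t)"
        by (intro vector_derivative_cong_eq) auto
      then show ?thesis using assms True by simp
    qed simp
  qed
qed

lemma arc_integral_join:
  assumes "valid_path g1" "valid_path g2" "pathfinish g1 = pathstart g2"
  shows "arc_integral \<phi> (g1 +++ g2) = arc_integral \<phi> g1 + arc_integral \<phi> g2"
proof -
  let ?g = "g1 +++ g2"
  have v: "valid_path ?g" using assms by (rule valid_path_join)
  have "arc_integral \<phi> ?g = arc_part \<phi> ?g 0 (1/2) + arc_part \<phi> ?g (1/2) 1"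
    unfolding arc_integral_eq_arc_part by (rule arc_part_add) auto
  also have "arc_part \<phi> ?g 0 (1/2) = arc_integral \<phi> (subpath 0 (1/2) ?g)"
    using arc_integral_subpath[OF v, of 0 "1/2"] by simp
  also have "\<dots> = arc_integral \<phi> g1"
    by (rule arc_integral_cong) (auto simp: subpath_def joinpaths_def)
  also have "arc_part \<phi> ?g (1/2) 1 = arc_integral \<phi> (subpath (1/2) 1 ?g)"
    using arc_integral_subpath[OF v, of "1/2" 1] by simp
  also have "\<dots> = arc_integral \<phi> g2"
    using assms(3)
    by (intro arc_integral_cong) (auto simp: subpath_def joinpaths_def pathstart_def pathfinish_def field_simps)
  finally show ?thesis .
qed

section \<open>The pseudometric of a fixed density\<close>

lemma T_le_arc_integral:
  assumes "valid_path \<gamma>" "pathstart \<gamma> = x" "pathfinish \<gamma> = y"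
  shows "T \<phi> x y \<le> arc_integral \<phi> \<gamma>"
  unfolding T_def using assms by (intro INF_lower) auto

lemma T_greatest:
  assumes "\<And>\<gamma>. valid_path \<gamma> \<Longrightarrow> pathstart \<gamma> = x \<Longrightarrow> pathfinish \<gamma> = y \<Longrightarrow> c \<le> arc_integral \<phi> \<gamma>"
  shows "c \<le> T \<phi> x y"
  unfolding T_def using assms by (intro INF_greatest) auto

lemma T_lessE:
  assumes "T \<phi> x y < c"
  obtains \<gamma> where "valid_path \<gamma>" "pathstart \<gamma> = x" "pathfinish \<gamma> = y" "arc_integral \<phi> \<gamma> < c"
  using assms unfolding T_def by (auto simp: INF_less_iff)

lemma T_self [simp]: "T \<phi> x x = 0"
proof -
  have "T \<phi> x x \<le> arc_integral \<phi> (linepath x x)"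
    by (rule T_le_arc_integral) auto
  also have "\<dots> = 0"
    unfolding arc_integral_def by (simp add: linepath_refl)
  finally show ?thesis by simp
qed

lemma T_triangle: "T \<phi> x z \<le> T \<phi> x y + T \<phi> y z"
proof (rule ennreal_le_epsilon)
  fix e :: real assume fin: "T \<phi> x y + T \<phi> y z < \<top>" and e: "0 < e"
  have "T \<phi> x y < T \<phi> x y + ennreal (e/2)" "T \<phi> y z < T \<phi> y z + ennreal (e/2)"
    using fin e by (auto simp: less_top[symmetric] ennreal_add_eq_top ennreal_add_left_cancel_less
          intro!: add_strict_increasing2)
  then obtain g1 g2 where g: "valid_path g1" "pathstart g1 = x" "pathfinish g1 = y" 
      "arc_integral \<phi> g1 < T \<phi> x y + ennreal (e/2)"
      "valid_path g2" "pathstart g2 = y" "pathfinish g2 = z" 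
      "arc_integral \<phi> g2 < T \<phi> y z + ennreal (e/2)"
    by (metis T_lessE)
  have "T \<phi> x z \<le> arc_integral \<phi> (g1 +++ g2)"
    using g by (intro T_le_arc_integral valid_path_join) auto
  also have "\<dots> = arc_integral \<phi> g1 + arc_integral \<phi> g2" using g by (intro arc_integral_join) auto
  also have "\<dots> \<le> (T \<phi> x y + ennreal (e/2)) + (T \<phi> y z + ennreal (e/2))"
    using g by (intro add_mono less_imp_le)
  also have "\<dots> = T \<phi> x y + T \<phi> y z + (ennreal (e/2) + ennreal (e/2))" by (simp add: ac_simps)
  also have "ennreal (e/2) + ennreal (e/2) = ennreal e" using e by (simp flip: ennreal_plus)
  finally show "T \<phi> x z \<le> T \<phi> x y + T \<phi> y z + ennreal e" .
qed

lemma T_commute: "T \<phi> x y = T \<phi> y x"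
proof -
  have "T \<phi> x y \<le> T \<phi> y x" for x y
  proof (rule T_greatest)
    fix \<gamma> assume g: "valid_path \<gamma>" "pathstart \<gamma> = y" "pathfinish \<gamma> = x"
    have "T \<phi> x y \<le> arc_integral \<phi> (subpath 1 0 \<gamma>)"
      using g by (intro T_le_arc_integral) (auto simp: subpath_reversepath)
    also have "\<dots> = arc_integral \<phi> \<gamma>"
      using arc_integral_subpath[OF g(1), of 1 0] by (simp add: arc_integral_eq_arc_part)
    finally show "T \<phi> x y \<le> arc_integral \<phi> \<gamma>" .
  qed
  then show ?thesis by (intro antisym)
qed

lemma T_mono: "\<phi> \<le> \<psi> \<Longrightarrow> T \<phi> x y \<le> T \<psi> x y"
  unfolding T_def arc_integral_eq_arc_part
  by (intro INF_superset_mono arc_part_mono_density) (auto simp: le_fun_def)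

lemma T_annulus_mono: "\<phi> \<le> \<psi> \<Longrightarrow> T_annulus \<phi> R \<le> T_annulus \<psi> R"
  unfolding T_annulus_def by (intro INF_mono' T_mono)

section \<open>Translations of a density\<close>

lemma vector_derivative_translation:
  "vector_derivative (\<lambda>t. \<gamma> t + v) (at t) = vector_derivative \<gamma> (at t)"
  for \<gamma> :: "real \<Rightarrow> 'a::real_normed_vector"
proof -
  \<comment> \<open>The two predicates agree for every \<open>D\<close>, so the choice operator
    returns the same value even where no derivative exists.\<close>
  have "((\<lambda>t. \<gamma> t + v) has_vector_derivative D) (at t) \<longleftrightarrow> (\<gamma> has_vector_derivative D) (at t)" for D
    using has_vector_derivative_add_const[of \<gamma> v D] by auto
  then show ?thesis by (simp add: vector_derivative_def)
qed

lemma arc_integral_translate: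
  "arc_integral (translate v \<phi>) \<gamma> = arc_integral \<phi> (\<lambda>t. \<gamma> t + v)"
  by (simp add: arc_integral_def translate_def vector_derivative_translation)

lemma valid_path_translation: "valid_path (\<lambda>t. \<gamma> t + v) \<longleftrightarrow> valid_path \<gamma>"
  using valid_path_translation_eq[of v \<gamma>] by (simp add: o_def add.commute)

lemma T_translate: "T (translate v \<phi>) x y = T \<phi> (x + v) (y + v)"
proof (rule antisym)
  show "T (translate v \<phi>) x y \<le> T \<phi> (x + v) (y + v)"
  proof (rule T_greatest)
    fix \<gamma> assume g: "valid_path \<gamma>" "pathstart \<gamma> = x + v" "pathfinish \<gamma> = y + v"
    then have "valid_path (\<lambda>t. \<gamma> t + (- v))" by (subst valid_path_translation)
    then have "T (translate v \<phi>) x y \<le> arc_integral (translate v \<phi>) (\<lambda>t. \<gamma> t + (- v))"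
      using g by (intro T_le_arc_integral) (auto simp: pathstart_def pathfinish_def)
    also have "\<dots> = arc_integral \<phi> \<gamma>" by (simp add: arc_integral_translate)
    finally show "T (translate v \<phi>) x y \<le> arc_integral \<phi> \<gamma>" .
  qed
  show "T \<phi> (x + v) (y + v) \<le> T (translate v \<phi>) x y"
  proof (rule T_greatest)
    fix \<gamma> assume g: "valid_path \<gamma>" "pathstart \<gamma> = x" "pathfinish \<gamma> = y"
    then show "T \<phi> (x + v) (y + v) \<le> arc_integral (translate v \<phi>) \<gamma>"
      unfolding arc_integral_translate
      by (intro T_le_arc_integral) (auto simp: pathstart_def pathfinish_def valid_path_translation)
  qed
qed

lemma translate_translate [simp]: "translate v (translate w \<phi>) = translate (v + w) \<phi>"
  by (simp add: translate_def add.assoc)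

lemma translate_0 [simp]: "translate 0 = id"
  by (auto simp: translate_def)

lemma translate_funpow: "translate v ^^ n = translate (real n *\<^sub>R v)"
  by (induction n) (auto simp: algebra_simps)

text \<open>By the intermediate value theorem the piece meets the unit sphere and then the sphere of
  radius \<open>R\<close> about \<open>c\<close>; the part in between competes in the annulus
  infimum. Asking only for inequalities at \<open>a\<close> and \<open>b\<close> makes this
  applicable to arbitrary pieces of paths.\<close>

lemma T_annulus_translate_le_arc_part:
  assumes \<gamma>: "valid_path \<gamma>" and ab: "0 \<le> a" "a \<le> b" "b \<le> 1" and R: "1 < R"
    and a: "dist (\<gamma> a) c \<le> 1" and b: "R \<le> dist (\<gamma> b) c"
  shows "T_annulus (translate c \<phi>) R \<le> arc_part \<phi> \<gamma> a b"
proof -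
  have cont: "continuous_on {0..1} \<gamma>" using \<gamma> by (simp add: valid_path_imp_path path_def[symmetric])
  have "continuous_on {a..b} (\<lambda>t. dist (\<gamma> t) c)"
    using ab by (intro continuous_intros continuous_on_subset[OF cont]) auto
  from IVT'[OF _ _ _ this, of 1] obtain s where s: "a \<le> s" "s \<le> b" "dist (\<gamma> s) c = 1"
    using a b R ab by auto
  have "continuous_on {s..b} (\<lambda>t. dist (\<gamma> t) c)"
    using ab s by (intro continuous_intros continuous_on_subset[OF cont]) auto
  from IVT'[OF _ _ _ this, of R] obtain t where t: "s \<le> t" "t \<le> b" "dist (\<gamma> t) c = R"
    using b R s by auto
  have "s \<noteq> t" using s t R by auto
  have in01: "s \<in> {0..1}" "t \<in> {0..1}" using s t ab by auto
  have "T_annulus (translate c \<phi>) R \<le> T (translate c \<phi>) (\<gamma> s - c) (\<gamma> t - c)"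
    unfolding T_annulus_def using s t
    by (intro INF_lower2[of "\<gamma> s - c" "sphere 0 1"] INF_lower2[of "\<gamma> t - c" "sphere 0 R"] order_refl)
       (simp_all add: dist_norm norm_minus_commute)
  also have "\<dots> = T \<phi> (\<gamma> s) (\<gamma> t)" by (simp add: T_translate)
  also have "\<dots> \<le> arc_integral \<phi> (subpath s t \<gamma>)"
    using \<gamma> in01 by (intro T_le_arc_integral valid_path_subpath) auto
  also have "\<dots> = arc_part \<phi> \<gamma> s t"
    using arc_integral_subpath[OF \<gamma> in01 \<open>s \<noteq> t\<close>] t by (simp add: min_def max_def)
  also have "\<dots> \<le> arc_part \<phi> \<gamma> a b" using s t by (intro arc_part_mono)
  finally show ?thesis .
qed

text \<open>A path between the two spheres may leave the ball of radius \<open>R\<close>, but it can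
  be cut at its first time of norm at least \<open>R\<close>; the cut path still crosses the annulus
  and costs no more. The locality of the cheap events rests on this.\<close>

lemma T_annulus_local:
  fixes \<phi> \<psi> :: "'d::finite density"
  assumes R: "1 < R" and eq: "\<And>x. x \<in> cball 0 R \<Longrightarrow> \<phi> x = \<psi> x"
  shows "T_annulus \<phi> R = T_annulus \<psi> R"
proof -
  have "T_annulus \<phi> R \<le> T_annulus \<psi> R"
    if eq: "\<And>x. x \<in> cball 0 R \<Longrightarrow> \<phi> x = \<psi> x" for \<phi> \<psi> :: "'d density"
    unfolding T_annulus_def[of \<psi>]
  proof (intro INF_greatest T_greatest)
    fix x y :: "real ^ 'd" and \<gamma> assume x: "x \<in> sphere 0 1" and y: "y \<in> sphere 0 R"
      and \<gamma>: "valid_path \<gamma>" "pathstart \<gamma> = x" "pathfinish \<gamma> = y"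
    have cont: "continuous_on {0..1} \<gamma>" using \<gamma> by (simp add: valid_path_imp_path path_def[symmetric])
    let ?A = "{t \<in> {0..1}. norm (\<gamma> t) \<in> {R..}}"
    have "?A = {0..1} \<inter> (\<lambda>t. norm (\<gamma> t)) -` {R..}" by auto
    also have "closed \<dots>"
      by (intro continuous_closed_preimage continuous_intros cont closed_atLeastAtMost closed_atLeast)
    finally have "compact ?A"
      by (intro compact_eq_bounded_closed[THEN iffD2] conjI bounded_subset[of "{0..1}" ?A]) auto
    moreover have "1 \<in> ?A" using \<gamma> y by (auto simp: pathfinish_def)
    ultimately obtain t where t: "t \<in> ?A" "\<And>s. s \<in> ?A \<Longrightarrow> t \<le> s"
      using compact_attains_inf[of ?A] by blast
    have inside: "norm (\<gamma> s) \<le> R" if s: "s \<in> {0..t}" for s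
    proof (rule ccontr)
      assume "\<not> norm (\<gamma> s) \<le> R"
      moreover have "continuous_on {0..s} (\<lambda>t. norm (\<gamma> t))"
        using t s by (intro continuous_intros continuous_on_subset[OF cont]) auto
      ultimately obtain s' where s': "0 \<le> s'" "s' \<le> s" "norm (\<gamma> s') = R"
        using IVT'[of "\<lambda>t. norm (\<gamma> t)" 0 R s] s \<gamma> x R by (auto simp: pathstart_def)
      then have "t \<le> s'" using t(2)[of s'] s t(1) s' by auto
      then have "s' = s" using s' s by simp
      with s' \<open>\<not> norm (\<gamma> s) \<le> R\<close> show False by simp
    qed
    have "T_annulus \<phi> R = T_annulus (translate 0 \<phi>) R" by simp
    also have "\<dots> \<le> arc_part \<phi> \<gamma> 0 t"
      using \<gamma> x t R by (intro T_annulus_translate_le_arc_part) (auto simp: pathstart_def)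
    also have "\<dots> \<le> arc_part \<psi> \<gamma> 0 t"
      using inside eq by (intro arc_part_mono_density) simp
    also have "\<dots> \<le> arc_integral \<psi> \<gamma>"
      unfolding arc_integral_eq_arc_part using t by (intro arc_part_mono) auto
    finally show "T_annulus \<phi> R \<le> arc_integral \<psi> \<gamma>" .
  qed
  from this[of \<phi> \<psi>] this[of \<psi> \<phi>] show ?thesis using eq by (simp add: antisym)
qed

section \<open>Subadditive ergodic theorem\<close>

locale ergodic_system = prob_space M for M :: "'a measure" +
  fixes \<tau> :: "'a \<Rightarrow> 'a"
  assumes measurable_shift [measurable]: "\<tau> \<in> measurable M M"
    and distr_shift: "distr M M \<tau> = M"
    and ergodic: "\<And>E. E \<in> sets M \<Longrightarrow> \<tau> -` E \<inter> space M = E \<Longrightarrow> prob E = 0 \<or> prob E = 1"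
begin

lemma measurable_shift_funpow [measurable]: "\<tau> ^^ n \<in> measurable M M"
  by (induction n) auto

lemma shift_funpow_space: "x \<in> space M \<Longrightarrow> (\<tau> ^^ n) x \<in> space M"
  using measurable_space[OF measurable_shift_funpow] .

lemma AE_shift_funpow:
  assumes "AE x in M. P x"
  shows "AE x in M. P ((\<tau> ^^ n) x)"
proof (induction n)
  case 0
  then show ?case using assms by simp
next
  case (Suc n)
  have "AE x in distr M M \<tau>. P ((\<tau> ^^ n) x)" using Suc by (subst distr_shift)
  from AE_distrD[OF measurable_shift this] show ?case by (simp add: funpow_swap1)
qed

lemma nn_integral_shift_funpow:
  assumes [measurable]: "f \<in> borel_measurable M"
  shows "(\<integral>\<^sup>+ x. f ((\<tau> ^^ n) x) \<partial>M) = (\<integral>\<^sup>+ x. f x \<partial>M)"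
proof (induction n)
  case (Suc n)
  have "(\<integral>\<^sup>+ x. f ((\<tau> ^^ n) x) \<partial>M) = (\<integral>\<^sup>+ x. f ((\<tau> ^^ n) x) \<partial>distr M M \<tau>)"
    by (simp add: distr_shift)
  also have "\<dots> = (\<integral>\<^sup>+ x. f ((\<tau> ^^ n) (\<tau> x)) \<partial>M)" by (rule nn_integral_distr) auto
  finally show ?case using Suc by (simp add: funpow_swap1)
qed simp

text \<open>The preimage of \<open>E\<close> has the same probability as \<open>E\<close>, so the
  one-sided almost sure inclusion is an almost sure equality. Ergodicity speaks of exactly invariant
  events only, hence the detour through a modification of \<open>E\<close>.\<close>

lemma zero_one_law:
  assumes E [measurable]: "E \<in> sets M" and sub: "AE x in M. \<tau> x \<in> E \<longrightarrow> x \<in> E"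
  shows "(AE x in M. x \<in> E) \<or> (AE x in M. x \<notin> E)"
proof -
  \<comment> \<open>Visiting \<open>E\<close> infinitely often is unaffected by shifting the orbit
    by one step, so this event is exactly invariant.\<close>
  define E' where "E' = {x \<in> space M. \<exists>\<^sub>\<infinity>n. (\<tau> ^^ n) x \<in> E}"
  have [measurable]: "E' \<in> sets M" unfolding E'_def INFM_nat by measurable
  have inv: "\<tau> -` E' \<inter> space M = E'"
  proof -
    have "(\<exists>\<^sub>\<infinity>n. (\<tau> ^^ n) (\<tau> x) \<in> E) \<longleftrightarrow> (\<exists>\<^sub>\<infinity>n. (\<tau> ^^ n) x \<in> E)" for x
      using eventually_sequentially_Suc[of "\<lambda>n. (\<tau> ^^ n) x \<notin> E"]
      by (simp add: funpow_swap1 frequently_def cofinite_eq_sequentially)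
    then show ?thesis using measurable_space[OF measurable_shift] by (auto simp: E'_def)
  qed
  have "AE x in M. \<tau> x \<in> E \<longleftrightarrow> x \<in> E"
  proof -
    let ?A = "\<tau> -` E \<inter> space M"
    have [measurable]: "?A \<in> sets M" by measurable
    have "emeasure M ?A = emeasure (distr M M \<tau>) E" by (rule emeasure_distr[symmetric]) auto
    then have eq: "prob ?A = prob E" by (simp add: distr_shift measure_def)
    have "prob (E - ?A) = prob E - prob (E \<inter> ?A)"
      by (rule finite_measure_Diff') auto
    also have "prob (E \<inter> ?A) = prob ?A"
      using sub by (intro finite_measure_eq_AE) auto
    finally have "prob (E - ?A) = 0" using eq by simp
    then have "AE x in M. x \<notin> E - ?A" by (subst prob_eq_0[symmetric]) auto
    with sub AE_space show ?thesis by eventually_elim auto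
  qed
  then have "AE x in M. \<tau> ((\<tau> ^^ n) x) \<in> E \<longleftrightarrow> (\<tau> ^^ n) x \<in> E" for n
    by (rule AE_shift_funpow)
  then have "AE x in M. \<forall>n. (\<tau> ^^ Suc n) x \<in> E \<longleftrightarrow> (\<tau> ^^ n) x \<in> E"
    unfolding AE_all_countable by simp
  then have eq: "AE x in M. x \<in> E' \<longleftrightarrow> x \<in> E"
    using AE_space
  proof eventually_elim
    fix x assume x: "\<forall>n. (\<tau> ^^ Suc n) x \<in> E \<longleftrightarrow> (\<tau> ^^ n) x \<in> E" "x \<in> space M"
    have "(\<tau> ^^ n) x \<in> E \<longleftrightarrow> x \<in> E" for n using x by (induction n) auto
    then show "x \<in> E' \<longleftrightarrow> x \<in> E" using x by (simp add: E'_def)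
  qed
  from ergodic[OF _ inv] have "prob E' = 0 \<or> prob E' = 1" by simp
  then show ?thesis
  proof
    assume "prob E' = 1"
    then have "AE x in M. x \<in> E'" by (simp add: AE_in_set_eq_1)
    with eq have "AE x in M. x \<in> E" by eventually_elim simp
    then show ?thesis ..
  next
    assume "prob E' = 0"
    then have "AE x in M. x \<notin> E'" by (subst prob_eq_0[symmetric]) auto
    with eq have "AE x in M. x \<notin> E" by eventually_elim simp
    then show ?thesis ..
  qed
qed

section \<open>Birkhoff sums\<close>

definition birkhoff_sum :: "('a \<Rightarrow> ennreal) \<Rightarrow> nat \<Rightarrow> 'a \<Rightarrow> ennreal" where
  "birkhoff_sum g n x = (\<Sum>j<n. g ((\<tau> ^^ j) x))"

lemma measurable_birkhoff_sum [measurable]: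
  "g \<in> borel_measurable M \<Longrightarrow> birkhoff_sum g n \<in> borel_measurable M"
  unfolding birkhoff_sum_def by (intro borel_measurable_sum measurable_compose[OF measurable_shift_funpow])

lemma birkhoff_sum_0 [simp]: "birkhoff_sum g 0 x = 0"
  by (simp add: birkhoff_sum_def)

lemma birkhoff_sum_Suc: "birkhoff_sum g (Suc n) x = birkhoff_sum g n x + g ((\<tau> ^^ n) x)"
  by (simp add: birkhoff_sum_def)

lemma birkhoff_sum_add: "birkhoff_sum g (m + n) x = birkhoff_sum g m x + birkhoff_sum g n ((\<tau> ^^ m) x)"
  by (induction n)
     (simp_all add: birkhoff_sum_Suc add.assoc add.commute[of m] funpow_add)

lemma nn_integral_birkhoff_sum:
  assumes [measurable]: "g \<in> borel_measurable M"
  shows "(\<integral>\<^sup>+ x. birkhoff_sum g n x \<partial>M) = of_nat n * (\<integral>\<^sup>+ x. g x \<partial>M)"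
  unfolding birkhoff_sum_def by (simp add: nn_integral_sum nn_integral_shift_funpow)

text \<open>Dominated convergence with \<open>g\<close> as the dominating function. In the greedy
  decompositions \<open>B N\<close> collects the points without a good jump of length at most
  \<open>N\<close>, and the integral is the mean cost of a unit step taken there.\<close>

lemma nn_integral_on_bad_set_eventually_small:
  fixes B :: "nat \<Rightarrow> 'a set" and e :: ennreal
  assumes [measurable]: "\<And>N. B N \<in> sets M" and [measurable]: "g \<in> borel_measurable M"
    and fin: "(\<integral>\<^sup>+ x. g x \<partial>M) < \<infinity>" and e: "0 < e"
    and B: "AE x in M. \<exists>N. \<forall>n\<ge>N. x \<notin> B n"
  shows "\<exists>N. (\<integral>\<^sup>+ x. g x * indicator (B N) x \<partial>M) < e"
proof -
  have "(\<lambda>N. \<integral>\<^sup>+ x. g x * indicator (B N) x \<partial>M) \<longlonglongrightarrow> (\<integral>\<^sup>+ x. 0 \<partial>M)"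
  proof (rule nn_integral_dominated_convergence[where w = g])
    show "AE x in M. (\<lambda>N. g x * indicator (B N) x) \<longlonglongrightarrow> 0"
      using B
    proof eventually_elim
      fix x assume "\<exists>N. \<forall>n\<ge>N. x \<notin> B n"
      then have "eventually (\<lambda>N. g x * indicator (B N) x = 0) sequentially"
        by (auto simp: eventually_sequentially intro!: exI)
      then show "(\<lambda>N. g x * indicator (B N) x) \<longlonglongrightarrow> 0" by (rule tendsto_eventually)
    qed
  qed (use fin in \<open>auto simp: indicator_def\<close>)
  then have "eventually (\<lambda>N. (\<integral>\<^sup>+ x. g x * indicator (B N) x \<partial>M) < e) sequentially"
    using e by (auto dest: order_tendstoD(2))
  then show ?thesis by (auto simp: eventually_sequentially)
qed

end

lemma ennreal_of_nat_mult_split: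
  "0 \<le> c \<Longrightarrow> n \<le> K \<Longrightarrow> ennreal (real n * c) + ennreal (real (K - n) * c) = ennreal (real K * c)"
  by (simp add: distrib_right[symmetric] of_nat_diff flip: ennreal_plus)

section \<open>One-sided almost sure bounds\<close>

context ergodic_system begin

lemma subadditive_le_birkhoff_sum:
  fixes X :: "nat \<Rightarrow> 'a \<Rightarrow> ennreal"
  assumes X0: "\<And>x. X 0 x = 0"
    and sub: "\<And>m n x. X (m + n) x \<le> X m x + X n ((\<tau> ^^ m) x)"
  shows "X n x \<le> birkhoff_sum (X 1) n x"
proof (induction n)
  case (Suc n)
  have "X (n + 1) x \<le> X n x + X 1 ((\<tau> ^^ n) x)" by (rule sub)
  with Suc show ?case by (simp add: birkhoff_sum_Suc add_mono order_trans[OF _ add_right_mono])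
qed (simp add: X0)

text \<open>Greedy decomposition: from each point jump ahead by a time \<open>n \<le> N\<close> with \<open>X\<^sub>n \<le> n c'\<close> if there is one, and by
  one step otherwise. The 0-1 law is applied to a version of the event that tolerates a bounded error,
  so that a shift by one step does not leave it.\<close>

lemma subadditive_eventually_ge:
  fixes X :: "nat \<Rightarrow> 'a \<Rightarrow> ennreal" and c \<gamma> :: real
  assumes meas [measurable]: "\<And>n. X n \<in> borel_measurable M"
    and X0: "\<And>x. X 0 x = 0"
    and sub: "\<And>m n x. X (m + n) x \<le> X m x + X n ((\<tau> ^^ m) x)"
    and fin: "(\<integral>\<^sup>+ x. X 1 x \<partial>M) < \<infinity>"
    and lower: "\<And>n. ennreal (real n * \<gamma>) \<le> (\<integral>\<^sup>+ x. X n x \<partial>M)"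
    and c: "c < \<gamma>"
  shows "AE x in M. eventually (\<lambda>n. ennreal (real n * c) \<le> X n x) sequentially"
proof (cases "c < 0")
  case True
  \<comment> \<open>The embedding into \<open>ennreal\<close> truncates, so a negative slope gives
    the trivial lower bound 0.\<close>
  then have "ennreal (real n * c) = 0" for n by (intro ennreal_neg) (simp add: mult_le_0_iff)
  then show ?thesis by simp
next
  case False
  define E where "E = {x \<in> space M. \<exists>b::nat. \<exists>\<^sub>\<infinity>n. X n x \<le> ennreal (real n * c + real b)}"
  have E: "E \<in> sets M" unfolding E_def INFM_nat by measurable
  have fin1: "AE x in M. X 1 x \<noteq> \<infinity>" using fin by (intro nn_integral_PInf_AE) auto
  have "AE x in M. \<tau> x \<in> E \<longrightarrow> x \<in> E"
    using fin1 AE_space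
  proof eventually_elim
    fix x assume x: "X 1 x \<noteq> \<infinity>" "x \<in> space M"
    show "\<tau> x \<in> E \<longrightarrow> x \<in> E"
    proof
      assume "\<tau> x \<in> E"
      then obtain b where b: "\<exists>\<^sub>\<infinity>n. X n (\<tau> x) \<le> ennreal (real n * c + real b)" by (auto simp: E_def)
      obtain b' :: nat where b': "X 1 x \<le> of_nat b'" using x ennreal_Ex_less_of_nat[of "X 1 x"]
        by (auto simp: less_top intro: less_imp_le)
      from b have "\<exists>\<^sub>\<infinity>n. X (Suc n) x \<le> ennreal (real (Suc n) * c + real (b + b'))"
      proof (rule INFM_mono)
        fix n assume n: "X n (\<tau> x) \<le> ennreal (real n * c + real b)"
        have "X (1 + n) x \<le> X 1 x + X n (\<tau> x)" using sub[of 1 n x] by simp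
        also have "\<dots> \<le> ennreal (real b') + ennreal (real n * c + real b)"
          using b' n by (intro add_mono) (simp_all add: ennreal_of_nat_eq_real_of_nat)
        also have "\<dots> = ennreal (real n * c + real (b + b'))" using False
          by (subst ennreal_plus[symmetric]) auto
        also have "\<dots> \<le> ennreal (real (Suc n) * c + real (b + b'))"
          using False by (intro ennreal_leI) (auto simp: algebra_simps)
        finally show "X (Suc n) x \<le> ennreal (real (Suc n) * c + real (b + b'))" by simp
      qed
      then have "\<exists>\<^sub>\<infinity>n. X n x \<le> ennreal (real n * c + real (b + b'))"
        using eventually_sequentially_Suc[of "\<lambda>n. \<not> X n x \<le> ennreal (real n * c + real (b + b'))"]
        by (simp add: frequently_def cofinite_eq_sequentially)
      then show "x \<in> E" using x unfolding E_def by blast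
    qed
  qed
  from zero_one_law[OF E this] show ?thesis
  proof
    assume "AE x in M. x \<notin> E"
    then show ?thesis using AE_space
    proof eventually_elim
      fix x assume "x \<notin> E" "x \<in> space M"
      then have "\<not> (\<exists>\<^sub>\<infinity>n. X n x \<le> ennreal (real n * c + real 0))" unfolding E_def by blast
      then have "eventually (\<lambda>n. \<not> X n x \<le> ennreal (real n * c)) sequentially"
        by (simp add: frequently_def cofinite_eq_sequentially)
      then show "eventually (\<lambda>n. ennreal (real n * c) \<le> X n x) sequentially"
        by eventually_elim auto
    qed
  next
    assume ae: "AE x in M. x \<in> E"
    \<comment> \<open>The larger slope absorbs the bounded error:
      \<open>n * c + b \<le> n * c'\<close> for large \<open>n\<close>, so almost every point has a
      good jump. The other half of the gap is kept for the contradiction.\<close>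
    define c' where "c' = (c + \<gamma>) / 2"
    have c': "c < c'" "c' < \<gamma>" "0 \<le> c'" using c False by (auto simp: c'_def)
    define D where "D N = {x \<in> space M. \<forall>n\<in>{1..N}. \<not> X n x \<le> ennreal (real n * c')}" for N
    have [measurable]: "D N \<in> sets M" for N unfolding D_def by measurable
    have "AE x in M. \<exists>N. \<forall>n\<ge>N. x \<notin> D n"
      using ae
    proof eventually_elim
      fix x assume "x \<in> E"
      then obtain b where b: "\<exists>\<^sub>\<infinity>n. X n x \<le> ennreal (real n * c + real b)" by (auto simp: E_def)
      obtain N0 where N0: "real b / (c' - c) \<le> real N0" using real_arch_simple by blast
      from b obtain n where n: "n > N0" "X n x \<le> ennreal (real n * c + real b)"
        unfolding INFM_nat by blast
      have "real b / (c' - c) \<le> real n" using n N0 by auto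
      then have "real n * c + real b \<le> real n * c'" using c' by (simp add: field_simps)
      then have "X n x \<le> ennreal (real n * c')" using n(2) by (meson ennreal_leI order_trans)
      then have "\<forall>m\<ge>n. x \<notin> D m" using n(1) unfolding D_def by force
      then show "\<exists>N. \<forall>n\<ge>N. x \<notin> D n" by blast
    qed
    from nn_integral_on_bad_set_eventually_small[OF _ _ fin _ this, of "ennreal ((\<gamma> - c') / 2)"]
    obtain N where N: "(\<integral>\<^sup>+ x. X 1 x * indicator (D N) x \<partial>M) < ennreal ((\<gamma> - c') / 2)"
      using c' by auto
    define h where "h = (\<lambda>x. X 1 x * indicator (D N) x)"
    have [measurable]: "h \<in> borel_measurable M" unfolding h_def by measurable
    have X_birkhoff: "X n x \<le> birkhoff_sum (X 1) n x" for n x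
      using X0 sub by (rule subadditive_le_birkhoff_sum)
    \<comment> \<open>The last sum pays in unit steps for the final \<open>N\<close> times, where a
      jump could overshoot \<open>K\<close>. Its mean stays bounded as \<open>K\<close>
      grows.\<close>
    have greedy: "X K x \<le> ennreal (real K * c') + birkhoff_sum h K x + (\<Sum>m\<in>{K-N..<K}. X 1 ((\<tau> ^^ m) x))"
      if "x \<in> space M" for K x
      using that
    proof (induction K arbitrary: x rule: less_induct)
      case (less K)
      show ?case
      proof (cases "K \<le> N")
        case True
        then have "{K-N..<K} = {..<K}" by auto
        then have "X K x \<le> 0 + (\<Sum>m\<in>{K-N..<K}. X 1 ((\<tau> ^^ m) x))"
          using X_birkhoff[of K x] by (simp add: birkhoff_sum_def)
        also have "\<dots> \<le> (ennreal (real K * c') + birkhoff_sum h K x) + (\<Sum>m\<in>{K-N..<K}. X 1 ((\<tau> ^^ m) x))"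
          by (intro add_right_mono) simp
        finally show ?thesis .
      next
        case False
        obtain n where n: "1 \<le> n" "n \<le> K" "X n x \<le> ennreal (real n * c') + birkhoff_sum h n x"
        proof (cases "x \<in> D N")
          case True
          then have "X 1 x \<le> ennreal (real 1 * c') + birkhoff_sum h 1 x"
            by (simp add: birkhoff_sum_def h_def)
          then show ?thesis using that[of 1] False by auto
        next
          case notD: False
          then obtain n where "n \<in> {1..N}" "X n x \<le> ennreal (real n * c')"
            using less.prems by (auto simp: D_def)
          then show ?thesis using that[of n] False add_increasing2[OF zero_le] by auto
        qed
        have sp: "(\<tau> ^^ n) x \<in> space M" using less.prems by (rule shift_funpow_space)
        have "X K x \<le> X n x + X (K - n) ((\<tau> ^^ n) x)" using sub[of n "K - n" x] n by simp
        also have "\<dots> \<le> (ennreal (real n * c') + birkhoff_sum h n x) +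
           (ennreal (real (K - n) * c') + birkhoff_sum h (K - n) ((\<tau> ^^ n) x)
             + (\<Sum>m\<in>{K-n-N..<K-n}. X 1 ((\<tau> ^^ m) ((\<tau> ^^ n) x))))"
          using n less.IH[OF _ sp, of "K - n"] by (intro add_mono) auto
        also have "\<dots> = (ennreal (real n * c') + ennreal (real (K - n) * c')) +
            (birkhoff_sum h n x + birkhoff_sum h (K - n) ((\<tau> ^^ n) x))
             + (\<Sum>m\<in>{K-n-N..<K-n}. X 1 ((\<tau> ^^ m) ((\<tau> ^^ n) x)))"
          by (simp only: ac_simps)
        also have "ennreal (real n * c') + ennreal (real (K - n) * c') = ennreal (real K * c')"
          using n c' by (intro ennreal_of_nat_mult_split)
        also have "birkhoff_sum h n x + birkhoff_sum h (K - n) ((\<tau> ^^ n) x) = birkhoff_sum h K x"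
          using birkhoff_sum_add[of h n "K - n" x] n by simp
        also have "(\<Sum>m\<in>{K-n-N..<K-n}. X 1 ((\<tau> ^^ m) ((\<tau> ^^ n) x)))
            = (\<Sum>m\<in>{(K-n-N)+n..<(K-n)+n}. X 1 ((\<tau> ^^ m) x))"
          by (subst sum.shift_bounds_nat_ivl) (simp add: funpow_add)
        also have "\<dots> \<le> (\<Sum>m\<in>{K-N..<K}. X 1 ((\<tau> ^^ m) x))"
          using n by (intro sum_mono2) auto
        finally show ?thesis by (simp add: add_left_mono)
      qed
    qed
    define e where "e = enn2real (\<integral>\<^sup>+ x. X 1 x \<partial>M)"
    have e: "(\<integral>\<^sup>+ x. X 1 x \<partial>M) = ennreal e" "0 \<le> e" using fin by (auto simp: e_def)
    have bound: "real K * \<gamma> \<le> real K * c' + real K * ((\<gamma> - c') / 2) + real N * e" for K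
    proof -
      have "ennreal (real K * \<gamma>) \<le> (\<integral>\<^sup>+ x. X K x \<partial>M)" by (rule lower)
      also have "\<dots> \<le> (\<integral>\<^sup>+ x. ennreal (real K * c') + birkhoff_sum h K x + (\<Sum>m\<in>{K-N..<K}. X 1 ((\<tau> ^^ m) x)) \<partial>M)"
        by (intro nn_integral_mono greedy)
      also have "\<dots> = ennreal (real K * c') + of_nat K * (\<integral>\<^sup>+ x. h x \<partial>M) + (\<Sum>m\<in>{K-N..<K}. \<integral>\<^sup>+ x. X 1 ((\<tau> ^^ m) x) \<partial>M)"
        by (simp add: nn_integral_add nn_integral_birkhoff_sum nn_integral_sum emeasure_space_1)
      also have "(\<Sum>m\<in>{K-N..<K}. \<integral>\<^sup>+ x. X 1 ((\<tau> ^^ m) x) \<partial>M) = of_nat (card {K-N..<K}) * ennreal e"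
        using e by (simp add: nn_integral_shift_funpow)
      also have "\<dots> \<le> of_nat N * ennreal e" by (intro mult_right_mono) auto
      also have "(\<integral>\<^sup>+ x. h x \<partial>M) \<le> ennreal ((\<gamma> - c') / 2)" using N by (simp add: h_def less_imp_le)
      finally have "ennreal (real K * \<gamma>) \<le> ennreal (real K * c') + of_nat K * ennreal ((\<gamma> - c') / 2) + of_nat N * ennreal e"
        by (simp add: add_mono mult_left_mono)
      also have "\<dots> = ennreal (real K * c' + real K * ((\<gamma> - c') / 2) + real N * e)"
        using c' e by (simp add: ennreal_of_nat_eq_real_of_nat ennreal_mult'[symmetric])
      finally show ?thesis using c' e
        by (subst (asm) ennreal_le_iff) auto
    qed
    \<comment> \<open>After the bad steps are paid, half of \<open>\<gamma> - c'\<close> is left per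
      step; \<open>K\<close> makes this exceed the boundary term \<open>N * e\<close>.\<close>
    obtain K :: nat where K: "real N * e / ((\<gamma> - c') / 2) < real K" using reals_Archimedean2 by blast
    then have lt: "2 * (real N * e) < real K * \<gamma> - real K * c'" using c' by (simp add: field_simps)
    have eq: "real K * ((\<gamma> - c') / 2) = (real K * \<gamma> - real K * c') / 2"
      by (simp add: algebra_simps)
    have "real K * \<gamma> \<le> real K * c' + (real K * \<gamma> - real K * c') / 2 + real N * e"
      using bound[of K] unfolding eq .
    with lt have False by argo
    then show ?thesis ..
  qed
qed

text \<open>The greedy decomposition with the inequalities reversed: if the sums exceeded slope
  \<open>c\<close> infinitely often, jumps with large sums would fill most of the orbit and push the
  mean above \<open>e\<close>. Additivity of the sums takes the place of subadditivity.\<close>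

lemma birkhoff_eventually_le:
  fixes e c :: real
  assumes meas [measurable]: "g \<in> borel_measurable M"
    and int: "(\<integral>\<^sup>+ x. g x \<partial>M) \<le> ennreal e" and e: "0 \<le> e" and c: "e < c"
  shows "AE x in M. eventually (\<lambda>n. birkhoff_sum g n x \<le> ennreal (real n * c)) sequentially"
proof -
  define E where "E = {x \<in> space M. \<exists>b::nat. \<exists>\<^sub>\<infinity>n. ennreal (real n * c) \<le> birkhoff_sum g n x + of_nat b}"
  have E: "E \<in> sets M" unfolding E_def INFM_nat by measurable
  obtain b' :: nat where b': "c \<le> real b'" using real_arch_simple by blast
  have "AE x in M. \<tau> x \<in> E \<longrightarrow> x \<in> E"
    using AE_space
  proof eventually_elim
    fix x assume x: "x \<in> space M"
    show "\<tau> x \<in> E \<longrightarrow> x \<in> E"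
    proof
      assume "\<tau> x \<in> E"
      then obtain b :: nat where b: "\<exists>\<^sub>\<infinity>n. ennreal (real n * c) \<le> birkhoff_sum g n (\<tau> x) + of_nat b"
        by (auto simp: E_def)
      from b have "\<exists>\<^sub>\<infinity>n. ennreal (real (Suc n) * c) \<le> birkhoff_sum g (Suc n) x + of_nat (b + b')"
      proof (rule INFM_mono)
        fix n assume n: "ennreal (real n * c) \<le> birkhoff_sum g n (\<tau> x) + of_nat b"
        have "ennreal (real (Suc n) * c) = ennreal (real n * c) + ennreal c"
          using c e by (subst ennreal_plus[symmetric]) (auto simp: algebra_simps)
        also have "\<dots> \<le> (birkhoff_sum g n (\<tau> x) + of_nat b) + of_nat b'"
          using n b' by (intro add_mono) (auto simp: ennreal_of_nat_eq_real_of_nat ennreal_leI)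
        also have "birkhoff_sum g n (\<tau> x) \<le> birkhoff_sum g (1 + n) x"
          unfolding birkhoff_sum_add by (simp add: add_increasing)
        finally show "ennreal (real (Suc n) * c) \<le> birkhoff_sum g (Suc n) x + of_nat (b + b')"
          by (simp add: add.assoc add_mono)
      qed
      then have "\<exists>\<^sub>\<infinity>n. ennreal (real n * c) \<le> birkhoff_sum g n x + of_nat (b + b')"
        using eventually_sequentially_Suc[of "\<lambda>n. \<not> ennreal (real n * c) \<le> birkhoff_sum g n x + of_nat (b + b')"]
        by (simp add: frequently_def cofinite_eq_sequentially)
      then show "x \<in> E" using x unfolding E_def by blast
    qed
  qed
  from zero_one_law[OF E this] show ?thesis
  proof
    assume "AE x in M. x \<notin> E"
    then show ?thesis using AE_space
    proof eventually_elim
      fix x assume "x \<notin> E" "x \<in> space M"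
      then have "\<not> (\<exists>\<^sub>\<infinity>n. ennreal (real n * c) \<le> birkhoff_sum g n x + of_nat 0)" unfolding E_def by blast
      then have "eventually (\<lambda>n. \<not> ennreal (real n * c) \<le> birkhoff_sum g n x) sequentially"
        by (simp add: frequently_def cofinite_eq_sequentially)
      then show "eventually (\<lambda>n. birkhoff_sum g n x \<le> ennreal (real n * c)) sequentially"
        by eventually_elim auto
    qed
  next
    assume ae: "AE x in M. x \<in> E"
    define c' where "c' = (e + c) / 2"
    have c': "e < c'" "c' < c" "0 < c'" using c e by (auto simp: c'_def)
    define D where "D N = {x \<in> space M. \<forall>n\<in>{1..N}. \<not> ennreal (real n * c') \<le> birkhoff_sum g n x}" for N
    have [measurable]: "D N \<in> sets M" for N unfolding D_def by measurable
    have aeD: "AE x in M. \<exists>N. \<forall>n\<ge>N. x \<notin> D n"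
      using ae
    proof eventually_elim
      fix x assume "x \<in> E"
      then obtain b :: nat where b: "\<exists>\<^sub>\<infinity>n. ennreal (real n * c) \<le> birkhoff_sum g n x + of_nat b" by (auto simp: E_def)
      obtain N0 where N0: "real b / (c - c') \<le> real N0" using real_arch_simple by blast
      from b obtain n where n: "n > N0" "ennreal (real n * c) \<le> birkhoff_sum g n x + of_nat b"
        unfolding INFM_nat by blast
      have "real b / (c - c') \<le> real n" using n N0 by auto
      then have le: "real n * c' + real b \<le> real n * c" using c' by (simp add: field_simps)
      have "of_nat b + ennreal (real n * c') = ennreal (real n * c' + real b)"
        using c' by (simp add: ennreal_of_nat_eq_real_of_nat add.commute)
      also have "\<dots> \<le> of_nat b + birkhoff_sum g n x"
        using n(2) le by (metis add.commute ennreal_leI order_trans)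
      finally have "ennreal (real n * c') \<le> birkhoff_sum g n x"
        by (simp add: ennreal_add_left_cancel_le ennreal_of_nat_eq_real_of_nat)
      then have "\<forall>m\<ge>n. x \<notin> D m" using n(1) unfolding D_def by force
      then show "\<exists>N. \<forall>n\<ge>N. x \<notin> D n" by blast
    qed
    \<comment> \<open>A bad step falls short of the target by at most \<open>c'\<close>, so bad
      points of this probability cost half of the gap \<open>c' - e\<close>.\<close>
    define \<epsilon> where "\<epsilon> = (c' - e) / (2 * c')"
    have \<epsilon>: "0 < \<epsilon>" "c' * \<epsilon> = (c' - e) / 2" using c' by (auto simp: \<epsilon>_def)
    from nn_integral_on_bad_set_eventually_small[OF _ _ _ _ aeD, of "\<lambda>_. 1" "ennreal \<epsilon>"]
    obtain N where N: "emeasure M (D N) < ennreal \<epsilon>"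
      using \<epsilon> by (auto simp: emeasure_space_1)
    \<comment> \<open>A fictitious reward at bad points: with it even a unit step from such a point
      reaches the slope \<open>c'\<close>.\<close>
    define h where "h = (\<lambda>x. ennreal c' * indicator (D N) x)"
    have [measurable]: "h \<in> borel_measurable M" unfolding h_def by measurable
    have greedy: "ennreal (real K * c') \<le> birkhoff_sum g K x + birkhoff_sum h K x + ennreal (real N * c')"
      if "x \<in> space M" for K x
      using that
    proof (induction K arbitrary: x rule: less_induct)
      case (less K)
      show ?case
      proof (cases "K \<le> N")
        case True
        then have "ennreal (real K * c') \<le> ennreal (real N * c')"
          using c' by (intro ennreal_leI) auto
        then show ?thesis by (simp add: add_increasing)
      next
        case False
        obtain n where n: "1 \<le> n" "n \<le> K" "ennreal (real n * c') \<le> birkhoff_sum g n x + birkhoff_sum h n x"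
        proof (cases "x \<in> D N")
          case True
          then have "ennreal (real 1 * c') \<le> birkhoff_sum g 1 x + birkhoff_sum h 1 x"
            by (simp add: birkhoff_sum_def h_def add_increasing)
          then show ?thesis using that[of 1] False by auto
        next
          case notD: False
          then obtain n where "n \<in> {1..N}" "ennreal (real n * c') \<le> birkhoff_sum g n x"
            using less.prems by (auto simp: D_def)
          then show ?thesis using that[of n] False add_increasing2[OF zero_le] by auto
        qed
        have sp: "(\<tau> ^^ n) x \<in> space M" using less.prems by (rule shift_funpow_space)
        have "ennreal (real K * c') = ennreal (real n * c') + ennreal (real (K - n) * c')"
          using n c' by (intro ennreal_of_nat_mult_split[symmetric]) auto
        also have "\<dots> \<le> (birkhoff_sum g n x + birkhoff_sum h n x) +
           (birkhoff_sum g (K - n) ((\<tau> ^^ n) x) + birkhoff_sum h (K - n) ((\<tau> ^^ n) x) + ennreal (real N * c'))"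
          using n less.IH[OF _ sp, of "K - n"] by (intro add_mono) auto
        also have "\<dots> = (birkhoff_sum g n x + birkhoff_sum g (K - n) ((\<tau> ^^ n) x)) +
            (birkhoff_sum h n x + birkhoff_sum h (K - n) ((\<tau> ^^ n) x)) + ennreal (real N * c')"
          by (simp only: ac_simps)
        also have "\<dots> = birkhoff_sum g K x + birkhoff_sum h K x + ennreal (real N * c')"
          using birkhoff_sum_add[of h n "K - n" x] birkhoff_sum_add[of g n "K - n" x] n by simp
        finally show ?thesis .
      qed
    qed
    have bound: "real K * c' \<le> real K * e + real K * (c' * \<epsilon>) + real N * c'" for K
    proof -
      have "ennreal (real K * c') = (\<integral>\<^sup>+ x. ennreal (real K * c') \<partial>M)" by (simp add: emeasure_space_1)
      also have "\<dots> \<le> (\<integral>\<^sup>+ x. birkhoff_sum g K x + birkhoff_sum h K x + ennreal (real N * c') \<partial>M)"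
        by (intro nn_integral_mono greedy)
      also have "\<dots> = of_nat K * (\<integral>\<^sup>+ x. g x \<partial>M) + of_nat K * (ennreal c' * emeasure M (D N)) + ennreal (real N * c')"
        by (simp add: nn_integral_add nn_integral_birkhoff_sum emeasure_space_1 h_def nn_integral_cmult)
      also have "\<dots> \<le> of_nat K * ennreal e + of_nat K * (ennreal c' * ennreal \<epsilon>) + ennreal (real N * c')"
        using int N by (intro add_mono mult_left_mono) auto
      also have "\<dots> = ennreal (real K * e + real K * (c' * \<epsilon>) + real N * c')"
        using c' e \<epsilon> by (simp add: ennreal_of_nat_eq_real_of_nat ennreal_mult'[symmetric])
      finally show ?thesis using c' e \<epsilon>(1)
        by (subst (asm) ennreal_le_iff) auto
    qed
    obtain K :: nat where K: "real N * c' / ((c' - e) / 2) < real K" using reals_Archimedean2 by blast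
    then have lt: "2 * (real N * c') < real K * c' - real K * e" using c' by (simp add: field_simps)
    have eq: "real K * (c' * \<epsilon>) = (real K * c' - real K * e) / 2"
      unfolding \<epsilon>(2) by (simp add: algebra_simps)
    have "real K * c' \<le> real K * e + (real K * c' - real K * e) / 2 + real N * c'"
      using bound[of K] unfolding eq .
    with lt have False by argo
    then show ?thesis ..
  qed
qed

text \<open>\<open>g ((\<tau> ^^ n) x)\<close> is the increment of two consecutive Birkhoff sums,
  and both are \<open>n * e\<close> up to a small multiple of \<open>n\<close>. The lower bound
  comes from the subadditive result, applied to the additive sequence.\<close>

lemma shift_eventually_sublinear:
  fixes \<epsilon> :: real
  assumes meas [measurable]: "g \<in> borel_measurable M"
    and fin: "(\<integral>\<^sup>+ x. g x \<partial>M) < \<infinity>" and \<epsilon>: "0 < \<epsilon>"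
  shows "AE x in M. eventually (\<lambda>n. g ((\<tau> ^^ n) x) \<le> ennreal (real n * \<epsilon>)) sequentially"
proof -
  define e where "e = enn2real (\<integral>\<^sup>+ x. g x \<partial>M)"
  have e: "(\<integral>\<^sup>+ x. g x \<partial>M) = ennreal e" "0 \<le> e" using fin by (auto simp: e_def)
  have "AE x in M. eventually (\<lambda>n. birkhoff_sum g n x \<le> ennreal (real n * (e + \<epsilon>/4))) sequentially"
    using e \<epsilon> by (intro birkhoff_eventually_le[of g e]) auto
  moreover have "AE x in M. eventually (\<lambda>n. ennreal (real n * (e - \<epsilon>/4)) \<le> birkhoff_sum g n x) sequentially"
  proof (rule subadditive_eventually_ge[where \<gamma> = e])
    show "ennreal (real n * e) \<le> (\<integral>\<^sup>+ x. birkhoff_sum g n x \<partial>M)" for n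
      using e by (simp add: nn_integral_birkhoff_sum ennreal_of_nat_eq_real_of_nat ennreal_mult')
  qed (use e \<epsilon> in \<open>simp_all add: birkhoff_sum_add nn_integral_birkhoff_sum birkhoff_sum_Suc\<close>)
  ultimately show ?thesis
  proof eventually_elim
    fix x
    assume up: "eventually (\<lambda>n. birkhoff_sum g n x \<le> ennreal (real n * (e + \<epsilon>/4))) sequentially"
      and lo: "eventually (\<lambda>n. ennreal (real n * (e - \<epsilon>/4)) \<le> birkhoff_sum g n x) sequentially"
    have up': "eventually (\<lambda>n. birkhoff_sum g (Suc n) x \<le> ennreal (real (Suc n) * (e + \<epsilon>/4))) sequentially"
      using up by (subst eventually_sequentially_Suc)
    have "filterlim real at_top sequentially" by (rule filterlim_real_sequentially)
    \<comment> \<open>The two margins \<open>\<epsilon>/4\<close> contribute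
      \<open>n * \<epsilon> / 2\<close> to the increment; for these \<open>n\<close> the extra
      summand \<open>e + \<epsilon>/4\<close> contributes no more than that.\<close>
    then have large: "eventually (\<lambda>n. 2 * (e + \<epsilon>/4) / \<epsilon> \<le> real n) sequentially"
      by (simp add: filterlim_at_top)
    show "eventually (\<lambda>n. g ((\<tau> ^^ n) x) \<le> ennreal (real n * \<epsilon>)) sequentially"
      using up' lo large
    proof eventually_elim
      fix n assume a: "birkhoff_sum g (Suc n) x \<le> ennreal (real (Suc n) * (e + \<epsilon>/4))"
        and b: "ennreal (real n * (e - \<epsilon>/4)) \<le> birkhoff_sum g n x"
        and l: "2 * (e + \<epsilon>/4) / \<epsilon> \<le> real n"
      have nn: "0 \<le> real (Suc n) * (e + \<epsilon>/4)" using e \<epsilon> by auto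
      have "birkhoff_sum g n x + g ((\<tau> ^^ n) x) \<le> ennreal (real (Suc n) * (e + \<epsilon>/4))"
        using a by (simp add: birkhoff_sum_Suc)
      moreover from this have "birkhoff_sum g n x < \<infinity>" "g ((\<tau> ^^ n) x) < \<infinity>"
        by (auto simp: less_top[symmetric] top_unique)
      then obtain s t where s: "birkhoff_sum g n x = ennreal s" "0 \<le> s" and t: "g ((\<tau> ^^ n) x) = ennreal t" "0 \<le> t"
        by (cases "birkhoff_sum g n x"; cases "g ((\<tau> ^^ n) x)") auto
      ultimately have "s + t \<le> real (Suc n) * (e + \<epsilon>/4)" using nn by (simp flip: ennreal_plus)
      moreover have "real n * (e - \<epsilon>/4) \<le> s" using b s by (simp add: ennreal_le_iff)
      moreover have "2 * (e + \<epsilon>/4) \<le> real n * \<epsilon>" using l \<epsilon> by (simp add: field_simps)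
      ultimately have "t \<le> real n * \<epsilon>" by (simp add: field_simps)
      then show "g ((\<tau> ^^ n) x) \<le> ennreal (real n * \<epsilon>)" using t by (simp add: ennreal_leI)
    qed
  qed
qed

end

text \<open>Margins \<open>1 / real (Suc j)\<close> suffice by the Archimedean property; being
  countably many, they can all be imposed on one almost sure event.\<close>

lemma tendsto_ennreal_of_bounds:
  fixes Y :: "nat \<Rightarrow> ennreal" and \<gamma> :: real
  assumes up: "\<And>j. eventually (\<lambda>n. Y n \<le> ennreal (\<gamma> + 1 / real (Suc j))) sequentially"
    and lo: "\<And>j. eventually (\<lambda>n. ennreal (\<gamma> - 1 / real (Suc j)) \<le> Y n) sequentially"
    and \<gamma>: "0 \<le> \<gamma>"
  shows "Y \<longlonglongrightarrow> ennreal \<gamma>"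
proof (rule order_tendstoI)
  fix a assume "ennreal \<gamma> < a"
  then obtain r where r: "\<gamma> < r" "ennreal r \<le> a"
    using \<gamma> by (cases a) (auto intro: that[of "\<gamma> + 1"] simp: ennreal_less_iff)
  then obtain j where j: "1 / real (Suc j) < r - \<gamma>"
    using reals_Archimedean[of "r - \<gamma>"] by (auto simp: inverse_eq_divide)
  have "ennreal (\<gamma> + 1 / real (Suc j)) < ennreal r" using j \<gamma> r by (intro ennreal_lessI) auto
  with r(2) have "ennreal (\<gamma> + 1 / real (Suc j)) < a" by simp
  then show "eventually (\<lambda>n. Y n < a) sequentially"
    using up[of j] by (auto elim!: eventually_mono)
next
  fix a assume "a < ennreal \<gamma>"
  then obtain r where r: "a = ennreal r" "0 \<le> r" "r < \<gamma>"
    by (cases a) (auto simp: ennreal_less_iff)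
  then obtain j where j: "1 / real (Suc j) < \<gamma> - r"
    using reals_Archimedean[of "\<gamma> - r"] by (auto simp: inverse_eq_divide)
  then have "a < ennreal (\<gamma> - 1 / real (Suc j))" using r by (simp add: ennreal_less_iff)
  then show "eventually (\<lambda>n. a < Y n) sequentially"
    using lo[of j] by (auto elim!: eventually_mono)
qed

text \<open>The real \<open>c\<close> may be negative, as \<open>\<gamma> - 1 / real (Suc j)\<close>
  can be; both sides then compare with 0.\<close>

lemma divide_of_nat_le_iff:
  fixes X :: ennreal
  assumes "0 < n"
  shows "X / of_nat n \<le> ennreal c \<longleftrightarrow> X \<le> ennreal (real n * c)" "ennreal c \<le> X / of_nat n \<longleftrightarrow> ennreal (real n * c) \<le> X"
proof -
  show "X / of_nat n \<le> ennreal c \<longleftrightarrow> X \<le> ennreal (real n * c)"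
  proof (cases X)
    case (real r)
    with assms show ?thesis
      by (simp add: ennreal_of_nat_eq_real_of_nat divide_ennreal ennreal_le_iff2 divide_le_eq
            zero_le_mult_iff mult_le_0_iff divide_le_0_iff mult.commute)
  qed (use assms in \<open>auto simp: ennreal_top_divide top_unique\<close>)
  show "ennreal c \<le> X / of_nat n \<longleftrightarrow> ennreal (real n * c) \<le> X"
  proof (cases X)
    case (real r)
    with assms show ?thesis
      by (simp add: ennreal_of_nat_eq_real_of_nat divide_ennreal ennreal_le_iff2 le_divide_eq
            zero_le_mult_iff mult_le_0_iff divide_le_0_iff mult.commute)
  qed (use assms in \<open>auto simp: ennreal_top_divide top_unique\<close>)
qed

text \<open>Scheffe's argument: the minimum with \<open>c\<close> converges in mean by dominated
  convergence, and since maximum plus minimum equals \<open>Y n x + c\<close>, the convergence of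
  the means of \<open>Y n\<close> controls the maximum.\<close>

lemma (in prob_space) nn_integral_abs_diff_tendsto_0:
  fixes Y :: "nat \<Rightarrow> 'a \<Rightarrow> ennreal" and c :: real
  assumes [measurable]: "\<And>n. Y n \<in> borel_measurable M"
    and lim: "AE x in M. (\<lambda>n. Y n x) \<longlonglongrightarrow> ennreal c"
    and int: "(\<lambda>n. \<integral>\<^sup>+ x. Y n x \<partial>M) \<longlonglongrightarrow> ennreal c" and c: "0 \<le> c"
  shows "(\<lambda>n. \<integral>\<^sup>+ x. max (Y n x) (ennreal c) - min (Y n x) (ennreal c) \<partial>M) \<longlonglongrightarrow> 0"
proof -
  define m where "m n = (\<integral>\<^sup>+ x. min (Y n x) (ennreal c) \<partial>M)" for n
  have "m \<longlonglongrightarrow> (\<integral>\<^sup>+ x. ennreal c \<partial>M)"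
    unfolding m_def
  proof (rule nn_integral_dominated_convergence[where w = "\<lambda>_. ennreal c"])
    show "AE x in M. (\<lambda>n. min (Y n x) (ennreal c)) \<longlonglongrightarrow> ennreal c"
      using lim
    proof eventually_elim
      fix x assume "(\<lambda>n. Y n x) \<longlonglongrightarrow> ennreal c"
      then have "(\<lambda>n. min (Y n x) (ennreal c)) \<longlonglongrightarrow> min (ennreal c) (ennreal c)"
        by (intro tendsto_min tendsto_const)
      then show "(\<lambda>n. min (Y n x) (ennreal c)) \<longlonglongrightarrow> ennreal c" by simp
    qed
  qed (auto simp: emeasure_space_1)
  then have m: "m \<longlonglongrightarrow> ennreal c" by (simp add: emeasure_space_1)
  have m_le: "m n \<le> ennreal c" for n
  proof -
    have "m n \<le> (\<integral>\<^sup>+ x. ennreal c \<partial>M)" unfolding m_def by (intro nn_integral_mono) simp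
    then show ?thesis by (simp add: emeasure_space_1)
  qed
  have fin: "m n \<noteq> \<top>" for n using m_le[of n] by (auto simp: top_unique)
  have eq: "(\<integral>\<^sup>+ x. max (Y n x) (ennreal c) - min (Y n x) (ennreal c) \<partial>M)
      = ((\<integral>\<^sup>+ x. Y n x \<partial>M) + ennreal c - m n) - m n" for n
  proof -
    have "(\<integral>\<^sup>+ x. max (Y n x) (ennreal c) - min (Y n x) (ennreal c) \<partial>M)
        = (\<integral>\<^sup>+ x. max (Y n x) (ennreal c) \<partial>M) - m n"
      unfolding m_def using fin[of n] by (intro nn_integral_diff) (auto simp: m_def less_top[symmetric] top_unique min_le_iff_disj)
    moreover have "(\<integral>\<^sup>+ x. max (Y n x) (ennreal c) \<partial>M) + m n = (\<integral>\<^sup>+ x. Y n x \<partial>M) + ennreal c"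
    proof -
      have "(\<integral>\<^sup>+ x. max (Y n x) (ennreal c) \<partial>M) + m n
          = (\<integral>\<^sup>+ x. max (Y n x) (ennreal c) + min (Y n x) (ennreal c) \<partial>M)"
        unfolding m_def by (intro nn_integral_add[symmetric]) auto
      also have "\<dots> = (\<integral>\<^sup>+ x. Y n x + ennreal c \<partial>M)"
        by (intro nn_integral_cong) (auto simp: max_def min_def add.commute)
      also have "\<dots> = (\<integral>\<^sup>+ x. Y n x \<partial>M) + ennreal c" by (simp add: nn_integral_add emeasure_space_1)
      finally show ?thesis .
    qed
    ultimately show ?thesis using fin[of n] by (metis ennreal_add_diff_cancel_right)
  qed
  have "(\<lambda>n. ((\<integral>\<^sup>+ x. Y n x \<partial>M) + ennreal c - m n) - m n) \<longlonglongrightarrow> (ennreal c + ennreal c - ennreal c) - ennreal c"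
    by (intro tendsto_diff_ennreal tendsto_add int m tendsto_const) auto
  then show ?thesis by (simp add: eq)
qed

text \<open>A power of an ergodic map need not be ergodic, and the upper bound sums over blocks of
  length \<open>k\<close>, which are moved by \<open>\<tau> ^^ k\<close>. Powers of a nonzero
  translation are again nonzero translations.\<close>

locale totally_ergodic_system = ergodic_system +
  assumes ergodic_funpow: "\<And>k. 0 < k \<Longrightarrow> ergodic_system M (\<tau> ^^ k)"
begin

text \<open>Time is cut into blocks of length \<open>k\<close> and a remainder. The blocks form a
  Birkhoff sum for \<open>\<tau> ^^ k\<close> with mean at most \<open>k * c\<close>; the remainder
  is at most \<open>k\<close> unit steps from a late point of the orbit, and these grow
  sublinearly.\<close>

lemma subadditive_eventually_le:
  fixes X :: "nat \<Rightarrow> 'a \<Rightarrow> ennreal" and c c' :: real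
  assumes meas [measurable]: "\<And>n. X n \<in> borel_measurable M"
    and X0: "\<And>x. X 0 x = 0"
    and sub: "\<And>m n x. X (m + n) x \<le> X m x + X n ((\<tau> ^^ m) x)"
    and fin: "(\<integral>\<^sup>+ x. X 1 x \<partial>M) < \<infinity>"
    and upper: "(\<integral>\<^sup>+ x. X k x \<partial>M) \<le> ennreal (real k * c)"
    and k: "0 < k" and c: "0 \<le> c" "c < c'"
  shows "AE x in M. eventually (\<lambda>n. X n x \<le> ennreal (real n * c')) sequentially"
proof -
  interpret K: ergodic_system M "\<tau> ^^ k" using k by (rule ergodic_funpow)
  \<comment> \<open>The slack is shared equally: the blocks use slope \<open>b\<close>, the
    remainder gets slope \<open>c' - b\<close>.\<close>
  define b where "b = (c + c') / 2"
  have b: "c < b" "b < c'" "0 < b" using c by (auto simp: b_def)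
  have funpow_k: "(\<tau> ^^ k) ^^ n = \<tau> ^^ (k * n)" for n by (simp add: funpow_mult mult.commute)
  have X_birkhoff: "X n x \<le> birkhoff_sum (X 1) n x" for n x
    using X0 sub by (rule subadditive_le_birkhoff_sum)
  have X_birkhoff_k: "X (k * n) x \<le> K.birkhoff_sum (X k) n x" for n x
  proof (induction n)
    case (Suc n)
    have "X (k * n + k) x \<le> X (k * n) x + X k ((\<tau> ^^ (k * n)) x)" by (rule sub)
    with Suc show ?case
      by (simp add: K.birkhoff_sum_Suc funpow_k add.commute add_mono order_trans[OF _ add_right_mono])
  qed (simp add: X0)
  have "AE x in M. eventually (\<lambda>n. K.birkhoff_sum (X k) n x \<le> ennreal (real n * (real k * b))) sequentially"
    using upper c b k by (intro K.birkhoff_eventually_le[where e = "real k * c"]) auto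
  moreover have "AE x in M. eventually (\<lambda>n. birkhoff_sum (X 1) k (((\<tau> ^^ k) ^^ n) x) \<le> ennreal (real n * (real k * (c' - b)))) sequentially"
    using fin b k by (intro K.shift_eventually_sublinear) (simp_all add: nn_integral_birkhoff_sum ennreal_mult_less_top of_nat_less_top)
  ultimately show ?thesis
  proof eventually_elim
    fix x
    assume "eventually (\<lambda>n. K.birkhoff_sum (X k) n x \<le> ennreal (real n * (real k * b))) sequentially"
      and "eventually (\<lambda>n. birkhoff_sum (X 1) k (((\<tau> ^^ k) ^^ n) x) \<le> ennreal (real n * (real k * (c' - b)))) sequentially"
    then have "eventually (\<lambda>n. K.birkhoff_sum (X k) n x \<le> ennreal (real n * (real k * b)) \<and>
        birkhoff_sum (X 1) k (((\<tau> ^^ k) ^^ n) x) \<le> ennreal (real n * (real k * (c' - b)))) sequentially"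
      by (rule eventually_conj)
    then obtain N where N: "\<And>n. N \<le> n \<Longrightarrow> K.birkhoff_sum (X k) n x \<le> ennreal (real n * (real k * b))"
        "\<And>n. N \<le> n \<Longrightarrow> birkhoff_sum (X 1) k (((\<tau> ^^ k) ^^ n) x) \<le> ennreal (real n * (real k * (c' - b)))"
      by (auto simp: eventually_sequentially)
    show "eventually (\<lambda>n. X n x \<le> ennreal (real n * c')) sequentially"
      unfolding eventually_sequentially
    proof (intro exI allI impI)
      fix m assume m: "k * N \<le> m"
      define n where "n = m div k"
      define r where "r = m mod k"
      have mr: "m = k * n + r" "r < k" using k by (auto simp: n_def r_def)
      have nN: "N \<le> n" using m k by (simp add: n_def less_eq_div_iff_mult_less_eq mult.commute)
      let ?y = "(\<tau> ^^ (k * n)) x"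
      have "X m x \<le> X (k * n) x + X r ?y" unfolding mr(1) by (rule sub)
      also have "\<dots> \<le> K.birkhoff_sum (X k) n x + birkhoff_sum (X 1) r ?y"
        by (intro add_mono X_birkhoff X_birkhoff_k)
      also have "birkhoff_sum (X 1) r ?y \<le> birkhoff_sum (X 1) k ?y"
        unfolding birkhoff_sum_def using mr by (intro sum_mono2) auto
      also have "K.birkhoff_sum (X k) n x + birkhoff_sum (X 1) k ?y
         \<le> ennreal (real n * (real k * b)) + ennreal (real n * (real k * (c' - b)))"
        using N[OF nN] by (intro add_mono) (simp_all add: funpow_k)
      also have "\<dots> = ennreal (real n * (real k * b) + real n * (real k * (c' - b)))"
        using b by (subst ennreal_plus) auto
      also have "real n * (real k * b) + real n * (real k * (c' - b)) = real (k * n) * c'"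
        by (simp add: algebra_simps)
      also have "ennreal \<dots> \<le> ennreal (real m * c')"
        using b mr by (intro ennreal_leI mult_right_mono) auto
      finally show "X m x \<le> ennreal (real m * c')" by (simp add: add_left_mono)
    qed
  qed
qed

text \<open>The constant is the infimum of the means divided by \<open>n\<close> and, by Fekete's
  argument, their limit. The last conclusion describes it through means alone; the seminorm
  properties and positivity are derived from that.\<close>

lemma subadditive_ergodic_theorem:
  fixes X :: "nat \<Rightarrow> 'a \<Rightarrow> ennreal"
  assumes meas [measurable]: "\<And>n. X n \<in> borel_measurable M"
    and X0: "\<And>x. X 0 x = 0"
    and sub: "\<And>m n x. X (m + n) x \<le> X m x + X n ((\<tau> ^^ m) x)"
    and fin: "(\<integral>\<^sup>+ x. X 1 x \<partial>M) < \<infinity>"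
  obtains \<gamma> :: real where "0 \<le> \<gamma>"
    "AE x in M. (\<lambda>n. X n x / of_nat n) \<longlonglongrightarrow> ennreal \<gamma>"
    "(\<lambda>n. \<integral>\<^sup>+ x. max (X n x / of_nat n) (ennreal \<gamma>) - min (X n x / of_nat n) (ennreal \<gamma>) \<partial>M) \<longlonglongrightarrow> 0"
    "(\<lambda>n. enn2real (\<integral>\<^sup>+ x. X n x \<partial>M) / real n) \<longlonglongrightarrow> \<gamma>"
proof -
  define m where "m n = enn2real (\<integral>\<^sup>+ x. X n x \<partial>M)" for n
  have int_sub: "(\<integral>\<^sup>+ x. X (i + j) x \<partial>M) \<le> (\<integral>\<^sup>+ x. X i x \<partial>M) + (\<integral>\<^sup>+ x. X j x \<partial>M)" for i j
  proof -
    have "(\<integral>\<^sup>+ x. X (i + j) x \<partial>M) \<le> (\<integral>\<^sup>+ x. X i x + X j ((\<tau> ^^ i) x) \<partial>M)"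
      by (intro nn_integral_mono sub)
    also have "\<dots> = (\<integral>\<^sup>+ x. X i x \<partial>M) + (\<integral>\<^sup>+ x. X j ((\<tau> ^^ i) x) \<partial>M)"
      by (intro nn_integral_add) auto
    also have "(\<integral>\<^sup>+ x. X j ((\<tau> ^^ i) x) \<partial>M) = (\<integral>\<^sup>+ x. X j x \<partial>M)"
      by (rule nn_integral_shift_funpow) auto
    finally show ?thesis .
  qed
  have fin_n: "(\<integral>\<^sup>+ x. X n x \<partial>M) < \<infinity>" for n
  proof (induction n)
    case (Suc n)
    then show ?case using int_sub[of n 1] fin by (simp add: order.strict_trans1)
  qed (simp add: X0)
  then have m: "(\<integral>\<^sup>+ x. X n x \<partial>M) = ennreal (m n)" "0 \<le> m n" for n by (auto simp: m_def)
  have m_sub: "m (i + j) \<le> m i + m j" for i j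
    using int_sub[of i j] by (simp add: m flip: ennreal_plus)
  define \<gamma> where "\<gamma> = (INF n\<in>{1..}. m n / real n)"
  have bdd: "bdd_below ((\<lambda>n. m n / real n) ` {1..})" using m by (intro bdd_belowI2[of _ 0]) simp
  have \<gamma>0: "0 \<le> \<gamma>" unfolding \<gamma>_def using m by (intro cINF_greatest) auto
  have \<gamma>_le: "real n * \<gamma> \<le> m n" for n
  proof (cases "n = 0")
    case False
    then have "\<gamma> \<le> m n / real n" unfolding \<gamma>_def using bdd by (intro cINF_lower) auto
    with False show ?thesis by (simp add: field_simps)
  qed (simp add: m)
  have below: "\<exists>k>0. m k < real k * c" if "\<gamma> < c" for c
  proof -
    have "\<exists>k\<in>{1..}. m k / real k < c"
      using that bdd unfolding \<gamma>_def by (subst (asm) cINF_less_iff) auto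
    then obtain k where "1 \<le> k" "m k / real k < c" by auto
    then show ?thesis by (intro exI[of _ k]) (simp add: field_simps)
  qed
  have lo: "AE x in M. eventually (\<lambda>n. ennreal (real n * c) \<le> X n x) sequentially" if "c < \<gamma>" for c
    using that fin by (intro subadditive_eventually_ge[where \<gamma> = \<gamma>] sub X0) (auto simp: m \<gamma>_le ennreal_leI)
  have up: "AE x in M. eventually (\<lambda>n. X n x \<le> ennreal (real n * c)) sequentially" if c: "\<gamma> < c" for c
  proof -
    obtain k where k: "0 < k" "m k < real k * ((\<gamma> + c) / 2)" using below[of "(\<gamma> + c) / 2"] c by auto
    show ?thesis using k c \<gamma>0 fin
      by (intro subadditive_eventually_le[where k = k and c = "(\<gamma> + c) / 2"] sub X0) (auto simp: m ennreal_leI)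
  qed
  have pos: "eventually (\<lambda>n::nat. 0 < n) sequentially" by (rule eventually_gt_at_top)
  have ae: "AE x in M. (\<lambda>n. X n x / of_nat n) \<longlonglongrightarrow> ennreal \<gamma>"
  proof -
    have "AE x in M. \<forall>j. eventually (\<lambda>n. X n x \<le> ennreal (real n * (\<gamma> + 1 / real (Suc j)))) sequentially"
      unfolding AE_all_countable by (intro allI up) simp
    moreover have "AE x in M. \<forall>j. eventually (\<lambda>n. ennreal (real n * (\<gamma> - 1 / real (Suc j))) \<le> X n x) sequentially"
      unfolding AE_all_countable by (intro allI lo) simp
    ultimately show ?thesis
    proof eventually_elim
      fix x
      assume 1: "\<forall>j. eventually (\<lambda>n. X n x \<le> ennreal (real n * (\<gamma> + 1 / real (Suc j)))) sequentially"
        and 2: "\<forall>j. eventually (\<lambda>n. ennreal (real n * (\<gamma> - 1 / real (Suc j))) \<le> X n x) sequentially"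
      show "(\<lambda>n. X n x / of_nat n) \<longlonglongrightarrow> ennreal \<gamma>"
      proof (rule tendsto_ennreal_of_bounds[OF _ _ \<gamma>0])
        fix j
        show "eventually (\<lambda>n. X n x / of_nat n \<le> ennreal (\<gamma> + 1 / real (Suc j))) sequentially"
          using 1[rule_format, of j] pos by eventually_elim (simp add: divide_of_nat_le_iff)
        show "eventually (\<lambda>n. ennreal (\<gamma> - 1 / real (Suc j)) \<le> X n x / of_nat n) sequentially"
          using 2[rule_format, of j] pos by eventually_elim (simp add: divide_of_nat_le_iff)
      qed
    qed
  qed
  have mlim: "(\<lambda>n. m n / real n) \<longlonglongrightarrow> \<gamma>"
  proof (rule order_tendstoI)
    fix a assume a: "a < \<gamma>"
    show "eventually (\<lambda>n. a < m n / real n) sequentially"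
      using pos
    proof eventually_elim
      fix n :: nat assume "0 < n"
      then have "a * real n < \<gamma> * real n" using a by simp
      with \<gamma>_le[of n] have "a * real n < m n" by (simp add: mult.commute)
      with \<open>0 < n\<close> show "a < m n / real n" by (simp add: less_divide_eq)
    qed
  next
    fix a assume a: "\<gamma> < a"
    define b where "b = (\<gamma> + a) / 2"
    have b: "\<gamma> < b" "b < a" "0 < b" using a \<gamma>0 by (auto simp: b_def)
    obtain k where k: "0 < k" "m k < real k * b" using below[OF b(1)] by auto
    have mr: "m r \<le> real r * m 1" for r
    proof (induction r)
      case 0
      have "m 0 = 0" by (simp add: m_def X0)
      then show ?case by simp
    next
      case (Suc r)
      then show ?case using m_sub[of r 1] by (simp add: algebra_simps)
    qed
    have mk: "m (k * n + r) \<le> real n * m k + m r" for n r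
    proof (induction n)
      case (Suc n)
      have "m (k + (k * n + r)) \<le> m k + m (k * n + r)" by (rule m_sub)
      with Suc show ?case by (simp add: algebra_simps)
    qed simp
    \<comment> \<open>Division by \<open>k\<close> with remainder: full blocks have slope at most
      \<open>b\<close>, and the remainder is bounded independently of \<open>n\<close>.\<close>
    have le: "m n \<le> real n * b + real k * m 1" for n
    proof -
      have "m n \<le> real (n div k) * m k + m (n mod k)" using mk[of "n div k" "n mod k"] by simp
      also have "\<dots> \<le> real (n div k) * (real k * b) + real (n mod k) * m 1"
        using k by (intro add_mono mult_left_mono mr) auto
      also have "\<dots> \<le> real n * b + real k * m 1"
      proof (intro add_mono mult_right_mono)
        have "real (n div k) * real k \<le> real n"
          by (metis div_times_less_eq_dividend of_nat_le_iff of_nat_mult)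
        then show "real (n div k) * (real k * b) \<le> real n * b"
          using b by (simp add: mult.assoc[symmetric] mult_right_mono)
        show "real (n mod k) \<le> real k" using k by (simp add: less_imp_le)
      qed (use m in auto)
      finally show ?thesis .
    qed
    have "eventually (\<lambda>n. real k * m 1 / (a - b) < real n) sequentially"
      using filterlim_real_sequentially by (simp add: filterlim_at_top_dense)
    then show "eventually (\<lambda>n. m n / real n < a) sequentially" using pos
    proof eventually_elim
      fix n :: nat assume n: "real k * m 1 / (a - b) < real n" "0 < n"
      then have "real k * m 1 < real n * a - real n * b" using b by (simp add: field_simps)
      with le[of n] have "m n < real n * a" by linarith
      then show "m n / real n < a" using n by (simp add: field_simps)
    qed
  qed
  have "(\<lambda>n. ennreal (m n / real n)) \<longlonglongrightarrow> ennreal \<gamma>" using mlim by (rule tendsto_ennrealI)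
  moreover have "eventually (\<lambda>n. ennreal (m n / real n) = (\<integral>\<^sup>+ x. X n x / of_nat n \<partial>M)) sequentially"
    using pos
  proof eventually_elim
    fix n :: nat assume "0 < n"
    then show "ennreal (m n / real n) = (\<integral>\<^sup>+ x. X n x / of_nat n \<partial>M)"
      by (simp add: nn_integral_divide m ennreal_of_nat_eq_real_of_nat divide_ennreal)
  qed
  ultimately have int: "(\<lambda>n. \<integral>\<^sup>+ x. X n x / of_nat n \<partial>M) \<longlonglongrightarrow> ennreal \<gamma>"
    by (rule Lim_transform_eventually)
  show ?thesis
    using that[OF \<gamma>0 ae nn_integral_abs_diff_tendsto_0[OF _ ae int \<gamma>0]] mlim by (simp add: m_def)
qed

end

section \<open>The time constant as a seminorm\<close>

text \<open>The integer part of \<open>n \<bar>s\<bar>\<close> replaces \<open>n s\<close> at bounded cost, which gives homogeneity under real factors.\<close>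

lemma subadditive_limit_seminorm:
  fixes m :: "'a::real_vector \<Rightarrow> real" and \<mu> :: "'a \<Rightarrow> real"
  assumes sub: "\<And>x y. m (x + y) \<le> m x + m y" and minus: "\<And>x. m (- x) = m x"
    and nonneg: "\<And>x. 0 \<le> m x"
    and bdd: "\<And>x. \<exists>C. \<forall>t\<in>{0..1}. m (t *\<^sub>R x) \<le> C"
    and lim: "\<And>x. (\<lambda>n. m (real n *\<^sub>R x) / real n) \<longlonglongrightarrow> \<mu> x"
  shows "0 \<le> \<mu> x" "\<mu> (x + y) \<le> \<mu> x + \<mu> y" "\<mu> (s *\<^sub>R x) = \<bar>s\<bar> * \<mu> x"
proof -
  show "0 \<le> \<mu> x" by (rule LIMSEQ_le_const[OF lim]) (auto simp: nonneg)
  show "\<mu> (x + y) \<le> \<mu> x + \<mu> y"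
  proof (rule LIMSEQ_le[OF lim tendsto_add[OF lim lim]])
    show "\<exists>N. \<forall>n\<ge>N. m (real n *\<^sub>R (x + y)) / real n \<le> m (real n *\<^sub>R x) / real n + m (real n *\<^sub>R y) / real n"
      using sub by (auto simp: scaleR_add_right add_divide_distrib[symmetric] intro!: divide_right_mono)
  qed
  have pos: "\<mu> (s *\<^sub>R x) = s * \<mu> x" if s: "0 < s" for s x
  proof -
    obtain C where C: "\<And>t. t \<in> {0..1} \<Longrightarrow> m (t *\<^sub>R x) \<le> C" using bdd[of x] by blast
    define k where "k n = nat \<lfloor>real n * s\<rfloor>" for n
    have k: "real (k n) \<le> real n * s" "real n * s < real (k n) + 1" for n
      using s by (auto simp: k_def of_nat_nat)
    have klim: "filterlim k at_top sequentially"
      unfolding filterlim_at_top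
    proof
      fix Z
      have "eventually (\<lambda>n. (real Z + 1) / s < real n) sequentially"
        using filterlim_real_sequentially by (simp add: filterlim_at_top_dense)
      then show "eventually (\<lambda>n. Z \<le> k n) sequentially"
      proof eventually_elim
        fix n assume "(real Z + 1) / s < real n"
        then have "real Z + 1 < real n * s" using s by (simp add: field_simps)
        with k(2)[of n] show "Z \<le> k n" by linarith
      qed
    qed
    have kn: "(\<lambda>n. real (k n) / real n) \<longlonglongrightarrow> s"
    proof (rule real_tendsto_sandwich[of "\<lambda>n. s - 1 / real n" _ _ "\<lambda>n. s"])
      show "eventually (\<lambda>n. s - 1 / real n \<le> real (k n) / real n) sequentially"
        using eventually_gt_at_top[of 0]
      proof eventually_elim
        fix n :: nat assume "0 < n"
        have "(real n * s - 1) / real n \<le> real (k n) / real n"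
          using k(2)[of n] by (intro divide_right_mono) auto
        with \<open>0 < n\<close> show "s - 1 / real n \<le> real (k n) / real n" by (simp add: diff_divide_distrib)
      qed
      show "eventually (\<lambda>n. real (k n) / real n \<le> s) sequentially"
        using eventually_gt_at_top[of 0]
        by eventually_elim (use k(1) in \<open>auto simp: field_simps\<close>)
      have "(\<lambda>n. s - 1 / real n) \<longlonglongrightarrow> s - 0" by (intro tendsto_intros lim_1_over_n)
      then show "(\<lambda>n. s - 1 / real n) \<longlonglongrightarrow> s" by simp
    qed auto
    have "(\<lambda>n. m (real (k n) *\<^sub>R x) / real (k n) * (real (k n) / real n)) \<longlonglongrightarrow> \<mu> x * s"
      by (intro tendsto_mult kn filterlim_compose[OF lim klim])
    then have main: "(\<lambda>n. m (real (k n) *\<^sub>R x) / real (k n) * (real (k n) / real n)) \<longlonglongrightarrow> s * \<mu> x"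
      by (simp add: mult.commute)
    have err: "(\<lambda>n. C / real n) \<longlonglongrightarrow> 0"
      using tendsto_mult[OF tendsto_const[of C] lim_1_over_n] by simp
    have "(\<lambda>n. m (real n *\<^sub>R (s *\<^sub>R x)) / real n - m (real (k n) *\<^sub>R x) / real (k n) * (real (k n) / real n)) \<longlonglongrightarrow> 0"
    proof (rule Lim_null_comparison[OF _ err])
      have "eventually (\<lambda>n. 0 < k n) sequentially"
        using klim eventually_gt_at_top[of 0] by (rule filterlim_iff[THEN iffD1, rule_format])
      then show "eventually (\<lambda>n. norm (m (real n *\<^sub>R (s *\<^sub>R x)) / real n - m (real (k n) *\<^sub>R x) / real (k n) * (real (k n) / real n)) \<le> C / real n) sequentially"
      proof eventually_elim
        fix n assume kp: "0 < k n"
        define t where "t = real n * s - real (k n)"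
        have t: "t \<in> {0..1}" using k[of n] by (auto simp: t_def)
        have "real n *\<^sub>R (s *\<^sub>R x) = real (k n) *\<^sub>R x + t *\<^sub>R x" by (simp add: t_def algebra_simps)
        then have 1: "m (real n *\<^sub>R (s *\<^sub>R x)) \<le> m (real (k n) *\<^sub>R x) + m (t *\<^sub>R x)" using sub by metis
        have "real (k n) *\<^sub>R x = real n *\<^sub>R (s *\<^sub>R x) + - (t *\<^sub>R x)" by (simp add: t_def algebra_simps)
        then have 2: "m (real (k n) *\<^sub>R x) \<le> m (real n *\<^sub>R (s *\<^sub>R x)) + m (t *\<^sub>R x)" using sub minus by metis
        have "\<bar>m (real n *\<^sub>R (s *\<^sub>R x)) - m (real (k n) *\<^sub>R x)\<bar> \<le> C" using 1 2 C[OF t] by linarith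
        then have "\<bar>m (real n *\<^sub>R (s *\<^sub>R x)) - m (real (k n) *\<^sub>R x)\<bar> / real n \<le> C / real n"
          by (intro divide_right_mono) auto
        then show "norm (m (real n *\<^sub>R (s *\<^sub>R x)) / real n - m (real (k n) *\<^sub>R x) / real (k n) * (real (k n) / real n)) \<le> C / real n"
          using kp by (simp add: diff_divide_distrib[symmetric] abs_divide)
      qed
    qed
    from tendsto_add[OF this main] have "(\<lambda>n. m (real n *\<^sub>R (s *\<^sub>R x)) / real n) \<longlonglongrightarrow> s * \<mu> x" by simp
    with lim[of "s *\<^sub>R x"] show ?thesis by (rule LIMSEQ_unique)
  qed
  have minus_\<mu>: "\<mu> (- x) = \<mu> x" for x
    using lim[of "- x"] lim[of x] minus by (auto simp: intro: LIMSEQ_unique)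
  have zero: "\<mu> 0 = 0"
  proof -
    have "(\<lambda>n. m 0 / real n) \<longlonglongrightarrow> 0"
      using tendsto_mult[OF tendsto_const[of "m 0"] lim_1_over_n] by simp
    with lim[of 0] show ?thesis by (auto intro: LIMSEQ_unique)
  qed
  show "\<mu> (s *\<^sub>R x) = \<bar>s\<bar> * \<mu> x"
  proof (cases s "0::real" rule: linorder_cases)
    case less
    have "\<mu> (s *\<^sub>R x) = \<mu> ((- s) *\<^sub>R x)" using minus_\<mu>[of "s *\<^sub>R x"] by simp
    also have "\<dots> = \<bar>s\<bar> * \<mu> x" using less by (subst pos) auto
    finally show ?thesis .
  qed (use zero pos in auto)
qed

text \<open>The law itself is the probability space and the identity is the random density, so that
  translations act on the space and the abstract ergodic theory applies directly.\<close>

locale ergodic_density = prob_space L for L :: "'d::finite density measure" +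
  assumes events: "density_events L"
    and finite_moment: "\<And>x. (\<integral>\<^sup>+ \<phi>. arc_integral \<phi> (linepath 0 x) \<partial>L) < \<infinity>"
    and ergodicity: "\<And>v. v \<noteq> 0 \<Longrightarrow> ergodic_translation L v"
begin

lemma space_L [simp]: "space L = UNIV"
  using events unfolding density_events_def by blast

lemma measurable_translate [measurable]: "translate v \<in> measurable L L"
proof (cases "v = 0")
  case True
  then show ?thesis by (simp add: id_def)
next
  case False
  from ergodicity[OF this] show ?thesis unfolding ergodic_translation_def by blast
qed

lemma distr_translate: "distr L L (translate v) = L"
proof (cases "v = 0")
  case True
  then show ?thesis by (simp add: id_def)
next
  case False
  from ergodicity[OF this] show ?thesis unfolding ergodic_translation_def by blast
qed

lemma measurable_T [measurable]: "(\<lambda>\<phi>. T \<phi> x y) \<in> borel_measurable L"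
  using events unfolding density_events_def by blast

lemma measurable_T_annulus [measurable]: "1 < R \<Longrightarrow> (\<lambda>\<phi>. T_annulus \<phi> R) \<in> borel_measurable L"
  using events unfolding density_events_def by blast

lemma nn_integral_translate:
  assumes [measurable]: "f \<in> borel_measurable L"
  shows "(\<integral>\<^sup>+ \<phi>. f (translate v \<phi>) \<partial>L) = (\<integral>\<^sup>+ \<phi>. f \<phi> \<partial>L)"
proof -
  have "(\<integral>\<^sup>+ \<phi>. f (translate v \<phi>) \<partial>L) = (\<integral>\<^sup>+ \<phi>. f \<phi> \<partial>distr L L (translate v))"
    by (rule nn_integral_distr[symmetric]) auto
  then show ?thesis by (simp add: distr_translate)
qed

lemma prob_translate:
  assumes [measurable]: "E \<in> sets L"
  shows "prob {\<phi>. translate v \<phi> \<in> E} = prob E"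
proof -
  have "prob E = measure (distr L L (translate v)) E" by (simp add: distr_translate)
  also have "\<dots> = prob (translate v -` E \<inter> space L)" by (rule measure_distr) auto
  finally show ?thesis by (simp add: vimage_def)
qed

lemma totally_ergodic_translate:
  assumes "v \<noteq> 0" shows "totally_ergodic_system L (translate v)"
proof -
  have erg: "ergodic_system L (translate w)" if "w \<noteq> 0" for w
  proof unfold_locales
    show "translate w \<in> measurable L L" "distr L L (translate w) = L"
      by (rule measurable_translate, rule distr_translate)
    show "prob E = 0 \<or> prob E = 1" if "E \<in> sets L" "translate w -` E \<inter> space L = E" for E
      using ergodicity[OF \<open>w \<noteq> 0\<close>] that unfolding ergodic_translation_def by simp
  qed
  show ?thesis
  proof (intro totally_ergodic_system.intro totally_ergodic_system_axioms.intro erg assms)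
    fix k :: nat assume "0 < k"
    then show "ergodic_system L (translate v ^^ k)" unfolding translate_funpow using assms by (intro erg) simp
  qed
qed

section \<open>Mean distances\<close>

definition mean_T :: "real ^ 'd \<Rightarrow> real" where
  "mean_T v = enn2real (\<integral>\<^sup>+ \<phi>. T \<phi> 0 v \<partial>L)"

text \<open>One straight segment bounds the cost of all its initial pieces. The case
  \<open>t = 1\<close> makes the means finite; general \<open>t\<close> gives the boundedness on
  segments that homogeneity uses.\<close>

lemma mean_T_scale_le:
  assumes "t \<in> {0..1}"
  shows "(\<integral>\<^sup>+ \<phi>. T \<phi> 0 (t *\<^sub>R v) \<partial>L) \<le> (\<integral>\<^sup>+ \<phi>. arc_integral \<phi> (linepath 0 v) \<partial>L)"
proof (rule nn_integral_mono)
  fix \<phi> :: "'d density"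
  show "T \<phi> 0 (t *\<^sub>R v) \<le> arc_integral \<phi> (linepath 0 v)"
  proof (cases "t = 0")
    case False
    have "T \<phi> 0 (t *\<^sub>R v) \<le> arc_integral \<phi> (subpath 0 t (linepath 0 v))"
      using assms by (intro T_le_arc_integral valid_path_subpath valid_path_linepath)
         (auto simp: linepath_def)
    also have "\<dots> = arc_part \<phi> (linepath 0 v) 0 t"
      using assms False by (subst arc_integral_subpath) auto
    also have "\<dots> \<le> arc_integral \<phi> (linepath 0 v)"
      unfolding arc_integral_eq_arc_part using assms by (intro arc_part_mono) auto
    finally show ?thesis .
  qed simp
qed

lemma nn_integral_T: "(\<integral>\<^sup>+ \<phi>. T \<phi> 0 v \<partial>L) = ennreal (mean_T v)"
  using mean_T_scale_le[of 1 v] finite_moment[of v] by (simp add: mean_T_def order.strict_trans1)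

lemma nn_integral_T_shift: "(\<integral>\<^sup>+ \<phi>. T \<phi> x (x + v) \<partial>L) = ennreal (mean_T v)"
  using nn_integral_translate[of "\<lambda>\<phi>. T \<phi> 0 v" x]
  by (simp add: T_translate add.commute nn_integral_T)

lemma mean_T_nonneg: "0 \<le> mean_T v" by (simp add: mean_T_def)

lemma mean_T_minus: "mean_T (- v) = mean_T v"
proof -
  have "ennreal (mean_T v) = (\<integral>\<^sup>+ \<phi>. T \<phi> (- v) (- v + v) \<partial>L)" by (rule nn_integral_T_shift[symmetric])
  also have "\<dots> = (\<integral>\<^sup>+ \<phi>. T \<phi> 0 (- v) \<partial>L)" by (subst T_commute) simp
  also have "\<dots> = ennreal (mean_T (- v))" by (rule nn_integral_T)
  finally show ?thesis by (simp add: mean_T_nonneg)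
qed

lemma mean_T_subadditive: "mean_T (x + y) \<le> mean_T x + mean_T y"
proof -
  have "ennreal (mean_T (x + y)) = (\<integral>\<^sup>+ \<phi>. T \<phi> 0 (x + y) \<partial>L)" by (rule nn_integral_T[symmetric])
  also have "\<dots> \<le> (\<integral>\<^sup>+ \<phi>. T \<phi> 0 x + T \<phi> x (x + y) \<partial>L)" by (intro nn_integral_mono T_triangle)
  also have "\<dots> = ennreal (mean_T x) + ennreal (mean_T y)"
    by (simp add: nn_integral_add nn_integral_T nn_integral_T_shift)
  finally show ?thesis by (simp add: mean_T_nonneg flip: ennreal_plus)
qed

lemma mean_T_bounded_on_segment: "\<exists>C. \<forall>t\<in>{0..1}. mean_T (t *\<^sub>R x) \<le> C"
proof (intro exI ballI)
  fix t :: real assume "t \<in> {0..1}"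
  then show "mean_T (t *\<^sub>R x) \<le> enn2real (\<integral>\<^sup>+ \<phi>. arc_integral \<phi> (linepath 0 x) \<partial>L)"
    unfolding mean_T_def using finite_moment[of x] by (intro enn2real_mono mean_T_scale_le) simp_all
qed

lemma time_limit_exists:
  obtains c where "is_time_limit L (\<lambda>\<phi>. \<phi>) v c" "(\<lambda>n. mean_T (real n *\<^sub>R v) / real n) \<longlonglongrightarrow> c"
proof (cases "v = 0")
  case True
  \<comment> \<open>Ergodicity is not assumed for the zero translation, but here all distances
    vanish.\<close>
  have "is_time_limit L (\<lambda>\<phi>. \<phi>) v 0" by (simp add: is_time_limit_def True)
  moreover have "(\<lambda>n. mean_T (real n *\<^sub>R v) / real n) \<longlonglongrightarrow> 0" by (simp add: mean_T_def True)
  ultimately show ?thesis by (rule that)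
next
  case False
  interpret totally_ergodic_system L "translate v" using False by (rule totally_ergodic_translate)
  have sub: "T \<phi> 0 (real (i + j) *\<^sub>R v) \<le> T \<phi> 0 (real i *\<^sub>R v) + T ((translate v ^^ i) \<phi>) 0 (real j *\<^sub>R v)" for i j \<phi>
    using T_triangle[of \<phi> 0 "real (i + j) *\<^sub>R v" "real i *\<^sub>R v"]
    by (simp add: translate_funpow T_translate algebra_simps)
  have "(\<integral>\<^sup>+ \<phi>. T \<phi> 0 (real 1 *\<^sub>R v) \<partial>L) < \<infinity>" by (simp add: nn_integral_T)
  from subadditive_ergodic_theorem[of "\<lambda>n \<phi>. T \<phi> 0 (real n *\<^sub>R v)", OF _ _ sub this]
  obtain c where "0 \<le> c" "AE \<phi> in L. (\<lambda>n. T \<phi> 0 (real n *\<^sub>R v) / of_nat n) \<longlonglongrightarrow> ennreal c"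
    "(\<lambda>n. \<integral>\<^sup>+ \<phi>. max (T \<phi> 0 (real n *\<^sub>R v) / of_nat n) (ennreal c) - min (T \<phi> 0 (real n *\<^sub>R v) / of_nat n) (ennreal c) \<partial>L) \<longlonglongrightarrow> 0"
    "(\<lambda>n. enn2real (\<integral>\<^sup>+ \<phi>. T \<phi> 0 (real n *\<^sub>R v) \<partial>L) / real n) \<longlonglongrightarrow> c"
    by auto
  then show ?thesis by (intro that[of c]) (auto simp: is_time_limit_def mean_T_def)
qed

end

section \<open>Cheap cubes\<close>

lemma infnorm_le_iff_cart: "infnorm x \<le> q \<longleftrightarrow> (\<forall>i. \<bar>x $ i\<bar> \<le> q)" for x :: "real ^ 'd::finite"
proof -
  have "infnorm x \<le> q \<longleftrightarrow> (\<forall>b\<in>Basis. \<bar>x \<bullet> b\<bar> \<le> q)"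
    by (subst infnorm_Max, subst Max_le_iff) auto
  then show ?thesis by (auto simp: Basis_vec_def inner_axis)
qed

lemma infnorm_attained_cart: "\<exists>i. \<bar>x $ i\<bar> = infnorm x" for x :: "real ^ 'd::finite"
proof -
  have "infnorm x \<in> (\<lambda>b. \<bar>x \<bullet> b\<bar>) ` Basis"
    unfolding infnorm_Max by (intro Max_in) auto
  then show ?thesis by (auto simp: Basis_vec_def inner_axis)
qed

lemma norm_le_card_mult_cart:
  fixes x :: "real ^ 'd::finite"
  assumes "\<And>i. \<bar>x $ i\<bar> \<le> q"
  shows "norm x \<le> real CARD('d) * q"
proof -
  have "norm x \<le> (\<Sum>i\<in>UNIV. \<bar>x $ i\<bar>)" by (rule norm_le_l1_cart)
  also have "\<dots> \<le> (\<Sum>i\<in>(UNIV::'d set). q)" by (intro sum_mono assms)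
  finally show ?thesis by simp
qed

definition lattice_box :: "real \<Rightarrow> nat \<Rightarrow> (real ^ 'd::finite) set" where
  "lattice_box s M = (\<lambda>f. \<chi> i. s * of_int (f i)) ` (UNIV \<rightarrow>\<^sub>E {- int M..int M})"

lemma finite_lattice_box [simp]: "finite (lattice_box s M)"
  by (simp add: lattice_box_def finite_PiE)

lemma card_lattice_box: "card (lattice_box s M :: (real ^ 'd::finite) set) \<le> (2 * M + 1) ^ CARD('d)"
proof -
  have "card (lattice_box s M :: (real ^ 'd) set) \<le> card ((UNIV::'d set) \<rightarrow>\<^sub>E {- int M..int M})"
    unfolding lattice_box_def by (intro card_image_le finite_PiE) auto
  also have "\<dots> = (2 * M + 1) ^ CARD('d)" by (simp add: card_PiE nat_add_distrib nat_mult_distrib)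
  finally show ?thesis .
qed

lemma lattice_box_covers:
  fixes x :: "real ^ 'd::finite"
  assumes s: "0 < s" and x: "norm x \<le> s * real M"
  obtains w where "w \<in> lattice_box s M" "infnorm (x - w) \<le> s"
proof -
  define f where "f i = \<lfloor>x $ i / s\<rfloor>" for i
  define w :: "real ^ 'd" where "w = (\<chi> i. s * of_int (f i))"
  have "f i \<in> {- int M..int M}" for i
  proof -
    have "\<bar>x $ i\<bar> \<le> s * real M" using component_le_norm_cart[of x i] x by linarith
    then have "\<bar>x $ i / s\<bar> \<le> real M" using s by (simp add: abs_divide field_simps)
    then have "- real M \<le> x $ i / s" "x $ i / s \<le> real M" by linarith+
    then show ?thesis unfolding f_def by (simp add: le_floor_iff floor_le_iff)
  qed
  then have "w \<in> lattice_box s M" unfolding w_def lattice_box_def by (intro imageI) auto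
  moreover have "infnorm (x - w) \<le> s"
    unfolding infnorm_le_iff_cart
  proof
    fix i
    have "\<bar>x $ i / s - of_int (f i)\<bar> \<le> 1" unfolding f_def by linarith
    then have "s * \<bar>x $ i / s - of_int (f i)\<bar> \<le> s" using s by simp
    also have "s * \<bar>x $ i / s - of_int (f i)\<bar> = \<bar>s * (x $ i / s - of_int (f i))\<bar>" using s by (simp add: abs_mult)
    also have "s * (x $ i / s - of_int (f i)) = (x - w) $ i" using s by (simp add: w_def algebra_simps)
    finally show "\<bar>(x - w) $ i\<bar> \<le> s" .
  qed
  ultimately show ?thesis by (rule that)
qed

text \<open>Centres of unit balls covering the boundary of the cube \<open>[-q, q]\<^sup>d\<close>: the number of centres is of order
  \<open>q\<^sup>d\<^sup>-\<^sup>1\<close>, which matches the exponent in the one-arm estimate.\<close>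

definition shell :: "real \<Rightarrow> (real ^ 'd::finite) set" where
  "shell q = (\<Union>i. \<Union>e\<in>{q, - q}. (\<lambda>f. \<chi> j. if j = i then e else of_int (f j) / real CARD('d)) `
     (PiE UNIV (\<lambda>j. if j = i then {0} else {- \<lceil>q * real CARD('d)\<rceil>..\<lceil>q * real CARD('d)\<rceil>})))"

lemma finite_shell [simp]: "finite (shell q)"
  by (auto simp: shell_def intro!: finite_imageI finite_PiE)

text \<open>On each of the \<open>2 * d\<close> faces one coordinate is fixed; pinning its label to
  0 leaves \<open>d - 1\<close> labels with \<open>2 * M + 1\<close> values each.\<close>

lemma card_shell:
  assumes q: "0 \<le> q"
  shows "real (card (shell q :: (real ^ 'd::finite) set))
    \<le> 2 * real CARD('d) * (2 * real CARD('d) * q + 3) ^ (CARD('d) - 1)"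
proof -
  define M where "M = \<lceil>q * real CARD('d)\<rceil>"
  have M: "0 \<le> M" "real_of_int M \<le> q * real CARD('d) + 1"
  proof -
    have "0 \<le> q * real CARD('d)" using q by simp
    then show "0 \<le> M" unfolding M_def by linarith
    show "real_of_int M \<le> q * real CARD('d) + 1" unfolding M_def by linarith
  qed
  let ?P = "\<lambda>i. PiE UNIV (\<lambda>j::'d. if j = i then {0::int} else {-M..M})"
  let ?g = "\<lambda>i e f. (\<chi> j::'d. if j = i then e else of_int (f j) / real CARD('d)) :: real ^ 'd"
  have cP: "card (?P i) = nat (2 * M + 1) ^ (CARD('d) - 1)" for i
  proof -
    have "card (?P i) = (\<Prod>j\<in>UNIV. card (if j = i then {0::int} else {-M..M}))" by (simp add: card_PiE)
    also have "\<dots> = (\<Prod>j\<in>UNIV - {i}. card (if j = i then {0::int} else {-M..M}))"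
      by (subst prod.remove[of _ i]) auto
    also have "\<dots> = (\<Prod>j\<in>UNIV - {i}. nat (2 * M + 1))" by (intro prod.cong) (auto simp: M)
    finally show ?thesis by (simp add: card_Diff_singleton)
  qed
  have fP: "finite (?P i)" for i by (intro finite_PiE) auto
  have "card (shell q :: (real ^ 'd) set) = card (\<Union>i\<in>UNIV. \<Union>e\<in>{q, - q}. ?g i e ` ?P i)"
    by (simp only: shell_def M_def)
  also have "\<dots> \<le> (\<Sum>i\<in>UNIV. card (\<Union>e\<in>{q, - q}. ?g i e ` ?P i))" by (rule card_UN_le) simp
  also have "\<dots> \<le> (\<Sum>i\<in>(UNIV::'d set). 2 * nat (2 * M + 1) ^ (CARD('d) - 1))"
  proof (rule sum_mono)
    fix i
    have "card (\<Union>e\<in>{q, - q}. ?g i e ` ?P i) \<le> (\<Sum>e\<in>{q, - q}. card (?g i e ` ?P i))"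
      by (rule card_UN_le) simp
    also have "\<dots> \<le> (\<Sum>e\<in>{q, - q}. card (?P i))" by (intro sum_mono card_image_le fP)
    also have "\<dots> \<le> 2 * card (?P i)" by (simp add: card_insert_if)
    finally show "card (\<Union>e\<in>{q, - q}. ?g i e ` ?P i) \<le> 2 * nat (2 * M + 1) ^ (CARD('d) - 1)"
      by (simp add: cP)
  qed
  finally have "real (card (shell q :: (real ^ 'd) set)) \<le> real (\<Sum>i\<in>(UNIV::'d set). 2 * nat (2 * M + 1) ^ (CARD('d) - 1))"
    by (rule of_nat_mono)
  also have "\<dots> = 2 * real CARD('d) * real_of_int (2 * M + 1) ^ (CARD('d) - 1)"
    using M(1) by (simp add: of_nat_nat)
  also have "\<dots> \<le> 2 * real CARD('d) * (2 * real CARD('d) * q + 3) ^ (CARD('d) - 1)"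
    using M by (intro mult_left_mono power_mono) (auto simp: algebra_simps)
  finally show ?thesis .
qed

text \<open>Rounding \<open>q * d\<close> up lets a centre stick out of the cube;
  \<open>q + 1\<close> per coordinate allows for that, and the dimension factor passes from the sup
  norm to the Euclidean norm.\<close>

lemma norm_shell:
  fixes z :: "real ^ 'd::finite"
  assumes "z \<in> shell q" "0 \<le> q"
  shows "norm z \<le> real CARD('d) * (q + 1)"
proof (rule norm_le_card_mult_cart)
  fix j
  let ?d = "real CARD('d)"
  obtain i e f where ife: "e \<in> {q, - q}" "z = (\<chi> j. if j = i then e else of_int (f j) / ?d)"
    "f \<in> PiE UNIV (\<lambda>j. if j = i then {0} else {- \<lceil>q * ?d\<rceil>..\<lceil>q * ?d\<rceil>})"
    using assms(1) unfolding shell_def by (elim UN_E imageE) (rule that)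
  show "\<bar>z $ j\<bar> \<le> q + 1"
  proof (cases "j = i")
    case False
    then have "f j \<in> {- \<lceil>q * ?d\<rceil>..\<lceil>q * ?d\<rceil>}" using ife(3) by (auto simp: PiE_iff split: if_splits)
    then have "\<bar>real_of_int (f j)\<bar> \<le> q * ?d + 1" by (auto simp: abs_le_iff) linarith+
    also have "\<dots> \<le> (q + 1) * ?d" by (simp add: algebra_simps)
    finally show ?thesis using False ife(2) by (simp add: abs_divide divide_le_eq)
  qed (use ife assms(2) in auto)
qed

text \<open>The mesh is \<open>1 / d\<close> so that rounding all coordinates moves a boundary point
  by at most 1 in the sum norm, hence in the Euclidean norm. The distance 1 matches the inner radius
  of the annuli.\<close>

lemma shell_covers:
  fixes x :: "real ^ 'd::finite"
  assumes "infnorm x = q"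
  obtains z where "z \<in> shell q" "dist x z \<le> 1"
proof -
  let ?d = "real CARD('d)"
  obtain i where i: "\<bar>x $ i\<bar> = q" using infnorm_attained_cart[of x] assms by auto
  have le: "\<bar>x $ j\<bar> \<le> q" for j using assms infnorm_le_iff_cart[of x q] by auto
  define f where "f j = (if j = i then 0 else \<lfloor>x $ j * ?d\<rfloor>)" for j
  define z :: "real ^ 'd" where "z = (\<chi> j. if j = i then x $ i else of_int (f j) / ?d)"
  have "f \<in> PiE UNIV (\<lambda>j. if j = i then {0} else {- \<lceil>q * ?d\<rceil>..\<lceil>q * ?d\<rceil>})"
  proof -
    have "\<lfloor>x $ j * ?d\<rfloor> \<in> {- \<lceil>q * ?d\<rceil>..\<lceil>q * ?d\<rceil>}" for j
    proof -
      have "\<bar>x $ j * ?d\<bar> \<le> q * ?d" using le[of j] by (simp add: abs_mult)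
      then have "\<bar>x $ j * ?d\<bar> \<le> real_of_int \<lceil>q * ?d\<rceil>" by linarith
      then have "- real_of_int \<lceil>q * ?d\<rceil> \<le> x $ j * ?d" "x $ j * ?d \<le> real_of_int \<lceil>q * ?d\<rceil>" by linarith+
      then show ?thesis by (simp add: le_floor_iff floor_le_iff)
    qed
    then show ?thesis by (auto simp: f_def)
  qed
  moreover have "x $ i \<in> {q, - q}" using i by auto
  ultimately have "z \<in> shell q"
    unfolding shell_def z_def by (intro UN_I[of i] UN_I[of "x $ i"] image_eqI[of _ _ f] UNIV_I refl)
  moreover have "norm (x - z) \<le> ?d * (1 / ?d)"
  proof (rule norm_le_card_mult_cart)
    fix j
    have "\<bar>x $ j * ?d - of_int \<lfloor>x $ j * ?d\<rfloor>\<bar> \<le> 1" by linarith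
    then have "\<bar>(x $ j * ?d - of_int \<lfloor>x $ j * ?d\<rfloor>) / ?d\<bar> \<le> 1 / ?d" unfolding abs_divide by (simp add: divide_right_mono)
    then show "\<bar>(x - z) $ j\<bar> \<le> 1 / ?d" by (simp add: z_def f_def diff_divide_distrib)
  qed
  ultimately show ?thesis using that by (simp add: dist_norm)
qed

lemma shell_nonempty: "shell q \<noteq> ({} :: (real ^ 'd::finite) set)" if "0 \<le> q"
proof -
  let ?x = "(\<chi> i. q) :: real ^ 'd"
  have "infnorm ?x = q" using infnorm_attained_cart[of ?x] that by auto
  from shell_covers[OF this] show ?thesis by blast
qed

text \<open>The boundary of the cube about \<open>w\<close> enters through its finite covering, so
  that measurability, monotonicity and locality are inherited from \<open>T_annulus\<close> and a
  union bound applies.\<close>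

definition cheap :: "real \<Rightarrow> real \<Rightarrow> real \<Rightarrow> real ^ 'd::finite \<Rightarrow> 'd density set" where
  "cheap q R \<delta> w = {\<phi>. \<exists>z\<in>shell q. T_annulus (translate (w + z) \<phi>) R < ennreal \<delta>}"

text \<open>The required displacement exceeds the diameter of the cube, so the piece meets the
  boundary, within distance 1 of some \<open>w + z\<close>. One term \<open>d * (q + 1)\<close> pays
  for the distance from \<open>\<gamma> a\<close> to \<open>w\<close>, the other for
  \<open>z\<close>; what remains is a crossing to radius \<open>R\<close>.\<close>

lemma cheap_if_arc_part_small:
  fixes \<gamma> :: "real \<Rightarrow> real ^ 'd::finite"
  defines "d \<equiv> real CARD('d)"
  assumes \<gamma>: "valid_path \<gamma>" and ab: "0 \<le> a" "a \<le> b" "b \<le> 1" and q: "0 < q" and R: "1 < R"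
    and a: "infnorm (\<gamma> a - w) \<le> q" and far: "R + 2 * (d * (q + 1)) \<le> dist (\<gamma> a) (\<gamma> b)"
    and small: "arc_part \<phi> \<gamma> a b < ennreal \<delta>"
  shows "\<phi> \<in> cheap q R \<delta> w"
proof -
  have d: "1 \<le> d" by (simp add: d_def Suc_le_eq)
  have cont: "continuous_on {0..1} \<gamma>" using \<gamma> by (simp add: valid_path_imp_path path_def[symmetric])
  have na: "norm (\<gamma> a - w) \<le> d * q"
    using a norm_le_card_mult_cart[of "\<gamma> a - w" q] by (simp add: infnorm_le_iff_cart d_def)
  have "q \<le> infnorm (\<gamma> b - w)"
  proof (rule ccontr)
    assume "\<not> q \<le> infnorm (\<gamma> b - w)"
    then have "norm (\<gamma> b - w) \<le> d * q"
      using norm_le_card_mult_cart[of "\<gamma> b - w" q] infnorm_le_iff_cart[of "\<gamma> b - w" q] by (auto simp: d_def)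
    moreover have "dist (\<gamma> a) (\<gamma> b) \<le> norm (\<gamma> a - w) + norm (\<gamma> b - w)"
      by (metis dist_norm dist_triangle2)
    ultimately have "R + 2 * (d * (q + 1)) \<le> 2 * (d * q)" using na far by linarith
    then show False using R d by (simp add: algebra_simps)
  qed
  moreover have "continuous_on {a..b} (\<lambda>t. infnorm (\<gamma> t - w))"
    using ab by (intro continuous_on_infnorm continuous_intros continuous_on_subset[OF cont]) auto
  ultimately obtain t where t: "a \<le> t" "t \<le> b" "infnorm (\<gamma> t - w) = q"
    using IVT'[of "\<lambda>t. infnorm (\<gamma> t - w)" a q b] a ab by auto
  obtain z where z: "z \<in> shell q" "dist (\<gamma> t - w) z \<le> 1" using shell_covers[OF t(3)] by blast
  have "T_annulus (translate (w + z) \<phi>) R \<le> arc_part \<phi> \<gamma> t b"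
  proof (rule T_annulus_translate_le_arc_part[OF \<gamma>])
    show "dist (\<gamma> t) (w + z) \<le> 1" using z(2) by (simp add: dist_norm algebra_simps)
    have "dist (\<gamma> a) (\<gamma> b) \<le> dist (\<gamma> a) w + (norm z + dist (\<gamma> b) (w + z))"
      using dist_triangle[of "\<gamma> a" "\<gamma> b" w] dist_triangle[of w "\<gamma> b" "w + z"]
      by (simp add: dist_commute dist_norm[of w "w + z"])
    moreover have "dist (\<gamma> a) w \<le> d * q" using na by (simp add: dist_norm)
    moreover have "norm z \<le> d * (q + 1)" using norm_shell[OF z(1)] q by (simp add: d_def)
    moreover have "d * q \<le> d * (q + 1)" using d by simp
    ultimately show "R \<le> dist (\<gamma> b) (w + z)" using far by linarith
  qed (use ab t R in auto)
  also have "\<dots> \<le> arc_part \<phi> \<gamma> a b" using t by (intro arc_part_mono) auto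
  also have "\<dots> < ennreal \<delta>" by (rule small)
  finally show ?thesis using z(1) unfolding cheap_def by blast
qed

text \<open>The sets of times at distance at least \<open>i * \<rho>\<close> are nested, so their
  minima are ordered, and continuity excludes an overshoot. Indices start at 1 because the path
  starts within distance \<open>\<rho>\<close>.\<close>

lemma first_hitting_times:
  fixes \<gamma> :: "real \<Rightarrow> 'a::metric_space" and \<rho> :: real
  assumes cont: "continuous_on {0..1} \<gamma>" and start: "dist (\<gamma> 0) c \<le> \<rho>" and fin: "real n * \<rho> \<le> dist (\<gamma> 1) c"
    and \<rho>: "0 \<le> \<rho>"
  obtains t where "\<And>i. i \<in> {1..n} \<Longrightarrow> t i \<in> {0..1}" "\<And>i. i \<in> {1..n} \<Longrightarrow> dist (\<gamma> (t i)) c = real i * \<rho>"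
    "\<And>i. i \<in> {1..<n} \<Longrightarrow> t i \<le> t (Suc i)"
proof -
  define A where "A i = {0..1} \<inter> (\<lambda>t. dist (\<gamma> t) c) -` {real i * \<rho>..}" for i
  have "\<exists>t\<in>A i. \<forall>s\<in>A i. t \<le> s" if "i \<in> {1..n}" for i
  proof (rule compact_attains_inf)
    have "closed (A i)" unfolding A_def
      by (intro continuous_closed_preimage continuous_intros cont closed_atLeastAtMost closed_atLeast)
    then show "compact (A i)"
      by (intro compact_eq_bounded_closed[THEN iffD2] conjI bounded_subset[of "{0..1}" "A i"]) (auto simp: A_def)
    have "real i * \<rho> \<le> real n * \<rho>" using that \<rho> by (intro mult_right_mono) auto
    then have "1 \<in> A i" using fin by (simp add: A_def)
    then show "A i \<noteq> {}" by blast
  qed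
  then obtain t where t: "\<And>i. i \<in> {1..n} \<Longrightarrow> t i \<in> A i" "\<And>i s. i \<in> {1..n} \<Longrightarrow> s \<in> A i \<Longrightarrow> t i \<le> s"
    by metis
  show ?thesis
  proof (rule that)
    fix i assume i: "i \<in> {1..n}"
    show t01: "t i \<in> {0..1}" using t(1)[OF i] by (simp add: A_def)
    show "dist (\<gamma> (t i)) c = real i * \<rho>"
    proof (rule antisym)
      show "real i * \<rho> \<le> dist (\<gamma> (t i)) c" using t(1)[OF i] by (simp add: A_def)
      show "dist (\<gamma> (t i)) c \<le> real i * \<rho>"
      proof (rule ccontr)
        assume gt: "\<not> dist (\<gamma> (t i)) c \<le> real i * \<rho>"
        have "1 * \<rho> \<le> real i * \<rho>" using i \<rho> by (intro mult_right_mono) auto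
        then have "dist (\<gamma> 0) c \<le> real i * \<rho>" using start by simp
        moreover have "continuous_on {0..t i} (\<lambda>t. dist (\<gamma> t) c)"
          using t01 by (intro continuous_intros continuous_on_subset[OF cont]) auto
        ultimately obtain s where s: "0 \<le> s" "s \<le> t i" "dist (\<gamma> s) c = real i * \<rho>"
          using IVT'[of "\<lambda>t. dist (\<gamma> t) c" 0 "real i * \<rho>" "t i"] gt t01 by auto
        then have "s \<in> A i" using t01 by (auto simp: A_def)
        then have "t i \<le> s" using t(2)[OF i] by blast
        with s gt show False by auto
      qed
    qed
  next
    fix i assume i: "i \<in> {1..<n}"
    have "real i * \<rho> \<le> real (Suc i) * \<rho>" using \<rho> by (intro mult_right_mono) auto
    then have "A (Suc i) \<subseteq> A i" by (auto simp: A_def)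
    moreover have "t (Suc i) \<in> A (Suc i)" using i by (intro t(1)) auto
    ultimately show "t i \<le> t (Suc i)" using i by (intro t(2)) auto
  qed
qed

text \<open>Four cheap pieces are what guarantees two of them three spheres apart, the separation at
  which their events sit in distant balls.\<close>

lemma far_apart_elements:
  fixes S :: "nat set"
  assumes "finite S" "4 \<le> card S"
  obtains i j where "i \<in> S" "j \<in> S" "i + 3 \<le> j"
proof -
  have ne: "S \<noteq> {}" using assms by auto
  have "S \<subseteq> {Min S..Max S}" using assms(1) ne by auto
  then have "card S \<le> card {Min S..Max S}" by (intro card_mono) auto
  with assms(2) have "Min S + 3 \<le> Max S" by simp
  with ne assms(1) show ?thesis by (intro that[of "Min S" "Max S"]) auto
qed

text \<open>A path to distance \<open>R'\<close> meets \<open>N\<close> successive spheres of radii \<open>i \<rho>\<close>; if it is shorter than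
  \<open>(N - 3) \<delta>\<close>, at least four of the \<open>N\<close> pieces between them are cheap, and two of these are far apart.\<close>

lemma cheap_path_two_cheap_pieces:
  fixes \<gamma> :: "real \<Rightarrow> real ^ 'd::finite"
  defines "r \<equiv> \<lambda>q. real CARD('d) * (q + 1)"
  assumes \<gamma>: "valid_path \<gamma>" and q: "0 < q" and R: "1 < R" and \<delta>: "0 \<le> \<delta>"
    and start: "dist (\<gamma> 0) c \<le> 1" and N: "real (N + 1) * (R + 2 * r q) \<le> dist (\<gamma> 1) c"
    and cover: "\<And>x. dist x c \<le> dist (\<gamma> 1) c \<Longrightarrow> \<exists>w\<in>W. infnorm (x - w) \<le> q"
    and small: "arc_integral \<phi> \<gamma> < ennreal ((real N - 3) * \<delta>)"
  obtains w w' where "w \<in> W" "w' \<in> W" "\<phi> \<in> cheap q R \<delta> w" "\<phi> \<in> cheap q R \<delta> w'" "3 * R + 4 * r q \<le> dist w w'"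
proof -
  \<comment> \<open>Exactly the displacement that makes the cube at the start of a cheap piece
    cheap. The \<open>N\<close> pieces are bounded by \<open>N + 1\<close> spheres.\<close>
  define \<rho> where "\<rho> = R + 2 * r q"
  have d: "1 \<le> real CARD('d)" by (simp add: Suc_le_eq)
  have r: "0 < r q" unfolding r_def using q d by simp
  have \<rho>: "1 \<le> \<rho>" using r R by (simp add: \<rho>_def)
  have cont: "continuous_on {0..1} \<gamma>" using \<gamma> by (simp add: valid_path_imp_path path_def[symmetric])
  obtain t where t: "\<And>i. i \<in> {1..N+1} \<Longrightarrow> t i \<in> {0..1}" "\<And>i. i \<in> {1..N+1} \<Longrightarrow> dist (\<gamma> (t i)) c = real i * \<rho>"
    "\<And>i. i \<in> {1..<N+1} \<Longrightarrow> t i \<le> t (Suc i)"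
  proof -
    have "dist (\<gamma> 0) c \<le> \<rho>" "real (N + 1) * \<rho> \<le> dist (\<gamma> 1) c" "0 \<le> \<rho>"
      using start \<rho> N unfolding \<rho>_def[symmetric] by linarith+
    from first_hitting_times[OF cont this] that show thesis by blast
  qed
  have "\<exists>w\<in>W. infnorm (\<gamma> (t i) - w) \<le> q" if "i \<in> {1..N}" for i
  proof (rule cover)
    have "real i * \<rho> \<le> real (N + 1) * \<rho>" using that \<rho> by (intro mult_right_mono) auto
    then show "dist (\<gamma> (t i)) c \<le> dist (\<gamma> 1) c" using t(2)[of i] that N by (simp add: \<rho>_def[symmetric])
  qed
  then obtain w where w: "\<And>i. i \<in> {1..N} \<Longrightarrow> w i \<in> W" "\<And>i. i \<in> {1..N} \<Longrightarrow> infnorm (\<gamma> (t i) - w i) \<le> q"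
    by metis
  have far: "real j * \<rho> - real i * \<rho> \<le> dist (\<gamma> (t i)) (\<gamma> (t j))" if "i \<in> {1..N+1}" "j \<in> {1..N+1}" for i j
    using t(2)[OF that(1)] t(2)[OF that(2)] dist_triangle[of "\<gamma> (t j)" c "\<gamma> (t i)"] by (simp add: dist_commute)
  define S where "S = {i\<in>{1..N}. arc_part \<phi> \<gamma> (t i) (t (Suc i)) < ennreal \<delta>}"
  have cheap: "\<phi> \<in> cheap q R \<delta> (w i)" if "i \<in> S" for i
  proof (rule cheap_if_arc_part_small[OF \<gamma>, of "t i" "t (Suc i)"])
    have i: "i \<in> {1..N}" using that by (simp add: S_def)
    show "0 \<le> t i" "t (Suc i) \<le> 1" "t i \<le> t (Suc i)" using t(1)[of i] t(1)[of "Suc i"] t(3)[of i] i by auto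
    show "infnorm (\<gamma> (t i) - w i) \<le> q" using w i by blast
    have "\<rho> \<le> dist (\<gamma> (t i)) (\<gamma> (t (Suc i)))" using far[of i "Suc i"] i by (simp add: algebra_simps)
    then show "R + 2 * (real CARD('d) * (q + 1)) \<le> dist (\<gamma> (t i)) (\<gamma> (t (Suc i)))"
      by (simp add: \<rho>_def r_def)
    show "arc_part \<phi> \<gamma> (t i) (t (Suc i)) < ennreal \<delta>" using that by (simp add: S_def)
  qed (use q R in auto)
  have finS: "finite S" by (simp add: S_def)
  have "4 \<le> card S"
  proof (rule ccontr)
    assume "\<not> 4 \<le> card S"
    then have card: "real N - 3 \<le> real (card ({1..N} - S))"
    proof -
      have "S \<subseteq> {1..N}" by (auto simp: S_def)
      from card_Diff_subset[OF finS this] have "card ({1..N} - S) = N - card S" by simp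
      with \<open>\<not> 4 \<le> card S\<close> show ?thesis by linarith
    qed
    have "ennreal ((real N - 3) * \<delta>) \<le> ennreal (real (card ({1..N} - S)) * \<delta>)"
      using card \<delta> by (intro ennreal_leI mult_right_mono)
    also have "\<dots> = (\<Sum>i\<in>{1..N} - S. ennreal \<delta>)"
      using \<delta> by (simp add: ennreal_mult' ennreal_of_nat_eq_real_of_nat)
    also have "\<dots> \<le> (\<Sum>i\<in>{1..N} - S. arc_part \<phi> \<gamma> (t i) (t (Suc i)))"
      by (intro sum_mono) (auto simp: S_def)
    also have "\<dots> \<le> (\<Sum>i\<in>{1..<N+1}. arc_part \<phi> \<gamma> (t i) (t (Suc i)))"
      by (intro sum_mono2) auto
    also have "\<dots> = arc_part \<phi> \<gamma> (t 1) (t (N + 1))"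
      by (intro sum_arc_part t(3)) simp_all
    also have "\<dots> \<le> arc_integral \<phi> \<gamma>"
      unfolding arc_integral_eq_arc_part using t(1)[of 1] t(1)[of "N + 1"] by (intro arc_part_mono) auto
    finally show False using small by simp
  qed
  then obtain i j where ij: "i \<in> S" "j \<in> S" "i + 3 \<le> j" using far_apart_elements[OF finS] by blast
  have ijN: "i \<in> {1..N}" "j \<in> {1..N}" using ij by (auto simp: S_def)
  have close: "dist (\<gamma> (t k)) (w k) \<le> r q" if "k \<in> {1..N}" for k
  proof -
    have "norm (\<gamma> (t k) - w k) \<le> real CARD('d) * q"
      using w(2)[OF that] by (intro norm_le_card_mult_cart) (simp add: infnorm_le_iff_cart)
    also have "\<dots> \<le> r q" using d by (simp add: r_def)
    finally show ?thesis by (simp add: dist_norm)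
  qed
  \<comment> \<open>The gap is \<open>3 * R + 6 * r q\<close>; moving from the two path points to
    the centres of their cubes costs \<open>2 * r q\<close>.\<close>
  have "3 * \<rho> \<le> real j * \<rho> - real i * \<rho>"
  proof -
    have "3 * \<rho> \<le> (real j - real i) * \<rho>" using ij(3) \<rho> by (intro mult_right_mono) auto
    then show ?thesis by (simp add: algebra_simps)
  qed
  also have "\<dots> \<le> dist (\<gamma> (t i)) (\<gamma> (t j))" using far ijN by simp
  also have "\<dots> \<le> dist (\<gamma> (t i)) (w i) + (dist (w i) (w j) + dist (\<gamma> (t j)) (w j))"
    using dist_triangle[of "\<gamma> (t i)" "\<gamma> (t j)" "w i"] dist_triangle[of "w i" "\<gamma> (t j)" "w j"]
    by (simp add: dist_commute)
  also have "\<dots> \<le> dist (w i) (w j) + 2 * r q" using close[OF ijN(1)] close[OF ijN(2)] by linarith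
  finally have "3 * R + 4 * r q \<le> dist (w i) (w j)" by (simp add: \<rho>_def)
  with ij ijN w cheap show ?thesis by (intro that[of "w i" "w j"]) auto
qed

section \<open>Probabilities of cheap cubes\<close>

context ergodic_density begin

lemma measurable_cheap [measurable]:
  assumes "1 < R"
  shows "cheap q R \<delta> w \<in> sets L"
proof -
  have "{\<phi> \<in> space L. \<exists>z\<in>shell q. T_annulus (translate (w + z) \<phi>) R < ennreal \<delta>} \<in> sets L"
  proof (rule sets.sets_Collect_finite_Ex[OF _ finite_shell])
    fix z
    have [measurable]: "(\<lambda>\<phi>. T_annulus (translate (w + z) \<phi>) R) \<in> borel_measurable L"
      using measurable_compose[OF measurable_translate measurable_T_annulus[OF assms]] .
    show "{\<phi> \<in> space L. T_annulus (translate (w + z) \<phi>) R < ennreal \<delta>} \<in> sets L" by measurable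
  qed
  then show ?thesis by (simp add: cheap_def)
qed

lemma prob_cheap:
  assumes "1 < R"
  shows "prob (cheap q R \<delta> w) = prob (cheap q R \<delta> 0)"
proof -
  have "cheap q R \<delta> w = {\<phi>. translate w \<phi> \<in> cheap q R \<delta> 0}"
    by (simp add: cheap_def add.commute)
  then show ?thesis using prob_translate[of "cheap q R \<delta> 0" w] assms by simp
qed

text \<open>Lowering the density lowers every crossing cost. By \<open>T_annulus_local\<close> the
  crossing about \<open>w + z\<close> reads the density only within distance \<open>R\<close> of
  \<open>w + z\<close>, and \<open>norm_shell\<close> bounds \<open>z\<close>.\<close>

lemma cheap_decreasing_event_on:
  fixes w :: "real ^ 'd"
  assumes R: "1 < R" and q: "0 < q"
  shows "cheap q R \<delta> w \<in> decreasing_events_on L (cball w (R + real CARD('d) * (q + 1)))"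
proof -
  have "decreasing_event (cheap q R \<delta> w)"
    unfolding decreasing_event_def
  proof (intro allI impI, elim conjE)
    fix \<phi> \<psi> :: "'d density" assume \<phi>: "\<phi> \<in> cheap q R \<delta> w" and le: "\<psi> \<le> \<phi>"
    then obtain z where z: "z \<in> shell q" "T_annulus (translate (w + z) \<phi>) R < ennreal \<delta>"
      unfolding cheap_def by blast
    have "translate (w + z) \<psi> \<le> translate (w + z) \<phi>" using le by (simp add: le_fun_def translate_def)
    from T_annulus_mono[OF this, of R] z show "\<psi> \<in> cheap q R \<delta> w"
      unfolding cheap_def using order.strict_trans1 by blast
  qed
  moreover have "depends_only_on (cheap q R \<delta> w) (cball w (R + real CARD('d) * (q + 1)))"
    unfolding depends_only_on_def
  proof (intro allI impI)
    fix \<phi> \<psi> :: "'d density" assume eq: "\<forall>x\<in>cball w (R + real CARD('d) * (q + 1)). \<phi> x = \<psi> x"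
    have "T_annulus (translate (w + z) \<phi>) R = T_annulus (translate (w + z) \<psi>) R" if z: "z \<in> shell q" for z
    proof (rule T_annulus_local[OF R])
      fix x :: "real ^ 'd" assume x: "x \<in> cball 0 R"
      have "dist w (x + (w + z)) \<le> norm x + norm z" using norm_triangle_ineq[of x z]
        by (simp add: dist_norm norm_minus_commute add.commute)
      also have "\<dots> \<le> R + real CARD('d) * (q + 1)"
        using x norm_shell[OF z] q by (intro add_mono) auto
      finally show "translate (w + z) \<phi> x = translate (w + z) \<psi> x" using eq by (simp add: translate_def)
    qed
    then show "\<phi> \<in> cheap q R \<delta> w \<longleftrightarrow> \<psi> \<in> cheap q R \<delta> w" by (simp add: cheap_def)
  qed
  ultimately show ?thesis using measurable_cheap[OF R] by (simp add: decreasing_events_on_def)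
qed

text \<open>A real \<open>Sup\<close> dominates the members only of a bounded set; here they are at
  most 1, being differences of numbers between 0 and 1.\<close>

lemma Ind_dec_bound:
  assumes "bounded A" "diameter A \<le> S" "bounded B" "diameter B \<le> S" "Q < setdist A B"
    and E: "E\<^sub>A \<in> decreasing_events_on L A" "E\<^sub>B \<in> decreasing_events_on L B"
  shows "prob (E\<^sub>A \<inter> E\<^sub>B) \<le> prob E\<^sub>A * prob E\<^sub>B + Ind_dec L Q S"
proof -
  let ?X = "{\<bar>prob (E\<^sub>A \<inter> E\<^sub>B) - prob E\<^sub>A * prob E\<^sub>B\<bar> | A B E\<^sub>A E\<^sub>B.
            bounded A \<and> diameter A \<le> S \<and> bounded B \<and> diameter B \<le> S \<and> Q < setdist A B \<and>
            E\<^sub>A \<in> decreasing_events_on L A \<and> E\<^sub>B \<in> decreasing_events_on L B}"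
  have "bdd_above ?X"
  proof (rule bdd_aboveI[of _ 1])
    fix x assume "x \<in> ?X"
    then obtain E E' where x: "x = \<bar>prob (E \<inter> E') - prob E * prob E'\<bar>" by blast
    have "0 \<le> prob E * prob E'" "prob E * prob E' \<le> 1" by (simp_all add: mult_le_one)
    moreover have "0 \<le> prob (E \<inter> E')" "prob (E \<inter> E') \<le> 1" by simp_all
    ultimately show "x \<le> 1" unfolding x by linarith
  qed
  moreover have "\<bar>prob (E\<^sub>A \<inter> E\<^sub>B) - prob E\<^sub>A * prob E\<^sub>B\<bar> \<in> ?X" using assms by blast
  ultimately have "\<bar>prob (E\<^sub>A \<inter> E\<^sub>B) - prob E\<^sub>A * prob E\<^sub>B\<bar> \<le> Ind_dec L Q S"
    unfolding Ind_dec_def by (rule cSup_upper[rotated])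
  then show ?thesis by linarith
qed

text \<open>Each event lives in a ball of radius \<open>R + r\<close>, so centres at distance
  \<open>3 * R + 4 * r\<close> leave at least \<open>R + 2 * r > R\<close> between the balls.
  Stationarity turns the product into a square.\<close>

lemma prob_two_cheap:
  fixes w w' :: "real ^ 'd" and q :: real
  defines "r \<equiv> real CARD('d) * (q + 1)"
  assumes R: "1 < R" and q: "0 < q" and far: "3 * R + 4 * r \<le> dist w w'" and S: "2 * (R + r) \<le> S"
  shows "prob (cheap q R \<delta> w \<inter> cheap q R \<delta> w') \<le> (prob (cheap q R \<delta> 0))\<^sup>2 + Ind_dec L R S"
proof -
  have r: "0 < r" unfolding r_def using q by simp
  have "R < R + 2 * r" using r by simp
  also have "\<dots> \<le> setdist (cball w (R + r)) (cball w' (R + r))"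
  proof (rule le_setdistI)
    show "cball w (R + r) \<noteq> {}" "cball w' (R + r) \<noteq> {}" using R r by auto
    fix x y assume "x \<in> cball w (R + r)" "y \<in> cball w' (R + r)"
    then show "R + 2 * r \<le> dist x y"
      using far dist_triangle[of w w' x] dist_triangle[of x w' y] by (simp add: dist_commute)
  qed
  finally have "R < setdist (cball w (R + r)) (cball w' (R + r))" .
  moreover have "diameter (cball w (R + r)) \<le> S" "diameter (cball w' (R + r)) \<le> S"
    using S R r by (auto simp: diameter_cball)
  ultimately have "prob (cheap q R \<delta> w \<inter> cheap q R \<delta> w')
      \<le> prob (cheap q R \<delta> w) * prob (cheap q R \<delta> w') + Ind_dec L R S"
    using cheap_decreasing_event_on[OF R q, of \<delta>] unfolding r_def[symmetric]
    by (intro Ind_dec_bound[of "cball w (R + r)" S "cball w' (R + r)"] bounded_cball)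
  then show ?thesis using prob_cheap[OF R, of q \<delta> w] prob_cheap[OF R, of q \<delta> w'] by (simp add: power2_eq_square)
qed

text \<open>A union bound over pairs of distant lattice cubes. The crossing is followed up to
  distance \<open>R'\<close> from a boundary centre of the larger cube, so the lattice has to cover
  the radius \<open>R' + r q'\<close>; this is the condition on \<open>M\<close>.\<close>

lemma renormalization_step:
  fixes q R q' R' \<delta> \<delta>' S \<kappa> :: real and M N :: nat
  defines "r \<equiv> \<lambda>q. real CARD('d) * (q + 1)"
  assumes R: "1 < R" "1 < R'" and q: "0 < q" "0 < q'" and \<delta>: "0 \<le> \<delta>"
    and N: "real (N + 1) * (R + 2 * r q) \<le> R'" and \<delta>': "\<delta>' \<le> (real N - 3) * \<delta>"
    and M: "R' + r q' \<le> q * real M" and S: "2 * (R + r q) \<le> S"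
    and Ind: "Ind_dec L R S \<le> \<kappa>" "0 \<le> \<kappa>"
  shows "prob (cheap q' R' \<delta>' 0) \<le> (real ((2 * M + 1) ^ CARD('d)))\<^sup>2 * ((prob (cheap q R \<delta> 0))\<^sup>2 + \<kappa>)"
proof -
  let ?W = "lattice_box q M :: (real ^ 'd) set"
  let ?P = "{p \<in> ?W \<times> ?W. 3 * R + 4 * r q \<le> dist (fst p) (snd p)}"
  let ?C = "\<lambda>p. cheap q R \<delta> (fst p) \<inter> cheap q R \<delta> (snd p)"
  let ?b = "(prob (cheap q R \<delta> 0))\<^sup>2 + \<kappa>"
  have finP: "finite ?P" by (rule finite_subset[of _ "?W \<times> ?W"]) auto
  have [measurable]: "cheap q R \<delta> w \<in> sets L" for w using R by simp
  have "cheap q' R' \<delta>' 0 \<subseteq> (\<Union>p\<in>?P. ?C p)"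
  proof
    fix \<phi> :: "'d density" assume "\<phi> \<in> cheap q' R' \<delta>' 0"
    then obtain z where z: "z \<in> shell q'" "T_annulus (translate z \<phi>) R' < ennreal \<delta>'"
      by (auto simp: cheap_def)
    then obtain x y where xy: "x \<in> sphere 0 1" "y \<in> sphere 0 R'" "T (translate z \<phi>) x y < ennreal \<delta>'"
      unfolding T_annulus_def by (auto simp: INF_less_iff)
    then have "T \<phi> (x + z) (y + z) < ennreal \<delta>'" by (simp add: T_translate)
    then obtain \<gamma> where \<gamma>: "valid_path \<gamma>" "pathstart \<gamma> = x + z" "pathfinish \<gamma> = y + z" "arc_integral \<phi> \<gamma> < ennreal \<delta>'"
      by (rule T_lessE)
    have d0: "dist (\<gamma> 0) z = 1" and d1: "dist (\<gamma> 1) z = R'"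
      using \<gamma> xy by (auto simp: pathstart_def pathfinish_def dist_norm)
    have cover: "\<exists>w\<in>?W. infnorm (x - w) \<le> q" if x: "dist x z \<le> dist (\<gamma> 1) z" for x
    proof -
      have "norm x \<le> norm z + dist x z" using norm_triangle_sub[of x z] by (simp add: dist_norm)
      also have "\<dots> \<le> r q' + R'" using norm_shell[OF z(1)] q x d1 by (intro add_mono) (auto simp: r_def)
      finally have "norm x \<le> q * real M" using M by simp
      from lattice_box_covers[OF q(1) this] show ?thesis by blast
    qed
    have N': "real (N + 1) * (R + 2 * (real CARD('d) * (q + 1))) \<le> dist (\<gamma> 1) z" using N d1 by (simp add: r_def)
    have small: "arc_integral \<phi> \<gamma> < ennreal ((real N - 3) * \<delta>)"
      using \<gamma>(4) \<delta>' by (meson ennreal_leI order.strict_trans2)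
    obtain w w' where "w \<in> ?W" "w' \<in> ?W" "\<phi> \<in> cheap q R \<delta> w" "\<phi> \<in> cheap q R \<delta> w'" "3 * R + 4 * r q \<le> dist w w'"
      using cheap_path_two_cheap_pieces[OF \<gamma>(1) q(1) R(1) \<delta> _ N' cover small] d0 unfolding r_def by auto
    then have "(w, w') \<in> ?P" "\<phi> \<in> ?C (w, w')" by auto
    then show "\<phi> \<in> (\<Union>p\<in>?P. ?C p)" by blast
  qed
  then have "prob (cheap q' R' \<delta>' 0) \<le> prob (\<Union>p\<in>?P. ?C p)"
    using finP by (intro finite_measure_mono) auto
  also have "\<dots> \<le> (\<Sum>p\<in>?P. prob (?C p))"
    using finP by (intro finite_measure_subadditive_finite) auto
  also have "\<dots> \<le> (\<Sum>p\<in>?P. ?b)"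
  proof (rule sum_mono)
    fix p assume "p \<in> ?P"
    then have "prob (?C p) \<le> (prob (cheap q R \<delta> 0))\<^sup>2 + Ind_dec L R S"
      using S by (intro prob_two_cheap R q) (auto simp: r_def)
    then show "prob (?C p) \<le> ?b" using Ind by linarith
  qed
  also have "\<dots> = real (card ?P) * ?b" by simp
  also have "\<dots> \<le> (real ((2 * M + 1) ^ CARD('d)))\<^sup>2 * ?b"
  proof (rule mult_right_mono)
    have "card ?P \<le> card (?W \<times> ?W)" by (intro card_mono) auto
    also have "\<dots> \<le> ((2 * M + 1) ^ CARD('d)) * ((2 * M + 1) ^ CARD('d))"
      unfolding card_cartesian_product by (intro mult_mono card_lattice_box) auto
    finally have "real (card ?P) \<le> real (((2 * M + 1) ^ CARD('d)) * ((2 * M + 1) ^ CARD('d)))" by (rule of_nat_mono)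
    then show "real (card ?P) \<le> (real ((2 * M + 1) ^ CARD('d)))\<^sup>2" by (simp add: power2_eq_square)
    show "0 \<le> ?b" using Ind by simp
  qed
  finally show ?thesis .
qed

end

section \<open>Induction over scales\<close>

primrec scale_radius :: "real \<Rightarrow> nat \<Rightarrow> real" where
  "scale_radius R\<^sub>0 0 = R\<^sub>0"
| "scale_radius R\<^sub>0 (Suc k) = 2 ^ (k + 5) * scale_radius R\<^sub>0 k"

lemma scale_radius_ge: "0 \<le> R\<^sub>0 \<Longrightarrow> R\<^sub>0 * 2 ^ k \<le> scale_radius R\<^sub>0 k"
proof (induction k)
  case (Suc k)
  have "R\<^sub>0 * 2 ^ Suc k = 2 * (R\<^sub>0 * 2 ^ k)" by simp
  also have "\<dots> \<le> 2 ^ (k + 5) * scale_radius R\<^sub>0 k"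
  proof (rule mult_mono)
    have "(2::real) ^ 1 \<le> 2 ^ (k + 5)" by (rule power_increasing) auto
    then show "(2::real) \<le> 2 ^ (k + 5)" by simp
  qed (use Suc in auto)
  finally show ?case by simp
qed simp

text \<open>Half the side of the cubes at scale \<open>k\<close>. The denominator makes the overhead
  \<open>2 * r\<close> with \<open>r = d * (q + 1) \<le> 2 * d * q\<close> at most
  \<open>R * ((1/2) ^ k / 16)\<close>, which is summable relative to \<open>R\<close>.\<close>

definition cube_side :: "real \<Rightarrow> real \<Rightarrow> nat \<Rightarrow> real" where
  "cube_side d R\<^sub>0 k = scale_radius R\<^sub>0 k / (d * 2 ^ (k + 6))"

text \<open>This allows \<open>q + 1 \<le> 2 * q\<close>, so that the rounding in
  \<open>shell\<close> stays proportional to the cube.\<close>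

lemma cube_side_ge_1:
  assumes d: "1 \<le> d" and R: "64 * d \<le> R\<^sub>0"
  shows "1 \<le> cube_side d R\<^sub>0 k"
proof (cases k)
  case 0
  then show ?thesis using assms by (simp add: cube_side_def)
next
  case (Suc j)
  have R0: "0 \<le> R\<^sub>0" using assms by linarith
  have "4 * d \<le> R\<^sub>0 * 1" using assms by linarith
  also have "\<dots> \<le> R\<^sub>0 * 2 ^ j" using R0 by (intro mult_left_mono) auto
  also have "\<dots> \<le> scale_radius R\<^sub>0 j" using R0 by (rule scale_radius_ge)
  finally have "4 * d \<le> scale_radius R\<^sub>0 j" .
  moreover have "cube_side d R\<^sub>0 k = scale_radius R\<^sub>0 j / (4 * d)"
    using d by (simp add: cube_side_def Suc field_simps power_add)
  ultimately show ?thesis using d by simp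
qed

text \<open>The speed \<open>\<delta>\<^sub>k / R\<^sub>k\<close> loses a factor \<open>1 - O(2\<^sup>-\<^sup>k)\<close> per scale, so that it stays above half of its initial value.\<close>

definition speed :: "nat \<Rightarrow> real" where
  "speed k = (1 + (1/2) ^ k) / 2"

lemma speed_bounds: "1/2 \<le> speed k" "speed k \<le> 1"
  by (simp_all add: speed_def power_le_one)

text \<open>Of the 5, three are the discarded pieces and two come from rounding. With
  \<open>x = (1/2) ^ k\<close> at least \<open>2 ^ (k + 5) - 7\<close> remains, a relative loss of
  \<open>7 * x / 32\<close>, and \<open>(1 - 7 * x / 32) * (1 + x)\<close> is still at least
  \<open>1 + x / 2\<close>.\<close>

lemma speed_step:
  fixes R \<rho> :: real
  assumes R: "0 < R" and \<rho>: "R \<le> \<rho>" "\<rho> \<le> R * (1 + (1/2) ^ k / 16)"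
  shows "2 ^ (k + 5) * R * speed (Suc k) \<le> (2 ^ (k + 5) * R / \<rho> - 5) * (R * speed k)"
proof -
  define x :: real where "x = (1/2) ^ k"
  have x: "0 < x" "x \<le> 1" by (simp_all add: x_def power_le_one)
  have p: "2 ^ (k + 5) * x = 32" by (simp add: x_def power_add power_one_over)
  have sp: "speed k = (1 + x) / 2" "speed (Suc k) = (1 + x / 2) / 2" by (simp_all add: speed_def x_def)
  have "1 - x / 16 \<le> R / \<rho>"
  proof -
    have "(1 - x / 16) * \<rho> \<le> (1 - x / 16) * (R * (1 + x / 16))"
      using \<rho>(2) x by (intro mult_left_mono) (auto simp: x_def)
    also have "\<dots> = R * (1 - x * x / 256)" by (simp add: field_simps)
    also have "\<dots> \<le> R * 1" using R x by (intro mult_left_mono) auto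
    finally show ?thesis using R \<rho> by (simp add: le_divide_eq)
  qed
  then have "2 ^ (k + 5) * (1 - x / 16) \<le> 2 ^ (k + 5) * (R / \<rho>)" by (intro mult_left_mono) auto
  then have 1: "2 ^ (k + 5) - 7 \<le> 2 ^ (k + 5) * R / \<rho> - 5" using p by (simp add: algebra_simps)
  have "x * x \<le> x * 1" using x by (intro mult_left_mono) auto
  moreover have "(1 - 7 * x / 32) * (1 + x) = 1 + x - 7 * x / 32 - 7 * (x * x) / 32" by (simp add: field_simps)
  ultimately have "1 + x / 2 \<le> (1 - 7 * x / 32) * (1 + x)" using x by linarith
  then have "2 ^ (k + 5) * (1 + x / 2) \<le> 2 ^ (k + 5) * ((1 - 7 * x / 32) * (1 + x))" by (intro mult_left_mono) auto
  also have "\<dots> = (2 ^ (k + 5) - 7 * (2 ^ (k + 5) * x) / 32) * (1 + x)" by (simp add: algebra_simps)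
  also have "\<dots> = (2 ^ (k + 5) - 7) * (1 + x)" unfolding p by simp
  also have "\<dots> \<le> (2 ^ (k + 5) * R / \<rho> - 5) * (1 + x)" using 1 x by (intro mult_right_mono) auto
  finally have "2 ^ (k + 5) * (1 + x / 2) * (R / 2) \<le> (2 ^ (k + 5) * R / \<rho> - 5) * (1 + x) * (R / 2)"
    using R by (intro mult_right_mono) auto
  then show ?thesis by (simp add: sp mult_ac)
qed

text \<open>With \<open>u = y powr \<beta>\<close> and \<open>p \<le> \<beta> * m\<close>, the power
  \<open>y ^ p\<close> is at most \<open>u ^ m\<close>, which is eventually below
  \<open>exp u\<close>.\<close>

lemma eventually_exp_powr_le:
  fixes \<beta> :: real
  assumes \<beta>: "0 < \<beta>"
  shows "eventually (\<lambda>y. exp (- (y powr \<beta>)) \<le> 1 / y ^ p) at_top"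
proof -
  obtain m :: nat where m: "real p / \<beta> \<le> real m" using real_arch_simple by blast
  have mb: "real p \<le> \<beta> * real m" using m \<beta> by (simp add: field_simps)
  have "filterlim (\<lambda>y. exp (\<beta> * ln y)) at_top at_top"
    by (intro filterlim_compose[OF exp_at_top] filterlim_tendsto_pos_mult_at_top[OF tendsto_const \<beta>] ln_at_top)
  moreover have "eventually (\<lambda>y. exp (\<beta> * ln y) = y powr \<beta>) at_top"
    using eventually_gt_at_top[of 0] by eventually_elim (simp add: powr_def)
  ultimately have "filterlim (\<lambda>y. y powr \<beta>) at_top at_top"
    by (simp cong: filterlim_cong)
  then have "((\<lambda>y. (y powr \<beta>) ^ m / exp (y powr \<beta>)) \<longlongrightarrow> 0) at_top"
    by (rule filterlim_compose[OF tendsto_power_div_exp_0])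
  then have "eventually (\<lambda>y. (y powr \<beta>) ^ m / exp (y powr \<beta>) < 1) at_top"
    by (rule order_tendstoD) simp
  then show ?thesis using eventually_ge_at_top[of 1]
  proof eventually_elim
    fix y :: real assume y: "(y powr \<beta>) ^ m / exp (y powr \<beta>) < 1" "1 \<le> y"
    have "y ^ p = y powr real p" using y by (simp add: powr_realpow)
    also have "\<dots> \<le> y powr (\<beta> * real m)" using y mb by (intro powr_mono) auto
    also have "\<dots> = (y powr \<beta>) ^ m" using y by (simp add: powr_powr[symmetric] powr_realpow)
    also have "\<dots> \<le> exp (y powr \<beta>)" using y by (simp add: field_simps)
    finally show "exp (- (y powr \<beta>)) \<le> 1 / y ^ p" using y by (simp add: exp_minus field_simps)
  qed
qed

section \<open>The recursion between consecutive scales\<close>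

context ergodic_density begin

text \<open>The prefactor is the squared number of lattice cubes: a radius of order
  \<open>2 ^ k * R\<close> is covered by cubes of size \<open>R / (d * 2 ^ (k + 6))\<close>, hence
  about \<open>d * 4 ^ k\<close> per direction.\<close>

lemma scale_step:
  fixes R\<^sub>0 c \<beta> Q\<^sub>0 :: real and k :: nat
  defines "d \<equiv> real CARD('d)"
  defines "p \<equiv> \<lambda>k. prob (cheap (cube_side d R\<^sub>0 k) (scale_radius R\<^sub>0 k) (c * scale_radius R\<^sub>0 k * speed k) 0)"
  assumes R0: "64 * d \<le> R\<^sub>0" "Q\<^sub>0 \<le> R\<^sub>0" and c: "0 \<le> c"
    and Ind: "\<And>Q. Q\<^sub>0 \<le> Q \<Longrightarrow> Ind_dec L Q (Q powr 2) \<le> exp (- (Q powr \<beta>))"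
  shows "p (Suc k) \<le> (d * 2 ^ 14) ^ (2 * CARD('d)) * (2 ^ (4 * CARD('d))) ^ k * ((p k)\<^sup>2 + exp (- (scale_radius R\<^sub>0 k powr \<beta>)))"
proof -
  define R where "R = scale_radius R\<^sub>0 k"
  define q where "q = cube_side d R\<^sub>0 k"
  define r where "r = d * (q + 1)"
  define \<rho> where "\<rho> = R + 2 * r"
  define R' where "R' = scale_radius R\<^sub>0 (Suc k)"
  define q' where "q' = cube_side d R\<^sub>0 (Suc k)"
  \<comment> \<open>One less than the number of spheres that fit, since \<open>N\<close> pieces need
    \<open>N + 1\<close> spheres; together with the floor this costs at most 2.\<close>
  define N where "N = nat \<lfloor>R' / \<rho>\<rfloor> - 1"
  \<comment> \<open>Gives \<open>q * real M = 2 * R'\<close>, room for \<open>R'\<close> plus the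
    norm of a boundary centre of the larger cube.\<close>
  define M where "M = CARD('d) * 2 ^ (2 * k + 12)"
  have d: "1 \<le> d" by (simp add: d_def Suc_le_eq)
  have R0pos: "64 \<le> R\<^sub>0" using R0 d by linarith
  have "R\<^sub>0 * 1 \<le> R\<^sub>0 * 2 ^ k" using R0pos by (intro mult_left_mono) auto
  also have "\<dots> \<le> R" unfolding R_def using R0pos by (intro scale_radius_ge) auto
  finally have RR0: "R\<^sub>0 \<le> R" by simp
  then have R: "64 \<le> R" using R0pos by linarith
  have R': "R' = 2 ^ (k + 5) * R" by (simp add: R'_def R_def)
  have two: "(32::real) \<le> 2 ^ (k + 5)" by (simp add: power_add)
  have R'R: "32 * R \<le> R'" unfolding R' using two R by (intro mult_right_mono) auto
  have q1: "1 \<le> q" "1 \<le> q'" unfolding q_def q'_def using d R0 by (auto intro!: cube_side_ge_1)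
  have dq: "d * q = R / 2 ^ (k + 6)" "d * q' = R' / 2 ^ (k + 7)"
    using d by (simp_all add: q_def q'_def cube_side_def R_def R'_def)
  have r_le: "r \<le> 2 * (d * q)" "d * (q' + 1) \<le> 2 * (d * q')"
    unfolding r_def using q1 d by (simp_all add: algebra_simps)
  have dq_half: "2 * r \<le> R * ((1/2) ^ k / 16)"
    using r_le(1) unfolding dq by (simp add: power_add power_one_over field_simps)
  have "R * ((1/2) ^ k / 16) \<le> R * 1"
    using R by (intro mult_left_mono) (auto simp: power_le_one order.trans[of _ 1])
  with dq_half have r_le_R: "2 * r \<le> R" by simp
  have r_pos: "0 < r" unfolding r_def using q1 d by simp
  have \<rho>: "R \<le> \<rho>" "\<rho> \<le> R * (1 + (1/2) ^ k / 16)" "\<rho> \<le> 2 * R" "0 < \<rho>"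
    using dq_half r_pos r_le_R R by (auto simp: \<rho>_def algebra_simps)
  have "2 * \<rho> \<le> R'" using \<rho> R'R R by linarith
  then have ratio: "2 \<le> R' / \<rho>" using \<rho>(4) by (simp add: field_simps)
  have N: "real N + 1 \<le> R' / \<rho>" "R' / \<rho> - 2 \<le> real N"
  proof -
    have fl: "2 \<le> \<lfloor>R' / \<rho>\<rfloor>" using ratio by (simp only: le_floor_iff of_int_numeral)
    then have "1 \<le> nat \<lfloor>R' / \<rho>\<rfloor>" by linarith
    then have "real N = real (nat \<lfloor>R' / \<rho>\<rfloor>) - 1" unfolding N_def by (simp only: of_nat_diff of_nat_1)
    also have "real (nat \<lfloor>R' / \<rho>\<rfloor>) = of_int \<lfloor>R' / \<rho>\<rfloor>" using fl by (intro of_nat_nat) linarith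
    finally have "real N = of_int \<lfloor>R' / \<rho>\<rfloor> - 1" .
    then show "real N + 1 \<le> R' / \<rho>" "R' / \<rho> - 2 \<le> real N" by linarith+
  qed
  have speed_pos: "0 \<le> speed k" using speed_bounds(1)[of k] by linarith
  have "prob (cheap q' R' (c * R' * speed (Suc k)) 0)
      \<le> (real ((2 * M + 1) ^ CARD('d)))\<^sup>2 * ((prob (cheap q R (c * R * speed k) 0))\<^sup>2 + exp (- (R powr \<beta>)))"
  proof (rule renormalization_step[where N = N and S = "R powr 2"])
    show "1 < R" "1 < R'" "0 < q" "0 < q'" using R R'R q1 by auto
    show "0 \<le> c * R * speed k" using c R speed_pos by simp
    have "(real N + 1) * \<rho> \<le> R'" using N(1) \<rho>(4) by (simp add: le_divide_eq)
    then show "real (N + 1) * (R + 2 * (real CARD('d) * (q + 1))) \<le> R'"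
      by (simp add: \<rho>_def r_def d_def add.commute)
    have "R' * speed (Suc k) \<le> (R' / \<rho> - 5) * (R * speed k)"
      unfolding R' using \<rho> R by (intro speed_step) auto
    also have "\<dots> \<le> (real N - 3) * (R * speed k)"
      using N(2) R speed_pos by (intro mult_right_mono) auto
    finally have "c * (R' * speed (Suc k)) \<le> c * ((real N - 3) * (R * speed k))"
      using c by (intro mult_left_mono)
    then show "c * R' * speed (Suc k) \<le> (real N - 3) * (c * R * speed k)" by (simp add: mult_ac)
    have "q * real M = d * q * 2 ^ (2 * k + 12)" by (simp add: M_def d_def)
    also have "\<dots> = 2 * R'" unfolding dq(1) R' by (simp add: power_add power_mult power2_eq_square field_simps flip: power_mult_distrib)
    finally have qM: "q * real M = 2 * R'" .
    have "d * (q' + 1) \<le> R' * (1 / 2 ^ (k + 6))" using r_le(2) unfolding dq by (simp add: power_add)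
    also have "\<dots> \<le> R' * 1" using R R'R by (intro mult_left_mono) (auto simp: field_simps)
    finally show "R' + real CARD('d) * (q' + 1) \<le> q * real M" unfolding qM by (simp add: d_def)
    have "2 * (R + r) \<le> R * R" 
    proof -
      have "2 * (R + r) = 2 * R + 2 * r" by simp
      also have "\<dots> \<le> 64 * R" using r_le_R R by linarith
      also have "\<dots> \<le> R * R" using R by (intro mult_right_mono) auto
      finally show ?thesis .
    qed
    also have "R * R = R powr 2" using R by (simp add: powr_realpow[of R 2, simplified] power2_eq_square)
    finally show "2 * (R + real CARD('d) * (q + 1)) \<le> R powr 2" by (simp add: r_def d_def)
    show "Ind_dec L R (R powr 2) \<le> exp (- (R powr \<beta>))" using RR0 R0 by (intro Ind) auto
  qed simp
  also have "\<dots> \<le> (d * 2 ^ 14) ^ (2 * CARD('d)) * (2 ^ (4 * CARD('d))) ^ k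
      * ((prob (cheap q R (c * R * speed k) 0))\<^sup>2 + exp (- (R powr \<beta>)))"
  proof (rule mult_right_mono)
    have "real (2 * M + 1) \<le> d * 2 ^ (2 * k + 14)"
    proof -
      have "1 \<le> d * 2 ^ (2 * k + 13)" using d mult_mono[of 1 d 1 "2 ^ (2 * k + 13)"] by simp
      moreover have "real (2 * M) = d * 2 ^ (2 * k + 13)" by (simp add: M_def d_def power_add)
      moreover have "d * 2 ^ (2 * k + 14) = d * 2 ^ (2 * k + 13) + d * 2 ^ (2 * k + 13)" by (simp add: power_add)
      moreover have "real (2 * M + 1) = real (2 * M) + 1" by simp
      ultimately show ?thesis by linarith
    qed
    then have "(real (2 * M + 1)) ^ (2 * CARD('d)) \<le> (d * 2 ^ (2 * k + 14)) ^ (2 * CARD('d))"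
      by (intro power_mono) auto
    also have "(d * 2 ^ (2 * k + 14)) ^ (2 * CARD('d)) = (d * 2 ^ 14) ^ (2 * CARD('d)) * (2 ^ (2 * k)) ^ (2 * CARD('d))"
    proof -
      have "d * 2 ^ (2 * k + 14) = (d * 2 ^ 14) * 2 ^ (2 * k)" by (simp add: power_add)
      then show ?thesis by (simp only: power_mult_distrib)
    qed
    also have "((2::real) ^ (2 * k)) ^ (2 * CARD('d)) = (2 ^ (4 * CARD('d))) ^ k"
    proof -
      have "2 * k * (2 * CARD('d)) = 4 * CARD('d) * k" by simp
      then show ?thesis by (simp only: power_mult[symmetric])
    qed
    finally show "(real ((2 * M + 1) ^ CARD('d)))\<^sup>2 \<le> (d * 2 ^ 14) ^ (2 * CARD('d)) * (2 ^ (4 * CARD('d))) ^ k"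
      by (simp add: power_mult[symmetric] mult.commute[of 2] del: of_nat_mult of_nat_add of_nat_Suc)
  qed auto
  finally show ?thesis by (simp add: p_def R_def q_def R'_def q'_def)
qed

end

section \<open>The first scale and the induction\<close>

context ergodic_density begin

text \<open>Continuity from above along the costs \<open>1 / real (Suc n)\<close>: the events
  decrease to cost 0. The resulting \<open>c\<close> depends on \<open>R\<close> in an uncontrolled
  way.\<close>

lemma small_cost_probability:
  fixes \<epsilon> R :: real
  assumes R: "1 < R" and \<epsilon>: "0 < \<epsilon>"
  obtains c where "0 < c" "prob {\<phi>. T_annulus \<phi> R < ennreal c} < prob {\<phi>. T_annulus \<phi> R = 0} + \<epsilon>"
proof -
  let ?A = "\<lambda>n::nat. {\<phi> \<in> space L. T_annulus \<phi> R < ennreal (1 / real (Suc n))}"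
  have [measurable]: "(\<lambda>\<phi>. T_annulus \<phi> R) \<in> borel_measurable L" using R by simp
  have "(\<lambda>n. prob (?A n)) \<longlonglongrightarrow> prob (\<Inter>n. ?A n)"
  proof (rule finite_Lim_measure_decseq)
    show "range ?A \<subseteq> sets L" by (intro image_subsetI) measurable
    show "decseq ?A"
    proof (rule decseq_SucI, rule subsetI)
      fix n \<phi> assume "\<phi> \<in> ?A (Suc n)"
      moreover have "ennreal (1 / real (Suc (Suc n))) \<le> ennreal (1 / real (Suc n))"
        by (intro ennreal_leI divide_left_mono) auto
      ultimately show "\<phi> \<in> ?A n" by (auto intro: order.strict_trans2)
    qed
  qed
  also have "(\<Inter>n. ?A n) = {\<phi>. T_annulus \<phi> R = 0}"
  proof (intro equalityI subsetI)
    fix \<phi> assume \<phi>: "\<phi> \<in> (\<Inter>n. ?A n)"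
    have "T_annulus \<phi> R \<le> 0"
    proof (rule ennreal_le_epsilon)
      fix e :: real assume "0 < e"
      then obtain n where "1 / real (Suc n) < e" using reals_Archimedean[of e] by (auto simp: inverse_eq_divide)
      then have "ennreal (1 / real (Suc n)) \<le> ennreal e" by (intro ennreal_leI) simp
      moreover have "T_annulus \<phi> R < ennreal (1 / real (Suc n))" using \<phi> by auto
      ultimately show "T_annulus \<phi> R \<le> 0 + ennreal e" by simp
    qed
    then show "\<phi> \<in> {\<phi>. T_annulus \<phi> R = 0}" by simp
  qed auto
  finally have "eventually (\<lambda>n. prob (?A n) < prob {\<phi>. T_annulus \<phi> R = 0} + \<epsilon>) sequentially"
    using \<epsilon> by (intro order_tendstoD) auto
  then obtain n where "prob (?A n) < prob {\<phi>. T_annulus \<phi> R = 0} + \<epsilon>" by (auto simp: eventually_sequentially)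
  then show ?thesis by (intro that[of "1 / real (Suc n)"]) auto
qed

lemma initial_scale:
  fixes \<eta> R :: real
  defines "d \<equiv> real CARD('d)"
  assumes R: "64 * d \<le> R"
    and arm: "prob {\<phi>. T_annulus \<phi> R = 0} \<le> R powr (- (d - 1 + \<eta>))"
  obtains c where "0 < c" "prob (cheap (R / (64 * d)) R (c * R) 0) \<le> 4 * d * R powr (- \<eta>)"
proof -
  have d: "1 \<le> d" by (simp add: d_def Suc_le_eq)
  have R64: "64 \<le> R" using R d by linarith
  define e where "e = R powr (- (d - 1 + \<eta>))"
  have e: "0 < e" using R64 by (simp add: e_def)
  obtain b where b: "0 < b" "prob {\<phi>. T_annulus \<phi> R < ennreal b} < prob {\<phi>. T_annulus \<phi> R = 0} + e"
    using small_cost_probability[of R e] R64 e by auto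
  \<comment> \<open>This is \<open>cube_side d R 0\<close>; it makes
    \<open>2 * d * q + 3 = R / 32 + 3 \<le> R\<close>, so at most \<open>2 * d * R ^ (d - 1)\<close>
    balls enter the union bound.\<close>
  define q where "q = R / (64 * d)"
  have q: "0 < q" using R64 d by (simp add: q_def)
  let ?A = "{\<phi>. T_annulus \<phi> R < ennreal b}"
  have A: "?A \<in> sets L"
  proof -
    have [measurable]: "(\<lambda>\<phi>. T_annulus \<phi> R) \<in> borel_measurable L" using R64 by simp
    have "{\<phi> \<in> space L. T_annulus \<phi> R < ennreal b} \<in> sets L" by measurable
    then show ?thesis by simp
  qed
  have tA: "{\<phi>. translate z \<phi> \<in> ?A} \<in> sets L" for z
    using measurable_sets[OF measurable_translate A, of z] by (simp add: vimage_def)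
  have "prob (cheap q R b 0) = prob (\<Union>z\<in>shell q. {\<phi>. translate z \<phi> \<in> ?A})"
    by (rule arg_cong[of _ _ prob]) (auto simp: cheap_def)
  also have "\<dots> \<le> (\<Sum>z\<in>shell q. prob {\<phi>. translate z \<phi> \<in> ?A})"
    using tA by (intro finite_measure_subadditive_finite) auto
  also have "\<dots> = real (card (shell q :: (real ^ 'd) set)) * prob ?A" by (simp only: prob_translate[OF A] sum_constant)
  also have "\<dots> \<le> (2 * d * R ^ (CARD('d) - 1)) * (2 * e)"
  proof (rule mult_mono)
    have "real (card (shell q :: (real ^ 'd) set)) \<le> 2 * d * (2 * d * q + 3) ^ (CARD('d) - 1)"
      using card_shell[of q, where 'd = 'd] q by (simp add: d_def)
    also have "\<dots> \<le> 2 * d * R ^ (CARD('d) - 1)"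
    proof (intro mult_left_mono power_mono)
      have "2 * d * q + 3 = R / 32 + 3" using d by (simp add: q_def)
      also have "\<dots> \<le> R" using R64 by simp
      finally show "2 * d * q + 3 \<le> R" .
    qed (use d q in auto)
    finally show "real (card (shell q :: (real ^ 'd) set)) \<le> 2 * d * R ^ (CARD('d) - 1)" .
    show "prob ?A \<le> 2 * e" using b arm by (simp add: e_def)
  qed (use d R64 in auto)
  also have "\<dots> = 4 * d * R powr (- \<eta>)"
  proof -
    have "R ^ (CARD('d) - 1) = R powr (d - 1)"
      using R64 by (subst powr_realpow[symmetric]) (auto simp: d_def of_nat_diff Suc_le_eq)
    then have "R ^ (CARD('d) - 1) * e = R powr (- \<eta>)" by (simp add: e_def flip: powr_add)
    then show ?thesis by simp
  qed
  finally have "prob (cheap q R b 0) \<le> 4 * d * R powr (- \<eta>)" .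
  then show ?thesis using b(1) R64 by (intro that[of "b / R"]) (auto simp: q_def)
qed

text \<open>Probability 1/2 along a sequence of radii is enough: the time constant is already known
  to be a limit, so a subsequence decides its positivity.\<close>

lemma linear_lower_bound_at_scales:
  fixes \<eta> \<beta> R\<^sub>1 Q\<^sub>0 :: real
  assumes \<eta>: "0 < \<eta>" and \<beta>: "0 < \<beta>"
    and arm: "\<And>R. R\<^sub>1 \<le> R \<Longrightarrow> prob {\<phi>. T_annulus \<phi> R = 0} \<le> R powr (- (real CARD('d) - 1 + \<eta>))"
    and Ind: "\<And>Q. Q\<^sub>0 \<le> Q \<Longrightarrow> Ind_dec L Q (Q powr 2) \<le> exp (- (Q powr \<beta>))"
  obtains c R where "0 < c" "filterlim R at_top sequentially" "\<And>k::nat. 1 < R k"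
    "\<And>k. prob {\<phi>. T_annulus \<phi> (R k) < ennreal (c * R k)} \<le> 1 / 2"
proof -
  define d where "d = real CARD('d)"
  define C where "C = (d * 2 ^ 14) ^ (2 * CARD('d))"
  define B :: real where "B = 2 ^ (4 * CARD('d))"
  \<comment> \<open>\<open>\<epsilon>\<close> and the later \<open>\<theta>\<close> satisfy
    \<open>C * \<epsilon> ^ 2 = C * \<theta> = \<epsilon> / (2 * B)\<close>: the square and the
    independence error each use half of the next bound.\<close>
  define \<epsilon> where "\<epsilon> = 1 / (2 * C * B)"
  have d: "1 \<le> d" by (simp add: d_def Suc_le_eq)
  have C: "1 \<le> C" unfolding C_def using d by (intro one_le_power) simp
  have B: "1 \<le> B" unfolding B_def by (intro one_le_power) simp
  have CB: "1 \<le> C * B" using C B mult_mono[of 1 C 1 B] by simp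
  have \<epsilon>: "0 < \<epsilon>" "\<epsilon> \<le> 1/2" using CB C B by (simp_all add: \<epsilon>_def field_simps)
  define \<theta> where "\<theta> = \<epsilon> / (2 * C * B)"
  have \<theta>: "0 < \<theta>" using \<epsilon> C B by (simp add: \<theta>_def)
  \<comment> \<open>The exponent is chosen because \<open>(2 ^ k) ^ (8 * d)\<close> is the square of
    \<open>B ^ k\<close>. The bound is asked for all larger arguments, since one initial radius
    serves every scale.\<close>
  have ev_exp: "eventually (\<lambda>R\<^sub>0. \<forall>y\<ge>R\<^sub>0. exp (- (y powr \<beta>)) \<le> 1 / y ^ (8 * CARD('d))) at_top"
    using eventually_exp_powr_le[OF \<beta>] by (simp add: eventually_all_ge_at_top)
  have "((\<lambda>R\<^sub>0. inverse (R\<^sub>0 :: real)) \<longlongrightarrow> 0) at_top" by (rule tendsto_inverse_0_at_top[OF filterlim_ident])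
  then have "((\<lambda>R\<^sub>0. inverse (R\<^sub>0 :: real) ^ (8 * CARD('d))) \<longlongrightarrow> 0 ^ (8 * CARD('d))) at_top"
    by (rule tendsto_power)
  also have "(0::real) ^ (8 * CARD('d)) = 0" by (simp add: power_0_left)
  finally have "((\<lambda>R\<^sub>0. inverse (R\<^sub>0 :: real) ^ (8 * CARD('d))) \<longlongrightarrow> 0) at_top" .
  then have "eventually (\<lambda>R\<^sub>0. inverse R\<^sub>0 ^ (8 * CARD('d)) < \<theta>) at_top"
    using \<theta> by (rule order_tendstoD)
  moreover have "eventually (\<lambda>R\<^sub>0. 4 * d * R\<^sub>0 powr (- \<eta>) < \<epsilon>) at_top"
  proof -
    have "((\<lambda>R\<^sub>0. R\<^sub>0 powr (- \<eta>)) \<longlongrightarrow> 0) at_top"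
      using \<eta> by (intro tendsto_neg_powr filterlim_ident) auto
    then have "((\<lambda>R\<^sub>0. 4 * d * R\<^sub>0 powr (- \<eta>)) \<longlongrightarrow> 4 * d * 0) at_top" by (intro tendsto_mult tendsto_const)
    then show ?thesis using \<epsilon> by (intro order_tendstoD) auto
  qed
  ultimately have "eventually (\<lambda>R\<^sub>0. (\<forall>y\<ge>R\<^sub>0. exp (- (y powr \<beta>)) \<le> 1 / y ^ (8 * CARD('d)))
      \<and> inverse R\<^sub>0 ^ (8 * CARD('d)) < \<theta> \<and> 4 * d * R\<^sub>0 powr (- \<eta>) < \<epsilon>
      \<and> 64 * d \<le> R\<^sub>0 \<and> R\<^sub>1 \<le> R\<^sub>0 \<and> Q\<^sub>0 \<le> R\<^sub>0) at_top"
    using ev_exp by (intro eventually_conj eventually_ge_at_top)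
  then obtain R\<^sub>0 where R0: "\<And>y. R\<^sub>0 \<le> y \<Longrightarrow> exp (- (y powr \<beta>)) \<le> 1 / y ^ (8 * CARD('d))"
      "inverse R\<^sub>0 ^ (8 * CARD('d)) < \<theta>" "4 * d * R\<^sub>0 powr (- \<eta>) < \<epsilon>" "64 * d \<le> R\<^sub>0" "R\<^sub>1 \<le> R\<^sub>0" "Q\<^sub>0 \<le> R\<^sub>0"
    by (auto dest!: eventually_happens'[OF trivial_limit_at_top_linorder])
  have R0pos: "64 \<le> R\<^sub>0" using R0(4) d by linarith
  obtain c where c: "0 < c" "prob (cheap (R\<^sub>0 / (64 * d)) R\<^sub>0 (c * R\<^sub>0) 0) \<le> 4 * d * R\<^sub>0 powr (- \<eta>)"
    using initial_scale[of R\<^sub>0 \<eta>] arm[OF R0(5)] R0(4) by (auto simp: d_def)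
  define p where "p k = prob (cheap (cube_side d R\<^sub>0 k) (scale_radius R\<^sub>0 k) (c * scale_radius R\<^sub>0 k * speed k) 0)" for k
  have ge: "R\<^sub>0 * 2 ^ k \<le> scale_radius R\<^sub>0 k" for k using R0pos by (intro scale_radius_ge) auto
  have ge0: "R\<^sub>0 \<le> R\<^sub>0 * 2 ^ k" for k :: nat using R0pos by simp
  have exp_le: "exp (- (scale_radius R\<^sub>0 k powr \<beta>)) \<le> \<theta> / (B ^ k)\<^sup>2" for k
  proof -
    have "exp (- (scale_radius R\<^sub>0 k powr \<beta>)) \<le> exp (- ((R\<^sub>0 * 2 ^ k) powr \<beta>))"
      using ge[of k] R0pos \<beta> by (simp add: powr_mono2)
    also have "\<dots> \<le> 1 / (R\<^sub>0 * 2 ^ k) ^ (8 * CARD('d))" by (intro R0(1) ge0)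
    also have "\<dots> = inverse R\<^sub>0 ^ (8 * CARD('d)) / (2 ^ k) ^ (8 * CARD('d))"
      by (simp add: power_mult_distrib power_one_over inverse_eq_divide)
    also have "\<dots> \<le> \<theta> / (2 ^ k) ^ (8 * CARD('d))" using R0(2) by (intro divide_right_mono) auto
    also have "((2::real) ^ k) ^ (8 * CARD('d)) = (B ^ k)\<^sup>2"
      by (simp add: B_def power_mult[symmetric] mult_ac)
    finally show ?thesis .
  qed
  have p_le: "p k \<le> \<epsilon> / B ^ k" for k
  proof (induction k)
    case 0
    have "p 0 = prob (cheap (R\<^sub>0 / (64 * d)) R\<^sub>0 (c * R\<^sub>0) 0)"
      by (simp add: p_def cube_side_def speed_def mult.commute)
    then show ?case using c(2) R0(3) by simp
  next
    case (Suc k)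
    have "0 \<le> p k" by (simp add: p_def)
    have Bk: "0 < B ^ k" using B by simp
    have "p (Suc k) \<le> C * B ^ k * ((p k)\<^sup>2 + exp (- (scale_radius R\<^sub>0 k powr \<beta>)))"
      unfolding p_def C_def B_def d_def
      by (rule scale_step[OF _ R0(6) _ Ind]) (use R0(4) c in \<open>auto simp: d_def\<close>)
    also have "\<dots> \<le> C * B ^ k * ((\<epsilon> / B ^ k)\<^sup>2 + \<theta> / (B ^ k)\<^sup>2)"
      using Suc \<open>0 \<le> p k\<close> C Bk by (intro mult_left_mono add_mono power_mono exp_le) auto
    also have "\<dots> = C * (\<epsilon>\<^sup>2 + \<theta>) / B ^ k"
      using Bk by (simp add: power_divide add_divide_distrib[symmetric] power2_eq_square)
    also have "C * (\<epsilon>\<^sup>2 + \<theta>) = \<epsilon> / B" using C B by (simp add: \<theta>_def \<epsilon>_def power2_eq_square field_simps)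
    finally show ?case by (simp add: mult.commute)
  qed
  show ?thesis
  \<comment> \<open>The factor 1/2 is the lower bound for \<open>speed\<close>.\<close>
  proof (rule that[of "c / 2" "scale_radius R\<^sub>0"])
    show "0 < c / 2" using c by simp
    show gt1: "1 < scale_radius R\<^sub>0 k" for k using ge[of k] ge0[of k] R0pos by linarith
    show "filterlim (scale_radius R\<^sub>0) at_top sequentially"
    proof (rule filterlim_at_top_mono)
      show "filterlim real at_top sequentially" by (rule filterlim_real_sequentially)
      show "eventually (\<lambda>k. real k \<le> scale_radius R\<^sub>0 k) sequentially"
      proof (intro always_eventually allI)
        fix k
        have "real k \<le> 2 ^ k" using of_nat_mono[OF less_imp_le[OF less_exp[of k]], where 'a = real] by simp
        also have "\<dots> \<le> R\<^sub>0 * 2 ^ k" using R0pos by simp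
        also note ge[of k]
        finally show "real k \<le> scale_radius R\<^sub>0 k" .
      qed
    qed
    show "prob {\<phi>. T_annulus \<phi> (scale_radius R\<^sub>0 k) < ennreal (c / 2 * scale_radius R\<^sub>0 k)} \<le> 1 / 2" for k
    proof -
      let ?R = "scale_radius R\<^sub>0 k"
      let ?A = "{\<phi>. T_annulus \<phi> ?R < ennreal (c / 2 * ?R)}"
      have q: "0 \<le> cube_side d R\<^sub>0 k" using cube_side_ge_1[OF d R0(4), of k] by simp
      \<comment> \<open>One boundary centre is enough: a cheap crossing about it makes the cube
        cheap, and by stationarity it is as likely as one about the origin.\<close>
      obtain z :: "real ^ 'd" where z: "z \<in> shell (cube_side d R\<^sub>0 k)" using shell_nonempty[OF q] by blast
      have A: "?A \<in> sets L"
      proof -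
        have [measurable]: "(\<lambda>\<phi>. T_annulus \<phi> ?R) \<in> borel_measurable L" using gt1 by simp
        have "{\<phi> \<in> space L. T_annulus \<phi> ?R < ennreal (c / 2 * ?R)} \<in> sets L" by measurable
        then show ?thesis by simp
      qed
      have le: "c / 2 * ?R \<le> c * ?R * speed k"
      proof -
        have "c * ?R * (1 / 2) \<le> c * ?R * speed k"
          using speed_bounds(1) c gt1[of k] by (intro mult_left_mono) auto
        then show ?thesis by simp
      qed
      have "{\<phi>. translate z \<phi> \<in> ?A} \<subseteq> cheap (cube_side d R\<^sub>0 k) ?R (c * ?R * speed k) 0"
      proof
        fix \<phi> assume "\<phi> \<in> {\<phi>. translate z \<phi> \<in> ?A}"
        then have "T_annulus (translate (0 + z) \<phi>) ?R < ennreal (c * ?R * speed k)"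
          using ennreal_leI[OF le] by (simp only: mem_Collect_eq add_0_left)
        with z show "\<phi> \<in> cheap (cube_side d R\<^sub>0 k) ?R (c * ?R * speed k) 0"
          unfolding cheap_def by blast
      qed
      then have "prob {\<phi>. translate z \<phi> \<in> ?A} \<le> p k"
        unfolding p_def using gt1 by (intro finite_measure_mono measurable_cheap)
      then have "prob ?A \<le> p k" by (simp only: prob_translate[OF A])
      also have "\<dots> \<le> \<epsilon> / B ^ k" by (rule p_le)
      also have "\<dots> \<le> \<epsilon> / 1" using B \<epsilon> by (intro divide_left_mono) auto
      finally show ?thesis using \<epsilon> by simp
    qed
  qed
qed

text \<open>Every path from 0 to \<open>v\<close> crosses the annulus, and Markov's inequality turns
  the probability 1/2 into a mean.\<close>

lemma mean_T_ge:
  assumes R: "1 < R" "R \<le> norm v" and \<delta>: "0 \<le> \<delta>" and p: "prob {\<phi>. T_annulus \<phi> R < ennreal \<delta>} \<le> 1 / 2"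
  shows "\<delta> / 2 \<le> mean_T v"
proof -
  let ?A = "{\<phi>. T_annulus \<phi> R < ennreal \<delta>}"
  have A: "?A \<in> sets L"
  proof -
    have [measurable]: "(\<lambda>\<phi>. T_annulus \<phi> R) \<in> borel_measurable L" using R by simp
    have "{\<phi> \<in> space L. T_annulus \<phi> R < ennreal \<delta>} \<in> sets L" by measurable
    then show ?thesis by simp
  qed
  have le: "T_annulus \<phi> R \<le> T \<phi> 0 v" for \<phi>
  proof (rule T_greatest)
    fix \<gamma> assume "valid_path \<gamma>" "pathstart \<gamma> = 0" "pathfinish \<gamma> = v"
    then show "T_annulus \<phi> R \<le> arc_integral \<phi> \<gamma>"
      using T_annulus_translate_le_arc_part[of \<gamma> 0 1 R 0 \<phi>] R
      by (simp add: arc_integral_eq_arc_part pathstart_def pathfinish_def)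
  qed
  have "prob (space L - ?A) = 1 - prob ?A" using A by (rule prob_compl)
  then have "1 / 2 \<le> prob (space L - ?A)" using p by simp
  then have "ennreal (\<delta> / 2) \<le> ennreal (\<delta> * prob (space L - ?A))"
    using \<delta> mult_left_mono[of "1/2" "prob (space L - ?A)" \<delta>] by (intro ennreal_leI) simp
  also have "\<dots> = (\<integral>\<^sup>+ \<phi>. ennreal \<delta> * indicator (space L - ?A) \<phi> \<partial>L)"
    using A \<delta> by (subst nn_integral_cmult_indicator) (auto simp: emeasure_eq_measure ennreal_mult' simp del: space_L)
  also have "\<dots> \<le> (\<integral>\<^sup>+ \<phi>. T \<phi> 0 v \<partial>L)"
  proof (rule nn_integral_mono)
    fix \<phi>
    show "ennreal \<delta> * indicator (space L - ?A) \<phi> \<le> T \<phi> 0 v"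
      using le[of \<phi>] by (cases "\<phi> \<in> ?A") (auto simp: not_less intro: order_trans)
  qed
  also have "\<dots> = ennreal (mean_T v)" by (rule nn_integral_T)
  finally show ?thesis by (simp add: mean_T_nonneg)
qed

text \<open>The multiples \<open>n k\<close> are the first for which \<open>n k\<close> times
  \<open>v\<close> is at distance at least \<open>R k\<close>. Eventually
  \<open>n k \<le> 2 * (R k / norm v)\<close>, and the mean \<open>c * R k / 2\<close> at that point
  gives the slope \<open>c * norm v / 4\<close>.\<close>

lemma time_constant_pos:
  fixes c :: real
  assumes v: "v \<noteq> 0" and lim: "(\<lambda>n. mean_T (real n *\<^sub>R v) / real n) \<longlonglongrightarrow> \<mu>"
    and c: "0 < c" and R: "filterlim R at_top sequentially" "\<And>k::nat. 1 < R k"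
    and p: "\<And>k. prob {\<phi>. T_annulus \<phi> (R k) < ennreal (c * R k)} \<le> 1 / 2"
  shows "0 < \<mu>"
proof -
  define n where "n k = nat \<lceil>R k / norm v\<rceil>" for k
  have nv: "0 < norm v" using v by simp
  have n: "R k / norm v \<le> real (n k)" "real (n k) \<le> R k / norm v + 1" for k
  proof -
    have "0 < R k / norm v" using nv R(2)[of k] by (intro divide_pos_pos) auto
    then show "R k / norm v \<le> real (n k)" "real (n k) \<le> R k / norm v + 1" unfolding n_def by linarith+
  qed
  have nlim: "filterlim n at_top sequentially"
    unfolding filterlim_at_top
  proof
    fix Z
    have "eventually (\<lambda>k. real Z * norm v \<le> R k) sequentially" using R(1) by (simp add: filterlim_at_top)
    then show "eventually (\<lambda>k. Z \<le> n k) sequentially"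
    proof eventually_elim
      fix k assume "real Z * norm v \<le> R k"
      then have "real Z \<le> R k / norm v" using nv by (simp add: field_simps)
      with n(1)[of k] show "Z \<le> n k" by linarith
    qed
  qed
  have "(\<lambda>k. mean_T (real (n k) *\<^sub>R v) / real (n k)) \<longlonglongrightarrow> \<mu>"
    by (rule filterlim_compose[OF lim nlim])
  moreover have "eventually (\<lambda>k. c * norm v / 4 \<le> mean_T (real (n k) *\<^sub>R v) / real (n k)) sequentially"
  proof -
    have "eventually (\<lambda>k. norm v \<le> R k) sequentially" using R(1) by (simp add: filterlim_at_top)
    then show ?thesis
    proof eventually_elim
      fix k assume k: "norm v \<le> R k"
      have Rn: "R k \<le> norm (real (n k) *\<^sub>R v)" using n(1)[of k] nv by (simp add: field_simps)
      have "1 \<le> R k / norm v" using k nv by simp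
      then have n2: "real (n k) \<le> 2 * (R k / norm v)" "0 < real (n k)" using n[of k] by linarith+
      have "c * norm v / 4 * real (n k) \<le> c * norm v / 4 * (2 * (R k / norm v))"
        using n2 c nv by (intro mult_left_mono) auto
      also have "\<dots> = c * R k / 2" using nv by simp
      also have "\<dots> \<le> mean_T (real (n k) *\<^sub>R v)"
        using R(2)[of k] c p Rn by (intro mean_T_ge) auto
      finally show "c * norm v / 4 \<le> mean_T (real (n k) *\<^sub>R v) / real (n k)"
        using n2 by (simp add: le_divide_eq)
    qed
  qed
  ultimately have "c * norm v / 4 \<le> \<mu>"
    by (intro tendsto_lowerbound) auto
  moreover have "0 < c * norm v / 4" using c nv by simp
  ultimately show ?thesis by linarith
qed

end

text \<open>On a probability space an almost sure identity of constants is an identity. This gives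
  the definite description in \<open>time_constant\<close> its meaning.\<close>

lemma is_time_limit_unique:
  assumes "prob_space M" "is_time_limit M \<sigma> v c" "is_time_limit M \<sigma> v c'"
  shows "c = c'"
proof -
  interpret prob_space M by fact
  have "AE \<omega> in M. (\<lambda>n. T (\<sigma> \<omega>) 0 (real n *\<^sub>R v) / of_nat n) \<longlonglongrightarrow> ennreal c"
    "AE \<omega> in M. (\<lambda>n. T (\<sigma> \<omega>) 0 (real n *\<^sub>R v) / of_nat n) \<longlonglongrightarrow> ennreal c'"
    using assms(2,3) unfolding is_time_limit_def by blast+
  then have "AE \<omega> in M. ennreal c = ennreal c'"
    by eventually_elim (rule LIMSEQ_unique)
  then show ?thesis using assms(2,3) by (simp add: is_time_limit_def)
qed

theorem corollary2p10:
  fixes M :: "'w measure"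
    and F :: "(real ^ 'd::finite \<Rightarrow> real) measure"
    and \<sigma> :: "'w \<Rightarrow> real ^ 'd \<Rightarrow> real"
  assumes density: "random_density M F \<sigma>"
    and measurability: "AE \<omega> in M. \<sigma> \<omega> \<in> borel_measurable borel"
    and finite_moment: "\<And>x. (\<integral>\<^sup>+ \<omega>. arc_integral (\<sigma> \<omega>) (linepath 0 x) \<partial>M) < \<infinity>"
    and ergodicity: "\<And>v. v \<noteq> 0 \<Longrightarrow> ergodic_translation (distr M F \<sigma>) v"
    and instant_one_arms:
      "\<exists>\<eta>>0. \<exists>R\<^sub>0>0. \<forall>R\<ge>R\<^sub>0.
         measure M {\<omega> \<in> space M. T_annulus (\<sigma> \<omega>) R = 0} \<le> R powr (- (real CARD('d) - 1 + \<eta>))"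
    and quasi_independence:
      "\<exists>\<beta>>0. \<forall>\<alpha>>0. \<exists>Q\<^sub>0>0. \<forall>Q\<ge>Q\<^sub>0.
         Ind_dec (distr M F \<sigma>) Q (Q powr (1 + \<alpha>)) \<le> exp (- (Q powr \<beta>))"
  shows "(\<forall>v. is_time_limit M \<sigma> v (time_constant M \<sigma> v)) \<and> is_norm (time_constant M \<sigma>)"
proof -
  have M: "prob_space M" and F: "density_events F" and \<sigma> [measurable]: "\<sigma> \<in> measurable M F"
    using density unfolding random_density_def by blast+
  interpret M: prob_space M by (rule M)
  define L where "L = distr M F \<sigma>"
  have spF: "space F = UNIV" using F unfolding density_events_def by blast
  have meas_arc [measurable]: "(\<lambda>\<phi>. arc_integral \<phi> (linepath 0 x)) \<in> borel_measurable F"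
    and meas_T [measurable]: "(\<lambda>\<phi>. T \<phi> x y) \<in> borel_measurable F"
    and meas_ann: "1 < R \<Longrightarrow> (\<lambda>\<phi>. T_annulus \<phi> R) \<in> borel_measurable F" for x y R
    using F unfolding density_events_def by blast+
  interpret L: ergodic_density L
  proof (intro ergodic_density.intro ergodic_density_axioms.intro)
    show "prob_space L" unfolding L_def by (rule M.prob_space_distr) (rule \<sigma>)
    show "density_events L" using F unfolding density_events_def L_def by simp
    show "(\<integral>\<^sup>+ \<phi>. arc_integral \<phi> (linepath 0 x) \<partial>L) < \<infinity>" for x
      using finite_moment[of x] unfolding L_def by (subst nn_integral_distr) auto
    show "ergodic_translation L v" if "v \<noteq> 0" for v
      unfolding L_def using that by (rule ergodicity)
  qed
  \<comment> \<open>Both modes of convergence depend on the law only, so they pull back along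
    \<open>\<sigma>\<close>.\<close>
  have transfer: "is_time_limit M \<sigma> v c" if "is_time_limit L (\<lambda>\<phi>. \<phi>) v c" for v c
    using that unfolding is_time_limit_def
  proof (elim conjE, intro conjI)
    assume "AE \<phi> in L. (\<lambda>n. T \<phi> 0 (real n *\<^sub>R v) / of_nat n) \<longlonglongrightarrow> ennreal c"
    then show "AE \<omega> in M. (\<lambda>n. T (\<sigma> \<omega>) 0 (real n *\<^sub>R v) / of_nat n) \<longlonglongrightarrow> ennreal c"
      unfolding L_def by (rule AE_distrD[OF \<sigma>])
    assume "(\<lambda>n. \<integral>\<^sup>+ \<phi>. max (T \<phi> 0 (real n *\<^sub>R v) / of_nat n) (ennreal c)
                - min (T \<phi> 0 (real n *\<^sub>R v) / of_nat n) (ennreal c) \<partial>L) \<longlonglongrightarrow> 0"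
    moreover have "(\<integral>\<^sup>+ \<phi>. max (T \<phi> 0 (real n *\<^sub>R v) / of_nat n) (ennreal c)
                - min (T \<phi> 0 (real n *\<^sub>R v) / of_nat n) (ennreal c) \<partial>L)
        = (\<integral>\<^sup>+ \<omega>. max (T (\<sigma> \<omega>) 0 (real n *\<^sub>R v) / of_nat n) (ennreal c)
                - min (T (\<sigma> \<omega>) 0 (real n *\<^sub>R v) / of_nat n) (ennreal c) \<partial>M)" for n
      unfolding L_def by (rule nn_integral_distr) auto
    ultimately show "(\<lambda>n. \<integral>\<^sup>+ \<omega>. max (T (\<sigma> \<omega>) 0 (real n *\<^sub>R v) / of_nat n) (ennreal c)
                - min (T (\<sigma> \<omega>) 0 (real n *\<^sub>R v) / of_nat n) (ennreal c) \<partial>M) \<longlonglongrightarrow> 0" by simp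
  qed
  have tc: "is_time_limit M \<sigma> v (time_constant M \<sigma> v)"
    and tc_lim: "(\<lambda>n. L.mean_T (real n *\<^sub>R v) / real n) \<longlonglongrightarrow> time_constant M \<sigma> v" for v
  proof -
    obtain c where c: "is_time_limit L (\<lambda>\<phi>. \<phi>) v c" "(\<lambda>n. L.mean_T (real n *\<^sub>R v) / real n) \<longlonglongrightarrow> c"
      by (rule L.time_limit_exists)
    then have "time_constant M \<sigma> v = c"
      unfolding time_constant_def using is_time_limit_unique[OF M] transfer by (intro the_equality) blast+
    with c transfer show "is_time_limit M \<sigma> v (time_constant M \<sigma> v)"
      "(\<lambda>n. L.mean_T (real n *\<^sub>R v) / real n) \<longlonglongrightarrow> time_constant M \<sigma> v" by auto
  qed
  note seminorm = subadditive_limit_seminorm[of L.mean_T "time_constant M \<sigma>",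
      OF L.mean_T_subadditive L.mean_T_minus L.mean_T_nonneg L.mean_T_bounded_on_segment tc_lim]
  obtain \<eta> R\<^sub>0 where \<eta>: "0 < \<eta>" and arm: "\<And>R. R\<^sub>0 \<le> R \<Longrightarrow>
      measure M {\<omega> \<in> space M. T_annulus (\<sigma> \<omega>) R = 0} \<le> R powr (- (real CARD('d) - 1 + \<eta>))"
    using instant_one_arms by blast
  obtain \<beta> where \<beta>: "0 < \<beta>" and ind: "\<And>\<alpha>. 0 < \<alpha> \<Longrightarrow> \<exists>Q\<^sub>0>0. \<forall>Q\<ge>Q\<^sub>0.
         Ind_dec L Q (Q powr (1 + \<alpha>)) \<le> exp (- (Q powr \<beta>))"
    using quasi_independence unfolding L_def by blast
  obtain Q\<^sub>0 where Q0: "\<And>Q. Q\<^sub>0 \<le> Q \<Longrightarrow> Ind_dec L Q (Q powr (1 + 1)) \<le> exp (- (Q powr \<beta>))"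
    using ind[of 1] by auto
  \<comment> \<open>The lower bound 2 keeps \<open>R > 1\<close>, where \<open>T_annulus\<close> is
    a random variable.\<close>
  have arm_L: "L.prob {\<phi>. T_annulus \<phi> R = 0} \<le> R powr (- (real CARD('d) - 1 + \<eta>))" if "max 2 R\<^sub>0 \<le> R" for R
  proof -
    have [measurable]: "(\<lambda>\<phi>. T_annulus \<phi> R) \<in> borel_measurable F" using that by (intro meas_ann) simp
    have "{\<phi> \<in> space F. T_annulus \<phi> R = 0} \<in> sets F" by measurable
    then have "L.prob {\<phi>. T_annulus \<phi> R = 0} = measure M (\<sigma> -` {\<phi>. T_annulus \<phi> R = 0} \<inter> space M)"
      unfolding L_def by (intro measure_distr) (auto simp: spF)
    also have "\<sigma> -` {\<phi>. T_annulus \<phi> R = 0} \<inter> space M = {\<omega> \<in> space M. T_annulus (\<sigma> \<omega>) R = 0}" by auto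
    finally show ?thesis using arm[of R] that by simp
  qed
  have ind_L: "Ind_dec L Q (Q powr 2) \<le> exp (- (Q powr \<beta>))" if "Q\<^sub>0 \<le> Q" for Q
    using Q0[OF that] by simp
  obtain c R where cR: "0 < c" "filterlim R at_top sequentially" "\<And>k::nat. 1 < R k"
    "\<And>k. L.prob {\<phi>. T_annulus \<phi> (R k) < ennreal (c * R k)} \<le> 1 / 2"
    using L.linear_lower_bound_at_scales[OF \<eta> \<beta> arm_L ind_L] by blast
  have pos: "0 < time_constant M \<sigma> v" if "v \<noteq> 0" for v
    by (rule L.time_constant_pos[OF that tc_lim cR])
  have "time_constant M \<sigma> 0 = 0" using seminorm(3)[of 0 0] by simp
  then have "is_norm (time_constant M \<sigma>)"
    unfolding is_norm_def using seminorm pos by (metis less_irrefl)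
  with tc show ?thesis by blast
qed

end
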